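(* For every finite-dimensional tele-covariant multipartite channel $\mathcal{T}_{A'B'\ldots N'\to AB\ldots N}$, $$I[A;B;\ldots;N]_{\mathcal{T}}=I(R_AA;R_BB;\ldots;R_NN)_{\Phi^{\mathcal{T}}}.$$ In particular, for a tele-covariant bipartite unitary channel $\mathcal{U}_{A'B'\to AB}$, $\tfrac12 I[A;B]_{\mathcal{U}}=S(R_AA)_{\Phi^{\mathcal{U}}}=S(R_BB)_{\Phi^{\mathcal{U}}}$.
   Context: $\Phi_{RX}$ is the normalized maximally entangled state, $R_X\simeq X'$, and $\Phi^{\mathcal{T}}=\mathcal{T}(\Phi_{R_AA'}\otimes\cdots\otimes\Phi_{R_NN'})$. $D$ is the Umegaki relative entropy; $D[\mathcal{K}\Vert\mathcal{L}]:=\sup_{\rho_{RX'}}D((\mathrm{id}_R\otimes\mathcal{K})(\rho)\Vert(\mathrm{id}_R\otimes\mathcal{L})(\rho))$. For a state, $I(X_1;\ldots;X_n)_\rho:=D(\rho\Vert\rho_{X_1}\otimes\cdots\otimes\rho_{X_n})=\inf_{\omega_i}D(\rho\Vert\otimes_i\omega_i)$. For a channel, $I[A;B;\ldots;N]_{\mathcal{N}}:=\inf D[\mathcal{N}\Vert\mathcal{M}^1_{A'\to A}\otimes\cdots\otimes\mathcal{M}^n_{N'\to N}]$ over local quantum channels. A multipartite channel is tele-covariant if for each input $X'$ there is a finite group with unitary one-design representation $U^{g}_{X'}$ ($\frac{1}{|G|}\sum_gU^gYU^{g\dagger}=\operatorname{tr}(Y)\mathbbm{1}/|X'|$) and unitary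 representation $V^g_X$ on the corresponding output such that $\mathcal{T}((\otimes_X U^{g_X}_{X'})\rho(\otimes_XU^{g_X}_{X'})^\dagger)=(\otimes_XV^{g_X}_X)\mathcal{T}(\rho)(\otimes_XV^{g_X}_X)^\dagger$ for all $\rho$ and group elements. *)

theory Defs
  imports "Jordan_Normal_Form.Matrix" "HOL-Algebra.Group" "HOL-Library.Extended_Real"
begin

definition adj :: "complex mat \<Rightarrow> complex mat" where
  "adj A = mat (dim_col A) (dim_row A) (\<lambda>(i,j). cnj (A $$ (j,i)))"

definition mtrace :: "complex mat \<Rightarrow> complex" where
  "mtrace A = (\<Sum>i<dim_row A. A $$ (i,i))"

definition hermitian_mat :: "complex mat \<Rightarrow> bool" where
  "hermitian_mat A \<longleftrightarrow> dim_row A = dim_col A \<and> adj A = A"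

definition unitary_mat :: "nat \<Rightarrow> complex mat \<Rightarrow> bool" where
  "unitary_mat d W \<longleftrightarrow> W \<in> carrier_mat d d \<and> adj W * W = 1\<^sub>m d \<and> W * adj W = 1\<^sub>m d"

definition quad_form :: "complex mat \<Rightarrow> complex vec \<Rightarrow> complex" where
  "quad_form A v = (\<Sum>i<dim_row A. \<Sum>j<dim_col A. cnj (v $ i) * A $$ (i,j) * v $ j)"

definition psd_mat :: "nat \<Rightarrow> complex mat \<Rightarrow> bool" where
  "psd_mat d A \<longleftrightarrow> A \<in> carrier_mat d d \<and> hermitian_mat A \<and>
     (\<forall>v\<in>carrier_vec d. 0 \<le> Re (quad_form A v))"

definition is_state :: "nat \<Rightarrow> complex mat \<Rightarrow> bool" where
  "is_state d \<rho> \<longleftrightarrow> psd_mat d \<rho> \<and> mtrace \<rho> = 1"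

definition mat_sum :: "nat \<Rightarrow> 'i set \<Rightarrow> ('i \<Rightarrow> complex mat) \<Rightarrow> complex mat" where
  "mat_sum d S f = mat d d (\<lambda>(p,q). \<Sum>g\<in>S. f g $$ (p,q))"

definition real_diag :: "nat \<Rightarrow> (nat \<Rightarrow> real) \<Rightarrow> complex mat" where
  "real_diag d l = mat d d (\<lambda>(i,j). if i = j then complex_of_real (l i) else 0)"

definition spec_decomp :: "complex mat \<Rightarrow> complex mat \<Rightarrow> (nat \<Rightarrow> real) \<Rightarrow> bool" where
  "spec_decomp A W l \<longleftrightarrow> unitary_mat (dim_row A) W \<and> A = W * real_diag (dim_row A) l * adj W"

text \<open>f(A) for a Hermitian matrix A via a spectral decomposition (independent of the choice).\<close>
definition mat_fun :: "(real \<Rightarrow> real) \<Rightarrow> complex mat \<Rightarrow> complex mat" where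
  "mat_fun f A = (let (W, l) = (SOME (W, l). spec_decomp A W l)
                  in W * real_diag (dim_row A) (f \<circ> l) * adj W)"

text \<open>Logarithm with the usual convention of acting only on the support (log 0 := 0).\<close>
definition ln0 :: "real \<Rightarrow> real" where
  "ln0 x = (if 0 < x then ln x else 0)"

text \<open>Umegaki relative entropy D(rho||sigma); +infinity unless supp rho is contained in supp sigma.\<close>
definition rel_ent :: "complex mat \<Rightarrow> complex mat \<Rightarrow> ereal" where
  "rel_ent \<rho> \<sigma> =
     (if \<forall>v\<in>carrier_vec (dim_row \<rho>). \<sigma> *\<^sub>v v = 0\<^sub>v (dim_row \<rho>) \<longrightarrow> \<rho> *\<^sub>v v = 0\<^sub>v (dim_row \<rho>)
      then ereal (Re (mtrace (\<rho> * mat_fun ln0 \<rho>)) - Re (mtrace (\<rho> * mat_fun ln0 \<sigma>)))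
      else \<infinity>)"

definition vn_entropy :: "complex mat \<Rightarrow> real" where
  "vn_entropy \<rho> = - Re (mtrace (\<rho> * mat_fun ln0 \<rho>))"

section \<open>Multipartite systems (mixed-radix encoding, first factor most significant)\<close>

fun mr_digits :: "nat list \<Rightarrow> nat \<Rightarrow> nat list" where
  "mr_digits [] j = []"
| "mr_digits (d # ds) j = (j div prod_list ds) # mr_digits ds (j mod prod_list ds)"

definition kron :: "complex mat \<Rightarrow> complex mat \<Rightarrow> complex mat" where
  "kron A B = mat (dim_row A * dim_row B) (dim_col A * dim_col B)
     (\<lambda>(i,j). A $$ (i div dim_row B, j div dim_col B) * B $$ (i mod dim_row B, j mod dim_col B))"

definition tensor_list :: "complex mat list \<Rightarrow> complex mat" where
  "tensor_list As = foldr kron As (1\<^sub>m 1)"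

definition ptrace_keep :: "nat list \<Rightarrow> nat \<Rightarrow> complex mat \<Rightarrow> complex mat" where
  "ptrace_keep ds k \<rho> = mat (ds ! k) (ds ! k) (\<lambda>(a,b).
      \<Sum>j<prod_list ds. \<Sum>j'<prod_list ds.
        if mr_digits ds j ! k = a \<and> mr_digits ds j' ! k = b \<and>
           (\<forall>m<length ds. m \<noteq> k \<longrightarrow> mr_digits ds j ! m = mr_digits ds j' ! m)
        then \<rho> $$ (j,j') else 0)"

text \<open>Reordering of tensor factors: new factor p is old factor f p (f a permutation).\<close>
definition reorder :: "nat list \<Rightarrow> (nat \<Rightarrow> nat) \<Rightarrow> complex mat \<Rightarrow> complex mat" where
  "reorder ds f \<rho> = (let ds' = map (\<lambda>p. ds ! f p) [0..<length ds]; P = prod_list ds in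
     mat P P (\<lambda>(j,k). \<Sum>i<P. \<Sum>i'<P.
        if (\<forall>p<length ds. mr_digits ds i ! f p = mr_digits ds' j ! p \<and>
                          mr_digits ds i' ! f p = mr_digits ds' k ! p)
        then \<rho> $$ (i,i') else 0))"

text \<open>Quantum channel (CPTP map) from a d-dimensional to an e-dimensional system,
  given by a Kraus representation.\<close>
definition is_channel :: "nat \<Rightarrow> nat \<Rightarrow> (complex mat \<Rightarrow> complex mat) \<Rightarrow> bool" where
  "is_channel d e T \<longleftrightarrow> (\<exists>(m::nat) K. (\<forall>k<m. K k \<in> carrier_mat e d) \<and>
      mat_sum d {..<m} (\<lambda>k. adj (K k) * K k) = 1\<^sub>m d \<and>
      (\<forall>\<rho>\<in>carrier_mat d d. T \<rho> = mat_sum e {..<m} (\<lambda>k. K k * \<rho> * adj (K k))))"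

definition id_tensor :: "nat \<Rightarrow> nat \<Rightarrow> nat \<Rightarrow> (complex mat \<Rightarrow> complex mat) \<Rightarrow> complex mat \<Rightarrow> complex mat" where
  "id_tensor r d e T \<rho> = mat (r * e) (r * e) (\<lambda>(j,k).
     T (mat d d (\<lambda>(x,y). \<rho> $$ ((j div e) * d + x, (k div e) * d + y))) $$ (j mod e, k mod e))"

definition ket_bra :: "nat \<Rightarrow> nat \<Rightarrow> nat \<Rightarrow> complex mat" where
  "ket_bra d a b = mat d d (\<lambda>(p,q). if p = a \<and> q = b then 1 else 0)"

text \<open>Tensor product of local maps M 0, ..., M (n-1) (linear extension on product operators).\<close>
definition chan_tensor :: "nat list \<Rightarrow> nat list \<Rightarrow> (nat \<Rightarrow> complex mat \<Rightarrow> complex mat) \<Rightarrow> complex mat \<Rightarrow> complex mat" where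
  "chan_tensor dI dO M \<rho> = mat (prod_list dO) (prod_list dO) (\<lambda>(j,k).
     \<Sum>x<prod_list dI. \<Sum>y<prod_list dI. \<rho> $$ (x,y) *
       (\<Prod>i<length dI. M i (ket_bra (dI ! i) (mr_digits dI x ! i) (mr_digits dI y ! i))
                          $$ (mr_digits dO j ! i, mr_digits dO k ! i)))"

definition chan_div :: "nat \<Rightarrow> nat \<Rightarrow> (complex mat \<Rightarrow> complex mat) \<Rightarrow> (complex mat \<Rightarrow> complex mat) \<Rightarrow> ereal" where
  "chan_div d e K L = (SUP p \<in> {(r, \<rho>). is_state (r * d) \<rho>}.
      rel_ent (id_tensor (fst p) d e K (snd p)) (id_tensor (fst p) d e L (snd p)))"

definition chan_mi :: "nat list \<Rightarrow> nat list \<Rightarrow> (complex mat \<Rightarrow> complex mat) \<Rightarrow> ereal" where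
  "chan_mi dI dO T = (INF M \<in> {M. \<forall>i<length dI. is_channel (dI ! i) (dO ! i) (M i)}.
      chan_div (prod_list dI) (prod_list dO) T (chan_tensor dI dO M))"

definition state_mi :: "nat list \<Rightarrow> complex mat \<Rightarrow> ereal" where
  "state_mi ds \<rho> = rel_ent \<rho> (tensor_list (map (\<lambda>k. ptrace_keep ds k \<rho>) [0..<length ds]))"

definition max_ent :: "nat \<Rightarrow> complex mat" where
  "max_ent d = mat (d * d) (d * d) (\<lambda>(j,k).
     if j div d = j mod d \<and> k div d = k mod d then complex_of_real (1 / real d) else 0)"

definition blocked_of_interleaved :: "nat \<Rightarrow> nat \<Rightarrow> nat" where
  "blocked_of_interleaved n p = (if p < n then 2 * p else 2 * (p - n) + 1)"

definition interleaved_of_blocked :: "nat \<Rightarrow> nat \<Rightarrow> nat" where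
  "interleaved_of_blocked n q = (if even q then q div 2 else n + q div 2)"

text \<open>Phi^T = T(Phi_{R_1 X'_1} \<otimes> ... \<otimes> Phi_{R_n X'_n}), as a state on the factors
  (R_1 X_1), ..., (R_n X_n) (each pair grouped into one factor of dimension dI!i * dO!i).\<close>
definition choi_state :: "nat list \<Rightarrow> nat list \<Rightarrow> (complex mat \<Rightarrow> complex mat) \<Rightarrow> complex mat" where
  "choi_state dI dO T = (let n = length dI;
      \<Phi>in = tensor_list (map max_ent dI);
      \<Phi>blk = reorder (concat (map (\<lambda>d. [d, d]) dI)) (blocked_of_interleaved n) \<Phi>in;
      \<Phi>out = id_tensor (prod_list dI) (prod_list dI) (prod_list dO) T \<Phi>blk
    in reorder (dI @ dO) (interleaved_of_blocked n) \<Phi>out)"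

definition grouped_dims :: "nat list \<Rightarrow> nat list \<Rightarrow> nat list" where
  "grouped_dims dI dO = map (\<lambda>i. dI ! i * dO ! i) [0..<length dI]"

definition tele_covariant ::
  "nat list \<Rightarrow> nat list \<Rightarrow> (complex mat \<Rightarrow> complex mat) \<Rightarrow> (nat \<Rightarrow> 'g monoid) \<Rightarrow>
   (nat \<Rightarrow> 'g \<Rightarrow> complex mat) \<Rightarrow> (nat \<Rightarrow> 'g \<Rightarrow> complex mat) \<Rightarrow> bool" where
  "tele_covariant dI dO T G U V \<longleftrightarrow>
     (\<forall>i<length dI.
        group (G i) \<and> finite (carrier (G i)) \<and>
        (\<forall>g\<in>carrier (G i). unitary_mat (dI ! i) (U i g) \<and> unitary_mat (dO ! i) (V i g)) \<and>
        (\<forall>g\<in>carrier (G i). \<forall>h\<in>carrier (G i).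
            U i (g \<otimes>\<^bsub>G i\<^esub> h) = U i g * U i h \<and> V i (g \<otimes>\<^bsub>G i\<^esub> h) = V i g * V i h) \<and>
        (\<forall>Y\<in>carrier_mat (dI ! i) (dI ! i).
            (1 / of_nat (card (carrier (G i)))) \<cdot>\<^sub>m
               mat_sum (dI ! i) (carrier (G i)) (\<lambda>g. U i g * Y * adj (U i g))
            = (mtrace Y / of_nat (dI ! i)) \<cdot>\<^sub>m 1\<^sub>m (dI ! i))) \<and>
     (\<forall>gs. (\<forall>i<length dI. gs i \<in> carrier (G i)) \<longrightarrow>
        (\<forall>\<rho>. is_state (prod_list dI) \<rho> \<longrightarrow>
           (let Ug = tensor_list (map (\<lambda>i. U i (gs i)) [0..<length dI]);
                Vg = tensor_list (map (\<lambda>i. V i (gs i)) [0..<length dI])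
            in T (Ug * \<rho> * adj Ug) = Vg * T \<rho> * adj Vg)))"

end

theory Submission
  imports Defs "Jordan_Normal_Form.Schur_Decomposition" "Jordan_Normal_Form.Spectral_Radius"
begin

text \<open>
  Lower bound: tested on the maximally entangled input, \<open>T\<close> and a product of local channels give the
  Choi state of \<open>T\<close> and a product state, and among products the marginals are optimal, since
  \<open>D(\<rho> || \<Otimes>\<omega>\<^sub>i) - D(\<rho> || \<Otimes>\<rho>\<^sub>i) = \<Sum>i. D(\<rho>\<^sub>i || \<omega>\<^sub>i) \<ge> 0\<close>.

  Upper bound: the marginals of the Choi state are Choi states of local channels with the same
  covariance. For covariant channels every output is obtained from the Choi state by one and the same
  channel (twirl, then filter the reference), so monotonicity of the relative entropy
  makes the maximally entangled input optimal.

  Monotonicity: \<open>D\<close> is an integral over \<open>t > 0\<close> of the quantities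
  \<open>sup X. 2 Re tr(\<rho>X) - tr(\<sigma>XX\<^sup>*) - t tr(\<rho>X\<^sup>*X)\<close>, and these decrease under channels by the
  Kadison--Schwarz inequality for the dual map.

  A unitary channel has a pure Choi state, whose two marginals have the same entropy.
\<close>

section \<open>Matrices and the spectral theorem\<close>


text \<open>The integral formula is convenient because both states enter it only through their
  eigenvalues and the overlaps of their eigenbases: for fixed t the supremum over X splits into one
  quadratic problem per pair of eigenvectors and has the value \<Sum>i j. |<w_i|z_j>|^2 p_i^2 / (q_j
  + t p_i). The integration is carried out as a mean value argument followed by a limit, so all
  analysis concerns finite real sums, with infinite values treated as a separate support condition.
  Bookkeeping shapes the second half. \<open>choi_state\<close> contains two permutations of tensor
  factors, and \<open>chan_tensor\<close> is defined by its action on matrix units and not by Kraus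
  operators. Both are met by describing a map through its coefficients on matrix units; positivity
  and normalisation are then read off the Choi matrix in the grouped ordering. Covariance is assumed
  on states only and is extended to matrix units. The local groups act independently, so the twirl
  runs over all tuples of group elements. Inputs may be mixed and have a reference of any dimension
  r; they enter through a Gram decomposition.\<close>

lemma sum_rotate:
  "(\<Sum>i\<in>A. \<Sum>j\<in>B. \<Sum>k\<in>C. f i j k) = (\<Sum>k\<in>C. \<Sum>i\<in>A. \<Sum>j\<in>B. f i j k)"
  by (subst sum.swap[of _ C]) (intro sum.cong refl sum.swap)

lemma adj_carrier [simp, intro]: "A \<in> carrier_mat n m \<Longrightarrow> adj A \<in> carrier_mat m n"
  by (auto simp: adj_def)

lemma dim_adj [simp]: "dim_row (adj A) = dim_col A" "dim_col (adj A) = dim_row A"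
  by (auto simp: adj_def)

lemma index_adj [simp]: "i < dim_col A \<Longrightarrow> j < dim_row A \<Longrightarrow> adj A $$ (i,j) = cnj (A $$ (j,i))"
  by (auto simp: adj_def)

lemma adj_adj [simp]: "adj (adj A) = A"
  by (rule eq_matI) auto

text \<open>The side conditions are dimension equations without free dimension variables, so the
  rule can be used for rewriting; together with \<open>adj_mult_dim\<close> it brings long products
  to a normal form.\<close>

lemma mat_assoc:
  "dim_col A = dim_row B \<Longrightarrow> dim_col B = dim_row C \<Longrightarrow> A * B * C = A * (B * C)" for A :: "complex mat"
  by (rule assoc_mult_mat[of _ "dim_row A" "dim_col A" _ "dim_col B" _ "dim_col C"]) auto

lemma adj_one [simp]: "adj (1\<^sub>m n) = 1\<^sub>m n"
  by (rule eq_matI) auto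

lemma index_mult_sum:
  assumes "A \<in> carrier_mat n m" "B \<in> carrier_mat m p" "i < n" "j < p"
  shows "(A * B) $$ (i,j) = (\<Sum>k<m. A $$ (i,k) * B $$ (k,j))"
  using assms by (auto simp: scalar_prod_def atLeast0LessThan intro!: sum.cong)

lemma index_triple_sum:
  assumes "A \<in> carrier_mat n m" "B \<in> carrier_mat m p" "C \<in> carrier_mat p q" "i < n" "j < q"
  shows "(A * B * C) $$ (i,j) = (\<Sum>k<m. \<Sum>l<p. A $$ (i,k) * B $$ (k,l) * C $$ (l,j))"
proof -
  have "(A * B * C) $$ (i,j) = (\<Sum>l<p. (\<Sum>k<m. A $$ (i,k) * B $$ (k,l)) * C $$ (l,j))"
    using assms by (subst index_mult_sum[of _ n p _ q])
      (auto intro!: sum.cong simp del: index_mult_mat(1) simp: index_mult_sum[of _ n m _ p])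
  also have "\<dots> = (\<Sum>k<m. \<Sum>l<p. A $$ (i,k) * B $$ (k,l) * C $$ (l,j))"
    by (subst sum.swap) (simp add: sum_distrib_right)
  finally show ?thesis .
qed

lemma index_conj_sum:
  assumes "A \<in> carrier_mat n m" "B \<in> carrier_mat m m" "i < n" "j < n"
  shows "(A * B * adj A) $$ (i,j) = (\<Sum>k<m. \<Sum>l<m. A $$ (i,k) * B $$ (k,l) * cnj (A $$ (j,l)))"
  using assms by (subst index_triple_sum[of _ n m _ m _ n]) (auto intro!: sum.cong)

lemma index_adj_conj_sum:
  assumes "A \<in> carrier_mat m n" "B \<in> carrier_mat m m" "i < n" "j < n"
  shows "(adj A * B * A) $$ (i,j) = (\<Sum>k<m. \<Sum>l<m. cnj (A $$ (k,i)) * B $$ (k,l) * A $$ (l,j))"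
  using assms by (subst index_triple_sum[of _ n m _ m _ n]) (auto intro!: sum.cong)

lemma adj_mult:
  assumes "A \<in> carrier_mat n m" "B \<in> carrier_mat m p"
  shows "adj (A * B) = adj B * adj A"
proof (rule eq_matI)
  fix i j assume "i < dim_row (adj B * adj A)" "j < dim_col (adj B * adj A)"
  then have ij: "i < p" "j < n" using assms by auto
  then show "adj (A * B) $$ (i,j) = (adj B * adj A) $$ (i,j)"
    using assms
    by (simp del: index_mult_mat(1) add: index_mult_sum[OF assms] index_mult_sum[of _ p m _ n] mult.commute)
qed (use assms in auto)

lemma adj_mult_dim: "dim_col A = dim_row B \<Longrightarrow> adj (A * B) = adj B * adj A"
  by (rule adj_mult[of _ "dim_row A" "dim_col A" _ "dim_col B"]) auto

lemma carrier_dims: "A \<in> carrier_mat n m \<Longrightarrow> dim_row A = n \<and> dim_col A = m"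
  by auto

lemma mult_one_dim [simp]:
  "dim_row A = n \<Longrightarrow> 1\<^sub>m n * A = A" "dim_col A = n \<Longrightarrow> A * 1\<^sub>m n = A" for A :: "complex mat"
  by auto

lemmas mat_algebra = mat_assoc adj_mult_dim

lemma mtrace_comm:
  assumes "A \<in> carrier_mat n m" "B \<in> carrier_mat m n"
  shows "mtrace (A * B) = mtrace (B * A)"
proof -
  have "mtrace (A * B) = (\<Sum>i<n. \<Sum>k<m. A $$ (i,k) * B $$ (k,i))"
    using assms by (auto simp: mtrace_def index_mult_sum[OF assms] simp del: index_mult_mat(1) intro!: sum.cong)
  also have "\<dots> = (\<Sum>k<m. \<Sum>i<n. B $$ (k,i) * A $$ (i,k))"
    by (subst sum.swap) (simp add: mult.commute)
  also have "\<dots> = mtrace (B * A)"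
    using assms by (auto simp: mtrace_def index_mult_sum[OF assms(2,1)] simp del: index_mult_mat(1) intro!: sum.cong)
  finally show ?thesis .
qed

lemma real_diag_carrier [simp, intro]: "real_diag d l \<in> carrier_mat d d"
  by (auto simp: real_diag_def)

lemma dim_real_diag [simp]: "dim_row (real_diag d l) = d" "dim_col (real_diag d l) = d"
  by (auto simp: real_diag_def)

lemma index_real_diag [simp]:
  "i < d \<Longrightarrow> j < d \<Longrightarrow> real_diag d l $$ (i,j) = (if i = j then complex_of_real (l i) else 0)"
  by (auto simp: real_diag_def)

lemma unitary_matD:
  assumes "unitary_mat d W"
  shows "W \<in> carrier_mat d d" "adj W * W = 1\<^sub>m d" "W * adj W = 1\<^sub>m d"
  using assms by (auto simp: unitary_mat_def)

lemma unitary_mat_adj: "unitary_mat d W \<Longrightarrow> unitary_mat d (adj W)"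
  by (auto simp: unitary_mat_def)

lemma unitary_mat_mult:
  assumes "unitary_mat d A" "unitary_mat d B"
  shows "unitary_mat d (A * B)"
proof -
  note A = unitary_matD[OF assms(1)] and B = unitary_matD[OF assms(2)]
  have "adj (A * B) * (A * B) = adj B * ((adj A * A) * B)"
    using A(1) B(1) by (auto dest!: carrier_dims intro!: carrier_matI simp: mat_algebra)
  moreover have "(A * B) * adj (A * B) = A * ((B * adj B) * adj A)"
    using A(1) B(1) by (auto dest!: carrier_dims intro!: carrier_matI simp: mat_algebra)
  ultimately show ?thesis using A B by (simp add: unitary_mat_def)
qed

text \<open>For square matrices a left inverse is also a right inverse.\<close>

lemma unitary_matI:
  assumes "W \<in> carrier_mat d d" "adj W * W = 1\<^sub>m d"
  shows "unitary_mat d W"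
  using assms mat_mult_left_right_inverse[of "adj W" d W] by (auto simp: unitary_mat_def)

lemma unitary_mat_one: "unitary_mat d (1\<^sub>m d)"
  by (auto simp: unitary_mat_def)

lemma unitary_orthonormal_cols:
  assumes "unitary_mat d W" "i < d" "j < d"
  shows "(\<Sum>k<d. cnj (W $$ (k,i)) * W $$ (k,j)) = (if i = j then 1 else 0)"
proof -
  note W = unitary_matD[OF assms(1)]
  have "(adj W * W) $$ (i,j) = (\<Sum>k<d. cnj (W $$ (k,i)) * W $$ (k,j))"
    using W(1) assms by (subst index_mult_sum[of _ d d _ d]) (auto intro!: sum.cong)
  then show ?thesis using W(2) assms by simp
qed

lemma unitary_orthonormal_rows:
  assumes "unitary_mat d W" "i < d" "j < d"
  shows "(\<Sum>k<d. W $$ (i,k) * cnj (W $$ (j,k))) = (if i = j then 1 else 0)"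
proof -
  note W = unitary_matD[OF assms(1)]
  have "(W * adj W) $$ (i,j) = (\<Sum>k<d. W $$ (i,k) * cnj (W $$ (j,k)))"
    using W(1) assms by (subst index_mult_sum[of _ d d _ d]) (auto intro!: sum.cong)
  then show ?thesis using W(3) assms by simp
qed

lemma hermitian_index:
  "hermitian_mat A \<Longrightarrow> i < dim_row A \<Longrightarrow> j < dim_row A \<Longrightarrow> cnj (A $$ (i,j)) = A $$ (j,i)"
  by (metis hermitian_mat_def index_adj)

lemma hermitian_conj:
  assumes "hermitian_mat A" "A \<in> carrier_mat n n" "W \<in> carrier_mat n m"
  shows "hermitian_mat (adj W * A * W)"
  using assms by (auto dest!: carrier_dims intro!: carrier_matI simp: hermitian_mat_def mat_algebra)

text \<open>Gram--Schmidt only produces orthogonal columns, so they are normalised here.\<close>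
lemma ex_unitary_first_col:
  fixes v :: "complex vec"
  assumes v: "v \<in> carrier_vec n" and v0: "v \<noteq> 0\<^sub>v n"
  obtains W c where "unitary_mat n W" "\<And>i. i < n \<Longrightarrow> W $$ (i,0) = c * v $ i"
proof -
  interpret cof_vec_space n "TYPE(complex)" .
  define b where "b = basis_completion v"
  define ws where "ws = gram_schmidt n b"
  have n0: "n \<noteq> 0" using v v0 by (auto simp: vec_eq_iff)
  from basis_completion[OF v v0, folded b_def]
  have dist_b: "distinct b" and indep: "\<not> lin_dep (set b)" and b: "set b \<subseteq> carrier_vec n"
    and hdb: "hd b = v" and len_b: "length b = n" by auto
  from hdb len_b n0 obtain vs where bv: "b = v # vs" by (cases b, auto)
  from gram_schmidt_result[OF b dist_b indep refl, folded ws_def]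
  have ws: "set ws \<subseteq> carrier_vec n" "corthogonal ws" "length ws = n"
    by (auto simp: len_b)
  from gram_schmidt_hd[OF v, of vs, folded bv] have "hd ws = v" unfolding ws_def .
  then have ws0: "ws ! 0 = v" using ws(3) n0 by (cases ws) auto
  have wsc: "ws ! j \<in> carrier_vec n" if "j < n" for j using ws that by auto
  define N where "N j = (\<Sum>k<n. (cmod (ws ! j $ k))^2)" for j
  have ip: "ws ! i \<bullet>c ws ! j = (\<Sum>k<n. ws ! i $ k * cnj (ws ! j $ k))" if "i < n" "j < n" for i j
    using wsc[OF that(1)] wsc[OF that(2)] by (auto simp: scalar_prod_def atLeast0LessThan intro!: sum.cong)
  have ipN: "ws ! i \<bullet>c ws ! i = complex_of_real (N i)" if "i < n" for i
    using that by (simp add: ip N_def complex_norm_square[symmetric])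
  have Npos: "N i > 0" if "i < n" for i
  proof -
    have "N i \<noteq> 0" using corthogonalD[OF ws(2), of i i] ipN[OF that] that ws(3) by auto
    moreover have "N i \<ge> 0" by (auto simp: N_def intro!: sum_nonneg)
    ultimately show ?thesis by simp
  qed
  define W where "W = mat n n (\<lambda>(i,j). complex_of_real (1 / sqrt (N j)) * ws ! j $ i)"
  have Wc: "W \<in> carrier_mat n n" by (simp add: W_def)
  have "adj W * W = 1\<^sub>m n"
  proof (rule eq_matI)
    fix i j assume "i < dim_row (1\<^sub>m n)" "j < dim_col (1\<^sub>m n)"
    then have ij: "i < n" "j < n" by auto
    have "(adj W * W) $$ (i,j) = (\<Sum>k<n. cnj (W $$ (k,i)) * W $$ (k,j))"
      using ij Wc by (subst index_mult_sum[of _ n n _ n]) (auto intro!: sum.cong)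
    also have "\<dots> = complex_of_real (1 / sqrt (N i) * (1 / sqrt (N j))) * (ws ! j \<bullet>c ws ! i)"
      using ij by (simp add: W_def ip sum_distrib_left mult_ac)
    also have "\<dots> = (if i = j then 1 else 0)"
    proof (cases "i = j")
      case True
      have s: "sqrt (N j) * sqrt (N j) = N j" using Npos[OF ij(2)] by simp
      have "1 / sqrt (N j) * (1 / sqrt (N j)) * N j = 1" using Npos[OF ij(2)] s by (simp add: field_simps)
      then show ?thesis using True ij ipN[of j] by (metis of_real_1 of_real_mult)
    next
      case False
      then show ?thesis using corthogonalD[OF ws(2), of j i] ws(3) ij by simp
    qed
    finally show "(adj W * W) $$ (i,j) = 1\<^sub>m n $$ (i,j)" using ij by simp
  qed (use Wc in auto)
  from unitary_matI[OF Wc this] have "unitary_mat n W" .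
  moreover have "W $$ (i,0) = complex_of_real (1 / sqrt (N 0)) * v $ i" if "i < n" for i
    using that n0 by (simp add: W_def ws0)
  ultimately show ?thesis using that by blast
qed

lemma spec_decompI:
  assumes "A \<in> carrier_mat d d" "unitary_mat d W" "adj W * A * W = real_diag d l"
  shows "spec_decomp A W l"
proof -
  note W = unitary_matD[OF assms(2)]
  have "W * real_diag d l * adj W = (W * adj W) * A * (W * adj W)"
    unfolding assms(3)[symmetric] using W(1) assms(1)
    by (auto dest!: carrier_dims intro!: carrier_matI simp: mat_algebra)
  then show ?thesis using assms W by (simp add: spec_decomp_def)
qed

text \<open>Deflation, by induction on the dimension: an eigenvector is completed to a unitary,
  conjugation by it clears the first column below the diagonal, hermiticity clears the first row as
  well, and the remaining block is Hermitian again.\<close>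

lemma hermitian_spec_decomp:
  assumes "hermitian_mat A" "A \<in> carrier_mat n n"
  shows "\<exists>W l. spec_decomp A W l"
  using assms
proof (induction n arbitrary: A)
  case 0
  have "spec_decomp A (1\<^sub>m 0) (\<lambda>_. 0)"
    by (rule spec_decompI[of _ 0]) (use 0 in \<open>auto intro!: unitary_mat_one eq_matI\<close>)
  then show ?case by blast
next
  case (Suc m)
  let ?n = "Suc m"
  note A = Suc.prems(2)
  from spectrum_non_empty[OF A] obtain e where "e \<in> spectrum A" by auto
  then obtain v where v: "v \<in> carrier_vec ?n" "v \<noteq> 0\<^sub>v ?n" "A *\<^sub>v v = e \<cdot>\<^sub>v v"
    using A by (auto simp: spectrum_def eigenvalue_def eigenvector_def)
  from ex_unitary_first_col[OF v(1,2)] obtain W c where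
    W: "unitary_mat ?n W" and W0: "\<And>i. i < ?n \<Longrightarrow> W $$ (i,0) = c * v $ i" by metis
  note Wd = unitary_matD[OF W]
  define A' where "A' = adj W * A * W"
  have A': "A' \<in> carrier_mat ?n ?n" using Wd(1) A by (auto dest!: carrier_dims intro!: carrier_matI simp: A'_def mat_algebra)
  have hA': "hermitian_mat A'" unfolding A'_def by (rule hermitian_conj[OF Suc.prems(1) A Wd(1)])
  have AW0: "(\<Sum>l<?n. A $$ (k,l) * W $$ (l,0)) = e * W $$ (k,0)" if k: "k < ?n" for k
  proof -
    have "(\<Sum>l<?n. A $$ (k,l) * v $ l) = (A *\<^sub>v v) $ k"
      using A v(1) k by (auto simp: scalar_prod_def atLeast0LessThan intro!: sum.cong)
    then have "(\<Sum>l<?n. A $$ (k,l) * v $ l) = e * v $ k" using v k by simp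
    moreover have "(\<Sum>l<?n. A $$ (k,l) * W $$ (l,0)) = c * (\<Sum>l<?n. A $$ (k,l) * v $ l)"
      by (simp add: W0 sum_distrib_left mult_ac del: sum.lessThan_Suc)
    ultimately show ?thesis using k by (simp add: W0)
  qed
  have col0: "A' $$ (i,0) = (if i = 0 then e else 0)" if i: "i < ?n" for i
  proof -
    have "A' $$ (i,0) = (\<Sum>k<?n. cnj (W $$ (k,i)) * (\<Sum>l<?n. A $$ (k,l) * W $$ (l,0)))"
      unfolding A'_def using Wd(1) A i
      by (subst index_adj_conj_sum) (auto simp: sum_distrib_left mult.assoc simp del: sum.lessThan_Suc)
    also have "\<dots> = e * (\<Sum>k<?n. cnj (W $$ (k,i)) * W $$ (k,0))"
      by (simp add: AW0 sum_distrib_left mult_ac del: sum.lessThan_Suc)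
    also have "\<dots> = (if i = 0 then e else 0)"
      using unitary_orthonormal_cols[OF W i, of 0] by simp
    finally show ?thesis .
  qed
  have row0: "A' $$ (0,i) = (if i = 0 then e else 0)" if i: "i < ?n" for i
  proof -
    have "A' $$ (0,i) = cnj (A' $$ (i,0))" "A' $$ (0,0) = cnj (A' $$ (0,0))"
      using hermitian_index[OF hA'] i A' by auto
    then show ?thesis using col0[OF i] col0[of 0] by auto
  qed
  define A3 where "A3 = mat m m (\<lambda>(i,j). A' $$ (Suc i, Suc j))"
  have A3: "A3 \<in> carrier_mat m m" by (simp add: A3_def)
  have "hermitian_mat A3"
    unfolding hermitian_mat_def
  proof (intro conjI eq_matI)
    fix i j assume "i < dim_row A3" "j < dim_col A3"
    then show "adj A3 $$ (i,j) = A3 $$ (i,j)"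
      using hermitian_index[OF hA', of "Suc j" "Suc i"] A' by (simp add: A3_def)
  qed (auto simp: A3_def)
  from Suc.IH[OF this A3] obtain W3 l3 where s3: "spec_decomp A3 W3 l3" by blast
  then have W3: "unitary_mat m W3" and A3eq: "A3 = W3 * real_diag m l3 * adj W3"
    using A3 by (auto simp: spec_decomp_def)
  note W3d = unitary_matD[OF W3]
  \<comment> \<open>The diagonalising unitary of the smaller block, bordered by a 1 in the corner so
    that the eigenvector already split off stays fixed.\<close>
  define Wb where "Wb = mat ?n ?n (\<lambda>(i,j). if i = 0 then (if j = 0 then 1 else 0)
      else if j = 0 then 0 else W3 $$ (i-1,j-1))"
  have Wbc: "Wb \<in> carrier_mat ?n ?n" by (simp add: Wb_def)
  have Wb: "unitary_mat ?n Wb"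
  proof (rule unitary_matI[OF Wbc], rule eq_matI)
    fix i j assume "i < dim_row (1\<^sub>m ?n)" "j < dim_col (1\<^sub>m ?n)"
    then have ij: "i < ?n" "j < ?n" by auto
    have "(adj Wb * Wb) $$ (i,j) = (\<Sum>k<?n. cnj (Wb $$ (k,i)) * Wb $$ (k,j))"
      using ij Wbc by (subst index_mult_sum[of _ ?n ?n _ ?n]) (auto intro!: sum.cong simp del: sum.lessThan_Suc)
    also have "\<dots> = (if i = j then 1 else 0)"
      unfolding sum.lessThan_Suc_shift using ij
      by (cases i; cases j) (auto simp: Wb_def unitary_orthonormal_cols[OF W3])
    finally show "(adj Wb * Wb) $$ (i,j) = 1\<^sub>m ?n $$ (i,j)" using ij by simp
  qed (use Wbc in auto)
  define l where "l i = (if i = 0 then Re e else l3 (i - 1))" for i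
  \<comment> \<open>A diagonal entry of a Hermitian matrix is real, so the eigenvalue can be stored
    as the real number \<open>Re e\<close>.\<close>
  have ee: "e = complex_of_real (Re e)"
    using hermitian_index[OF hA', of 0 0] col0[of 0] A' by (simp add: complex_eq_iff)
  have D3: "adj W3 * A3 * W3 = real_diag m l3"
  proof -
    have "adj W3 * A3 * W3 = (adj W3 * W3) * real_diag m l3 * (adj W3 * W3)"
      unfolding A3eq using W3d(1) by (auto dest!: carrier_dims intro!: carrier_matI simp: mat_algebra)
    then show ?thesis using W3d by simp
  qed
  have "adj Wb * A' * Wb = real_diag ?n l"
  proof (rule eq_matI)
    fix i j assume "i < dim_row (real_diag ?n l)" "j < dim_col (real_diag ?n l)"
    then have ij: "i < ?n" "j < ?n" by auto
    have "(adj Wb * A' * Wb) $$ (i,j) = (\<Sum>k<?n. \<Sum>l<?n. cnj (Wb $$ (k,i)) * A' $$ (k,l) * Wb $$ (l,j))"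
      by (rule index_adj_conj_sum[OF Wbc A' ij])
    also have "\<dots> = real_diag ?n l $$ (i,j)"
    proof (cases i)
      case 0
      then show ?thesis unfolding sum.lessThan_Suc_shift using ij row0 col0 ee
        by (cases j) (auto simp: Wb_def l_def)
    next
      case (Suc i')
      show ?thesis
      proof (cases j)
        case 0
        then show ?thesis unfolding sum.lessThan_Suc_shift using ij row0 col0 ee Suc
          by (auto simp: Wb_def l_def)
      next
        case (Suc j')
        have ij': "i' < m" "j' < m" using ij \<open>i = Suc i'\<close> Suc by auto
        have "(\<Sum>k<m. \<Sum>l<m. cnj (W3 $$ (k,i')) * A3 $$ (k,l) * W3 $$ (l,j')) = real_diag m l3 $$ (i',j')"
          using index_adj_conj_sum[OF W3d(1) A3 ij'] D3 by simp
        then show ?thesis unfolding sum.lessThan_Suc_shift using ij row0 col0 ee Suc \<open>i = Suc i'\<close> ij'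
          by (auto simp: Wb_def l_def A3_def)
      qed
    qed
    finally show "(adj Wb * A' * Wb) $$ (i,j) = real_diag ?n l $$ (i,j)" .
  qed (use Wbc in auto)
  moreover have "adj (W * Wb) * A * (W * Wb) = adj Wb * A' * Wb"
    using Wd(1) Wbc A unfolding A'_def
    by (auto dest!: carrier_dims intro!: carrier_matI simp: mat_algebra)
  ultimately have "spec_decomp A (W * Wb) l"
    by (intro spec_decompI[OF A unitary_mat_mult[OF W Wb]]) simp
  then show ?case by blast
qed

section \<open>Functional calculus\<close>

lemma spec_decompD:
  assumes "spec_decomp A W l" "A \<in> carrier_mat d d"
  shows "unitary_mat d W" "W \<in> carrier_mat d d" "A = W * real_diag d l * adj W"
    "adj W * A * W = real_diag d l"
proof -
  show W: "unitary_mat d W" and A: "A = W * real_diag d l * adj W"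
    using assms by (auto simp: spec_decomp_def)
  note Wd = unitary_matD[OF W]
  show "W \<in> carrier_mat d d" by fact
  have "adj W * A * W = (adj W * W) * real_diag d l * (adj W * W)"
    unfolding A using Wd(1) by (auto dest!: carrier_dims intro!: carrier_matI simp: mat_algebra)
  then show "adj W * A * W = real_diag d l" using Wd by simp
qed

lemma mult_diag_conj_index:
  assumes "W \<in> carrier_mat n d" "i < n" "j < n"
  shows "(W * real_diag d l * adj W) $$ (i,j) = (\<Sum>k<d. complex_of_real (l k) * W $$ (i,k) * cnj (W $$ (j,k)))"
proof -
  have "(W * real_diag d l * adj W) $$ (i,j) =
     (\<Sum>k<d. \<Sum>m<d. W $$ (i,k) * real_diag d l $$ (k,m) * cnj (W $$ (j,m)))"
    using assms by (subst index_conj_sum) auto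
  then show ?thesis by (simp add: if_distrib if_distribR mult_ac cong: if_cong)
qed

lemma spec_decomp_index:
  assumes "spec_decomp A W l" "A \<in> carrier_mat d d" "i < d" "j < d"
  shows "A $$ (i,j) = (\<Sum>k<d. complex_of_real (l k) * W $$ (i,k) * cnj (W $$ (j,k)))"
  using mult_diag_conj_index[OF spec_decompD(2)[OF assms(1,2)] assms(3,4), of l]
    spec_decompD(3)[OF assms(1,2)] by simp

text \<open>Independence of the decomposition picked by \<open>SOME\<close>. The change of basis
  \<open>Y\<close> between two decompositions intertwines the two diagonal matrices, so its entries
  vanish except between equal eigenvalues; on equal eigenvalues \<open>f\<close> agrees, and
  \<open>Y\<close> intertwines the images under \<open>f\<close> too.\<close>

lemma mat_fun_eq:
  assumes "spec_decomp A W l" "A \<in> carrier_mat d d"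
  shows "mat_fun f A = W * real_diag d (f \<circ> l) * adj W"
proof -
  obtain W' l' where W'l': "(SOME (W, l). spec_decomp A W l) = (W', l')" by fastforce
  have "case (SOME (W, l). spec_decomp A W l) of (W, l) \<Rightarrow> spec_decomp A W l"
    by (rule someI[where P = "\<lambda>(W, l). spec_decomp A W l" and x = "(W, l)"]) (use assms in simp)
  then have s': "spec_decomp A W' l'" using W'l' by simp
  note d = spec_decompD[OF assms] and d' = spec_decompD[OF s' assms(2)]
  note u = unitary_matD[OF d(1)] and u' = unitary_matD[OF d'(1)]
  define Y where "Y = adj W' * W"
  have Y: "Y \<in> carrier_mat d d" using u(1) u'(1) by (auto dest!: carrier_dims intro!: carrier_matI simp: Y_def mat_algebra)
  have "real_diag d l' * Y = adj W' * A * (W' * adj W') * W"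
    unfolding d'(4)[symmetric] Y_def using u(1) u'(1) assms(2)
    by (auto dest!: carrier_dims intro!: carrier_matI simp: mat_algebra)
  also have "\<dots> = adj W' * (W * real_diag d l * adj W) * W"
    using u'(1,3) u(1) assms(2) d(3) by simp
  also have "\<dots> = Y * real_diag d l * (adj W * W)"
    unfolding Y_def using u(1) u'(1) by (auto dest!: carrier_dims intro!: carrier_matI simp: mat_algebra)
  finally have comm: "real_diag d l' * Y = Y * real_diag d l"
    using u(2) Y by simp
  have "real_diag d (f \<circ> l') * Y = Y * real_diag d (f \<circ> l)"
  proof (rule eq_matI)
    fix i j assume "i < dim_row (Y * real_diag d (f \<circ> l))" "j < dim_col (Y * real_diag d (f \<circ> l))"
    then have ij: "i < d" "j < d" using Y by auto
    have 1: "(real_diag d g * Y) $$ (i,j) = complex_of_real (g i) * Y $$ (i,j)" for g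
      using ij Y by (subst index_mult_sum[of _ d d _ d]) (auto simp: if_distrib if_distribR cong: if_cong)
    have 2: "(Y * real_diag d g) $$ (i,j) = complex_of_real (g j) * Y $$ (i,j)" for g
      using ij Y by (subst index_mult_sum[of _ d d _ d])
        (auto simp: if_distrib if_distribR mult.commute cong: if_cong)
    from comm have "complex_of_real (l' i) * Y $$ (i,j) = complex_of_real (l j) * Y $$ (i,j)"
      using 1 2 by metis
    then show "(real_diag d (f \<circ> l') * Y) $$ (i,j) = (Y * real_diag d (f \<circ> l)) $$ (i,j)"
      unfolding 1 2 by auto
  qed (use Y in auto)
  then have "W' * (real_diag d (f \<circ> l') * Y) * adj W = W' * (Y * real_diag d (f \<circ> l)) * adj W" by simp
  moreover have "W' * (real_diag d (f \<circ> l') * Y) * adj W = W' * real_diag d (f \<circ> l') * adj W' * (W * adj W)"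
    unfolding Y_def using u(1) u'(1) by (auto dest!: carrier_dims intro!: carrier_matI simp: mat_algebra)
  moreover have "W' * (Y * real_diag d (f \<circ> l)) * adj W = (W' * adj W') * W * real_diag d (f \<circ> l) * adj W"
    unfolding Y_def using u(1) u'(1) by (auto dest!: carrier_dims intro!: carrier_matI simp: mat_algebra)
  ultimately have "W' * real_diag d (f \<circ> l') * adj W' = W * real_diag d (f \<circ> l) * adj W"
    using u u' by simp
  then show ?thesis using W'l' assms(2) by (simp add: mat_fun_def)
qed

section \<open>Positive matrices and their Gram representations\<close>

lemma psd_matD:
  assumes "psd_mat d A"
  shows "A \<in> carrier_mat d d" "hermitian_mat A"
  using assms by (auto simp: psd_mat_def)

text \<open>Each eigenvalue is the quadratic form evaluated at its eigenvector, a column of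
  \<open>W\<close>.\<close>

lemma psd_spec_decomp:
  assumes "psd_mat d A"
  obtains W l where "spec_decomp A W l" "\<And>i. i < d \<Longrightarrow> 0 \<le> l i"
proof -
  note A = psd_matD[OF assms]
  from hermitian_spec_decomp[OF A(2,1)] obtain W l where s: "spec_decomp A W l" by blast
  note W = spec_decompD[OF s A(1)]
  have "0 \<le> l i" if i: "i < d" for i
  proof -
    have "complex_of_real (l i) = (adj W * A * W) $$ (i,i)" using W(4) i by simp
    also have "\<dots> = quad_form A (col W i)"
      using W(2) A(1) i by (subst index_adj_conj_sum) (auto simp: quad_form_def)
    finally have "l i = Re (quad_form A (col W i))" by (metis Re_complex_of_real)
    moreover have "col W i \<in> carrier_vec d" using W(2) by auto
    ultimately show ?thesis using assms by (simp add: psd_mat_def)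
  qed
  with s show ?thesis using that by blast
qed

text \<open>The quadratic form becomes a sum of squared moduli of the overlaps with the vectors
  \<open>u k\<close>. Together with the converse \<open>psd_mat_gram\<close> this lets positivity be
  transported entrywise through Kraus maps, permutations of indices and Choi matrices.\<close>

lemma psd_mat_gramI:
  assumes "A \<in> carrier_mat d d"
    "\<And>i j. i < d \<Longrightarrow> j < d \<Longrightarrow> A $$ (i,j) = (\<Sum>k\<in>S. u k i * cnj (u k j))"
  shows "psd_mat d A"
  unfolding psd_mat_def
proof (intro conjI ballI)
  show "hermitian_mat A" unfolding hermitian_mat_def
    by (intro conjI eq_matI) (use assms in \<open>auto simp: mult.commute\<close>)
  fix v :: "complex vec" assume "v \<in> carrier_vec d"
  have "quad_form A v = (\<Sum>i<d. \<Sum>j<d. \<Sum>k\<in>S. cnj (v $ i) * u k i * cnj (cnj (v $ j) * u k j))"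
    using assms(1) unfolding quad_form_def
    by (auto simp: assms(2) sum_distrib_left sum_distrib_right mult_ac intro!: sum.cong)
  also have "\<dots> = (\<Sum>k\<in>S. \<Sum>i<d. \<Sum>j<d. cnj (v $ i) * u k i * cnj (cnj (v $ j) * u k j))"
    by (rule sum_rotate)
  also have "\<dots> = (\<Sum>k\<in>S. (\<Sum>i<d. cnj (v $ i) * u k i) * cnj (\<Sum>j<d. cnj (v $ j) * u k j))"
    by (simp add: sum_product del: complex_cnj_mult)
  also have "\<dots> = complex_of_real (\<Sum>k\<in>S. (cmod (\<Sum>i<d. cnj (v $ i) * u k i))^2)"
    by (simp only: complex_norm_square[symmetric] of_real_sum of_real_power[symmetric])
  finally show "0 \<le> Re (quad_form A v)" by (simp add: sum_nonneg)
qed (use assms in auto)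

text \<open>A nonnegative weight is shared evenly between the two vectors of a rank-one term, which
  turns weighted sums into Gram sums.\<close>

lemma sqrt_scale:
  assumes "0 \<le> r"
  shows "complex_of_real r * x * cnj y = (complex_of_real (sqrt r) * x) * cnj (complex_of_real (sqrt r) * y)"
proof -
  have "(complex_of_real (sqrt r) * x) * cnj (complex_of_real (sqrt r) * y)
      = complex_of_real (sqrt r * sqrt r) * (x * cnj y)"
    by (simp only: of_real_mult complex_cnj_mult complex_cnj_complex_of_real mult_ac)
  then show ?thesis using assms by (simp only: real_sqrt_mult_self abs_of_nonneg mult.assoc)
qed

lemma psd_mat_gram:
  assumes "psd_mat d A"
  obtains u where "\<And>i j. i < d \<Longrightarrow> j < d \<Longrightarrow> A $$ (i,j) = (\<Sum>k<d. u k i * cnj (u k j))"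
proof -
  from psd_spec_decomp[OF assms] obtain W l where s: "spec_decomp A W l" and l: "\<And>i. i < d \<Longrightarrow> 0 \<le> l i" by blast
  have "A $$ (i,j) = (\<Sum>k<d. (complex_of_real (sqrt (l k)) * W $$ (i,k)) * cnj (complex_of_real (sqrt (l k)) * W $$ (j,k)))"
    if "i < d" "j < d" for i j
    unfolding spec_decomp_index[OF s psd_matD(1)[OF assms] that]
    by (rule sum.cong[OF refl], rule sqrt_scale, rule l) simp
  then show ?thesis by (rule that)
qed

lemma psd_mat_spec_decompI:
  assumes "A \<in> carrier_mat d d" "spec_decomp A W l" "\<And>i. i < d \<Longrightarrow> 0 \<le> l i"
  shows "psd_mat d A"
proof (rule psd_mat_gramI[OF assms(1), where S = "{..<d}"])
  fix i j assume ij: "i < d" "j < d"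
  show "A $$ (i,j) = (\<Sum>k<d. (complex_of_real (sqrt (l k)) * W $$ (i,k)) * cnj (complex_of_real (sqrt (l k)) * W $$ (j,k)))"
    unfolding spec_decomp_index[OF assms(2,1) ij]
    by (rule sum.cong[OF refl], rule sqrt_scale, rule assms(3)) simp
qed

section \<open>Relative entropy in eigenbases\<close>


lemma mtrace_mult_sum:
  assumes "A \<in> carrier_mat n m" "B \<in> carrier_mat m n"
  shows "mtrace (A * B) = (\<Sum>i<n. \<Sum>k<m. A $$ (i,k) * B $$ (k,i))"
  using assms by (auto simp: mtrace_def index_mult_sum[OF assms] simp del: index_mult_mat(1) intro!: sum.cong)

lemma index_mult_mat_vec_sum:
  assumes "A \<in> carrier_mat n m" "v \<in> carrier_vec m" "i < n"
  shows "(A *\<^sub>v v) $ i = (\<Sum>k<m. A $$ (i,k) * v $ k)"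
  using assms by (auto simp: scalar_prod_def atLeast0LessThan intro!: sum.cong)

lemma mtrace_unitary_conj:
  assumes "unitary_mat d W" "M \<in> carrier_mat d d"
  shows "mtrace (W * M * adj W) = mtrace M"
proof -
  note W = unitary_matD[OF assms(1)]
  have "mtrace (W * M * adj W) = mtrace (adj W * (W * M))"
    using W(1) assms(2) by (intro mtrace_comm) auto
  also have "adj W * (W * M) = (adj W * W) * M"
    using W(1) assms(2) by (auto dest!: carrier_dims simp: mat_algebra)
  finally show ?thesis using W assms(2) by simp
qed

lemma mtrace_diag_mult:
  assumes "M \<in> carrier_mat d d"
  shows "mtrace (real_diag d l * M) = (\<Sum>i<d. complex_of_real (l i) * M $$ (i,i))"
  using assms by (subst mtrace_mult_sum[of _ d d]) (auto simp: if_distrib if_distribR cong: if_cong)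

text \<open>Only the diagonal of \<rho> in an eigenbasis of \<sigma> survives in the trace, by
  cyclicity.\<close>

lemma mtrace_mult_spec:
  assumes "\<rho> \<in> carrier_mat d d" "spec_decomp \<sigma> Z q" "\<sigma> \<in> carrier_mat d d"
  shows "mtrace (\<rho> * mat_fun f \<sigma>) = (\<Sum>j<d. complex_of_real (f (q j)) * (adj Z * \<rho> * Z) $$ (j,j))"
proof -
  note Z = spec_decompD[OF assms(2,3)]
  have "mtrace (\<rho> * mat_fun f \<sigma>) = mtrace ((\<rho> * Z) * (real_diag d (f \<circ> q) * adj Z))"
    unfolding mat_fun_eq[OF assms(2,3)] using Z(2) assms(1)
    by (auto dest!: carrier_dims simp: mat_algebra)
  also have "\<dots> = mtrace ((real_diag d (f \<circ> q) * adj Z) * (\<rho> * Z))"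
    by (rule mtrace_comm[of _ d d]) (use Z(2) assms(1) in \<open>auto dest!: carrier_dims intro!: carrier_matI\<close>)
  also have "\<dots> = mtrace (real_diag d (f \<circ> q) * (adj Z * \<rho> * Z))"
    using Z(2) assms(1) by (auto dest!: carrier_dims simp: mat_algebra)
  also have "\<dots> = (\<Sum>j<d. complex_of_real (f (q j)) * (adj Z * \<rho> * Z) $$ (j,j))"
    by (subst mtrace_diag_mult) (use Z(2) assms(1) in \<open>auto dest!: carrier_dims intro!: carrier_matI\<close>)
  finally show ?thesis .
qed

text \<open>Since \<open>\<rho>\<close> is positive, it vanishes on a vector exactly when the corresponding diagonal
  entry does, so the support condition can be read off from the diagonal of \<open>\<rho>\<close> in an
  eigenbasis of \<open>\<sigma>\<close>.\<close>
lemma rel_ent_spec: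
  assumes \<rho>: "psd_mat d \<rho>" and s: "spec_decomp \<sigma> Z q" and \<sigma>: "\<sigma> \<in> carrier_mat d d"
  shows "rel_ent \<rho> \<sigma> =
    (if \<forall>j<d. q j = 0 \<longrightarrow> (adj Z * \<rho> * Z) $$ (j,j) = 0
     then ereal (Re (mtrace (\<rho> * mat_fun ln0 \<rho>)) - (\<Sum>j<d. ln0 (q j) * Re ((adj Z * \<rho> * Z) $$ (j,j))))
     else \<infinity>)"
proof -
  note \<rho>c = psd_matD(1)[OF \<rho>] and Z = spec_decompD[OF s \<sigma>]
  note u = unitary_matD[OF Z(1)]
  obtain g where g: "\<And>i j. i < d \<Longrightarrow> j < d \<Longrightarrow> \<rho> $$ (i,j) = (\<Sum>m<d. g m i * cnj (g m j))"
    using psd_mat_gram[OF \<rho>] by metis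
  \<comment> \<open>The overlap <z_k|g_m> of an eigenvector of \<sigma> with a Gram vector of
    \<rho>. Diagonal entries are sums of the squared moduli of these numbers, and columns of
    \<open>\<rho> * Z\<close> are combinations with their conjugates as coefficients, so a zero
    diagonal entry forces a zero column.\<close>
  define w where "w m k = (\<Sum>i<d. cnj (Z $$ (i,k)) * g m i)" for m k
  have diag: "(adj Z * \<rho> * Z) $$ (k,k) = complex_of_real (\<Sum>m<d. (cmod (w m k))^2)" if k: "k < d" for k
  proof -
    have "(adj Z * \<rho> * Z) $$ (k,k) = (\<Sum>i<d. \<Sum>j<d. \<Sum>m<d. (cnj (Z $$ (i,k)) * g m i) * cnj (cnj (Z $$ (j,k)) * g m j))"
      using k by (subst index_adj_conj_sum[OF Z(2) \<rho>c]) (auto simp: g sum_distrib_left sum_distrib_right mult_ac intro!: sum.cong)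
    also have "\<dots> = (\<Sum>m<d. w m k * cnj (w m k))"
      by (subst sum_rotate) (simp add: w_def sum_product)
    finally show ?thesis by (simp only: complex_norm_square of_real_sum)
  qed
  have \<rho>Z: "(\<rho> * Z) $$ (i,k) = (\<Sum>m<d. g m i * cnj (w m k))" if "i < d" "k < d" for i k
  proof -
    have "(\<rho> * Z) $$ (i,k) = (\<Sum>l<d. \<Sum>m<d. g m i * cnj (g m l) * Z $$ (l,k))"
      using that by (subst index_mult_sum[OF \<rho>c Z(2)]) (auto simp: g sum_distrib_right)
    also have "\<dots> = (\<Sum>m<d. g m i * cnj (w m k))"
      by (subst sum.swap) (simp add: w_def sum_distrib_left mult_ac)
    finally show ?thesis .
  qed
  have zero: "(adj Z * \<rho> * Z) $$ (k,k) = 0 \<Longrightarrow> i < d \<Longrightarrow> (\<rho> * Z) $$ (i,k) = 0" if k: "k < d" for i k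
    using diag[OF k] k by (auto simp: \<rho>Z sum_nonneg_eq_0_iff simp del: index_mult_mat(1) of_real_sum)
  have supp: "(\<forall>v\<in>carrier_vec (dim_row \<rho>). \<sigma> *\<^sub>v v = 0\<^sub>v (dim_row \<rho>) \<longrightarrow> \<rho> *\<^sub>v v = 0\<^sub>v (dim_row \<rho>)) \<longleftrightarrow>
      (\<forall>j<d. q j = 0 \<longrightarrow> (adj Z * \<rho> * Z) $$ (j,j) = 0)" (is "?L \<longleftrightarrow> ?R")
  proof
    assume L: ?L
    show ?R
    proof (intro allI impI)
      fix j assume j: "j < d" "q j = 0"
      have cj: "col Z j \<in> carrier_vec d" using Z(2) by auto
      have \<sigma>Z: "\<sigma> * Z = Z * real_diag d q"
      proof -
        have "\<sigma> * Z = Z * real_diag d q * (adj Z * Z)"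
          unfolding Z(3) using Z(2) by (auto dest!: carrier_dims simp: mat_algebra)
        then show ?thesis using u by simp
      qed
      have "\<sigma> *\<^sub>v col Z j = col (\<sigma> * Z) j" by (rule col_mult2[OF \<sigma> Z(2) j(1), symmetric])
      also have "\<dots> = 0\<^sub>v d"
      proof (rule eq_vecI)
        fix i assume "i < dim_vec (0\<^sub>v d)"
        then have i: "i < d" by simp
        have "(Z * real_diag d q) $$ (i,j) = 0"
          using i j Z(2) by (subst index_mult_sum[of _ d d _ d]) (auto simp: if_distrib if_distribR cong: if_cong)
        then show "col (\<sigma> * Z) j $ i = 0\<^sub>v d $ i" unfolding \<sigma>Z using i j Z(2) by (simp add: col_def)
      qed (use \<sigma> in auto)
      finally have "\<rho> *\<^sub>v col Z j = 0\<^sub>v d" using L cj \<rho>c by auto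
      then have "col (\<rho> * Z) j = 0\<^sub>v d" by (rule trans[OF col_mult2[OF \<rho>c Z(2) j(1)]])
      then have 0: "(\<rho> * Z) $$ (i,j) = 0" if "i < d" for i
        using that j \<rho>c Z(2) by (metis carrier_matD(1,2) index_col index_mult_mat(2,3) index_zero_vec(1))
      have "adj Z * \<rho> * Z = adj Z * (\<rho> * Z)"
        using \<rho>c Z(2) by (auto dest!: carrier_dims simp: mat_algebra)
      then show "(adj Z * \<rho> * Z) $$ (j,j) = 0"
        using j \<rho>c Z(2) by (simp only:, subst index_mult_sum[of _ d d _ d]) (auto simp: 0 simp del: index_mult_mat(1))
    qed
  next
    assume R: ?R
    show ?L
    proof (intro ballI impI)
      fix v assume "v \<in> carrier_vec (dim_row \<rho>)" and "\<sigma> *\<^sub>v v = 0\<^sub>v (dim_row \<rho>)"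
      then have v: "v \<in> carrier_vec d" and \<sigma>v: "\<sigma> *\<^sub>v v = 0\<^sub>v d" using \<rho>c by auto
      \<comment> \<open>Coordinates of \<open>v\<close> in the eigenbasis of \<sigma>. Since
        \<sigma> annihilates \<open>v\<close>, only coordinates with eigenvalue 0 can be nonzero,
        and there the columns of \<open>\<rho> * Z\<close> vanish.\<close>
      define y where "y = adj Z *\<^sub>v v"
      have y: "y \<in> carrier_vec d" unfolding y_def by (rule mult_mat_vec_carrier[OF adj_carrier[OF Z(2)] v])
      have vy: "v = Z *\<^sub>v y"
        unfolding y_def using Z(2) v u(3) by (metis adj_carrier assoc_mult_mat_vec one_mult_mat_vec)
      have "adj Z * \<sigma> * Z *\<^sub>v y = adj Z *\<^sub>v (\<sigma> *\<^sub>v (Z *\<^sub>v y))"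
        using Z(2) \<sigma> y by (simp add: assoc_mult_mat_vec[of _ d d _ d] mult_carrier_mat[of _ d d _ d] mult_mat_vec_carrier[of _ d d])
      then have "real_diag d q *\<^sub>v y = 0\<^sub>v d"
        using Z(2,4) \<sigma>v vy by auto
      then have D0: "(real_diag d q *\<^sub>v y) $ k = 0" if "k < d" for k
        using that by simp
      have yk: "complex_of_real (q k) * y $ k = 0" if k: "k < d" for k
      proof -
        have "(real_diag d q *\<^sub>v y) $ k = (\<Sum>j<d. real_diag d q $$ (k,j) * y $ j)"
          using k y by (intro index_mult_mat_vec_sum[of _ d d]) auto
        then show ?thesis using D0[OF k] k by (simp add: if_distrib if_distribR cong: if_cong)
      qed
      have "\<rho> *\<^sub>v v = (\<rho> * Z) *\<^sub>v y" using vy \<rho>c Z(2) y by (simp add: assoc_mult_mat_vec[of _ d d _ d] mult_carrier_mat[of _ d d _ d] mult_mat_vec_carrier[of _ d d])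
      also have "\<dots> = 0\<^sub>v d"
      proof (rule eq_vecI)
        fix i assume "i < dim_vec (0\<^sub>v d)"
        then have i: "i < d" by simp
        have "((\<rho> * Z) *\<^sub>v y) $ i = (\<Sum>k<d. (\<rho> * Z) $$ (i,k) * y $ k)"
          using i \<rho>c Z(2) y by (intro index_mult_mat_vec_sum[of _ d d] mult_carrier_mat[of _ d d]) auto
        also have "\<dots> = 0"
          using zero R yk i by (intro sum.neutral) (metis lessThan_iff mult_eq_0_iff of_real_eq_0_iff)
        finally show "((\<rho> * Z) *\<^sub>v y) $ i = 0\<^sub>v d $ i" using i by simp
      qed (use \<rho>c in auto)
      finally show "\<rho> *\<^sub>v v = 0\<^sub>v (dim_row \<rho>)" using \<rho>c by auto
    qed
  qed
  have "Re (mtrace (\<rho> * mat_fun ln0 \<sigma>)) = (\<Sum>j<d. ln0 (q j) * Re ((adj Z * \<rho> * Z) $$ (j,j)))"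
    by (simp add: mtrace_mult_spec[OF \<rho>c s \<sigma>] del: index_mult_mat)
  then show ?thesis unfolding rel_ent_def supp by simp
qed

lemma overlap_diag:
  assumes s: "spec_decomp \<rho> W p" and \<rho>: "\<rho> \<in> carrier_mat d d" and Z: "Z \<in> carrier_mat d d" and j: "j < d"
  shows "(adj Z * \<rho> * Z) $$ (j,j) = complex_of_real (\<Sum>i<d. p i * (cmod ((adj W * Z) $$ (i,j)))^2)"
proof -
  note W = spec_decompD[OF s \<rho>]
  have Y: "adj Z * W \<in> carrier_mat d d" using W(2) Z by (auto intro: mult_carrier_mat[of _ d d])
  have "adj Z * \<rho> * Z = (adj Z * W) * real_diag d p * adj (adj Z * W)"
    unfolding W(3) using W(2) Z by (auto dest!: carrier_dims simp: mat_algebra)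
  then have "(adj Z * \<rho> * Z) $$ (j,j) = (\<Sum>k<d. complex_of_real (p k) * (adj Z * W) $$ (j,k) * cnj ((adj Z * W) $$ (j,k)))"
    using mult_diag_conj_index[OF Y j j, of p] by simp
  also have "\<dots> = (\<Sum>i<d. complex_of_real (p i * (cmod ((adj W * Z) $$ (i,j)))^2))"
  proof (intro sum.cong refl)
    fix k assume "k \<in> {..<d}"
    then have k: "k < d" by simp
    have "adj (adj Z * W) = adj W * Z" using W(2) Z by (auto dest!: carrier_dims simp: mat_algebra)
    then have e: "(adj W * Z) $$ (k,j) = cnj ((adj Z * W) $$ (j,k))"
      using index_adj[of k "adj Z * W" j] Y k j by (metis carrier_matD(1,2))
    then show "complex_of_real (p k) * (adj Z * W) $$ (j,k) * cnj ((adj Z * W) $$ (j,k)) = complex_of_real (p k * (cmod ((adj W * Z) $$ (k,j)))^2)"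
      unfolding e complex_mod_cnj of_real_mult complex_norm_square by (simp only: mult.assoc)
  qed
  finally show ?thesis by (simp only: of_real_sum)
qed

text \<open>The squared moduli of the entries of a unitary matrix form a doubly stochastic
  matrix.\<close>

lemma overlap_sums:
  assumes "unitary_mat d W" "unitary_mat d Z"
  shows "i < d \<Longrightarrow> (\<Sum>j<d. (cmod ((adj W * Z) $$ (i,j)))^2) = 1"
    and "j < d \<Longrightarrow> (\<Sum>i<d. (cmod ((adj W * Z) $$ (i,j)))^2) = 1"
proof -
  have Y: "unitary_mat d (adj W * Z)" using assms by (intro unitary_mat_mult unitary_mat_adj)
  show "(\<Sum>j<d. (cmod ((adj W * Z) $$ (i,j)))^2) = 1" if "i < d"
  proof -
    have "complex_of_real (\<Sum>j<d. (cmod ((adj W * Z) $$ (i,j)))^2) = 1"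
      using unitary_orthonormal_rows[OF Y that that] by (simp only: of_real_sum complex_norm_square) simp
    then show ?thesis by (simp only: of_real_eq_1_iff)
  qed
  show "(\<Sum>i<d. (cmod ((adj W * Z) $$ (i,j)))^2) = 1" if "j < d"
  proof -
    have "complex_of_real (\<Sum>i<d. (cmod ((adj W * Z) $$ (i,j)))^2) = 1"
      using unitary_orthonormal_cols[OF Y that that]
      by (simp only: of_real_sum complex_norm_square mult.commute[of _ "cnj _"]) simp
    then show ?thesis by (simp only: of_real_eq_1_iff)
  qed
qed

lemma trace_fun_spec:
  assumes "spec_decomp \<rho> W p" "\<rho> \<in> carrier_mat d d"
  shows "mtrace (\<rho> * mat_fun f \<rho>) = complex_of_real (\<Sum>i<d. f (p i) * p i)"
  unfolding mtrace_mult_spec[OF assms(2,1,2)] spec_decompD(4)[OF assms] by simp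

lemma mtrace_spec:
  assumes "spec_decomp \<rho> W p" "\<rho> \<in> carrier_mat d d"
  shows "mtrace \<rho> = complex_of_real (\<Sum>i<d. p i)"
proof -
  note W = spec_decompD[OF assms]
  have "mtrace \<rho> = mtrace (real_diag d p)" by (subst W(3)) (rule mtrace_unitary_conj[OF W(1)], simp)
  then show ?thesis by (simp add: mtrace_def)
qed

text \<open>The quantum relative entropy equals the classical one of the two weights
  \<open>c i j * p i\<close> and \<open>c i j * q j\<close> on pairs of indices (the
  Nussbaum--Szkola distributions). From here on it is a finite real sum plus a support
  condition.\<close>

lemma rel_ent_overlap:
  assumes \<rho>: "psd_mat d \<rho>" and sr: "spec_decomp \<rho> W p" and p: "\<And>i. i < d \<Longrightarrow> 0 \<le> p i"
    and ss: "spec_decomp \<sigma> Z q" and \<sigma>: "\<sigma> \<in> carrier_mat d d"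
  defines "c \<equiv> \<lambda>i j. (cmod ((adj W * Z) $$ (i,j)))^2"
  shows "rel_ent \<rho> \<sigma> =
    (if \<forall>i<d. \<forall>j<d. q j = 0 \<longrightarrow> c i j * p i = 0
     then ereal (\<Sum>i<d. \<Sum>j<d. c i j * p i * (ln0 (p i) - ln0 (q j))) else \<infinity>)"
proof -
  note \<rho>c = psd_matD(1)[OF \<rho>] and W = spec_decompD[OF sr psd_matD(1)[OF \<rho>]] and Z = spec_decompD[OF ss \<sigma>]
  have cpos: "0 \<le> c i j" for i j by (simp add: c_def)
  have dg: "(adj Z * \<rho> * Z) $$ (j,j) = complex_of_real (\<Sum>i<d. p i * c i j)" if "j < d" for j
    unfolding c_def by (rule overlap_diag[OF sr \<rho>c Z(2) that])
  have 1: "(adj Z * \<rho> * Z) $$ (j,j) = 0 \<longleftrightarrow> (\<forall>i<d. c i j * p i = 0)" if "j < d" for j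
    unfolding dg[OF that] of_real_eq_0_iff
    by (subst sum_nonneg_eq_0_iff) (auto simp: p cpos mult.commute)
  have "(\<Sum>i<d. \<Sum>j<d. c i j * p i * (ln0 (p i) - ln0 (q j))) =
        (\<Sum>i<d. (\<Sum>j<d. c i j) * (p i * ln0 (p i))) - (\<Sum>i<d. \<Sum>j<d. ln0 (q j) * (p i * c i j))"
    unfolding sum_subtractf[symmetric] sum_distrib_right
    by (intro sum.cong refl) (simp add: algebra_simps)
  also have "(\<Sum>i<d. (\<Sum>j<d. c i j) * (p i * ln0 (p i))) = Re (mtrace (\<rho> * mat_fun ln0 \<rho>))"
    unfolding trace_fun_spec[OF sr \<rho>c] c_def
    by (simp add: overlap_sums(1)[OF W(1) Z(1)] mult.commute del: index_mult_mat)
  also have "(\<Sum>i<d. \<Sum>j<d. ln0 (q j) * (p i * c i j)) = (\<Sum>j<d. ln0 (q j) * Re ((adj Z * \<rho> * Z) $$ (j,j)))"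
    by (subst sum.swap) (simp add: dg sum_distrib_left del: index_mult_mat of_real_sum)
  finally show ?thesis
    unfolding rel_ent_spec[OF \<rho> ss \<sigma>] using 1 by (auto simp del: index_mult_mat)
qed

section \<open>Monotonicity of the relative entropy\<close>


text \<open>The comparison of the sums for every \<open>t > 0\<close> integrates to a comparison of relative
  entropies: with \<open>G t = (\<Sum>a. c a * p a * ln (q a + t * p a))\<close>, the sums are \<open>G'\<close>, while
  \<open>G t - ln t * (\<Sum>a. c a * p a) - G 0\<close> tends to the relative entropy as \<open>t\<close> tends to infinity.
  Letting \<open>t\<close> tend to \<open>0\<close> gives the comparison of supports.\<close>
lemma relative_entropy_sum_mono:
  fixes c p q :: "'a \<Rightarrow> real" and c' p' q' :: "'b \<Rightarrow> real"
  assumes fin: "finite I" "finite J"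
    and nn: "\<And>a. a \<in> I \<Longrightarrow> 0 \<le> c a \<and> 0 \<le> p a \<and> 0 \<le> q a"
    and nn': "\<And>a. a \<in> J \<Longrightarrow> 0 \<le> c' a \<and> 0 \<le> p' a \<and> 0 \<le> q' a"
    and tr: "(\<Sum>a\<in>I. c a * p a) = (\<Sum>a\<in>J. c' a * p' a)"
    and le: "\<And>t. t > 0 \<Longrightarrow> (\<Sum>a\<in>I. c a * (p a)\<^sup>2 / (q a + t * p a)) \<le> (\<Sum>a\<in>J. c' a * (p' a)\<^sup>2 / (q' a + t * p' a))"
    and supp': "\<And>a. a \<in> J \<Longrightarrow> q' a = 0 \<Longrightarrow> c' a * p' a = 0"
  shows "\<forall>a\<in>I. q a = 0 \<longrightarrow> c a * p a = 0"
    and "(\<Sum>a\<in>I. c a * p a * (ln0 (p a) - ln0 (q a))) \<le> (\<Sum>a\<in>J. c' a * p' a * (ln0 (p' a) - ln0 (q' a)))"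
proof -
  show supp: "\<forall>a\<in>I. q a = 0 \<longrightarrow> c a * p a = 0"
  proof (intro ballI impI, rule ccontr)
    fix a assume a: "a \<in> I" "q a = 0" "c a * p a \<noteq> 0"
    \<comment> \<open>A bound, uniform in t, for the larger sum: dropping \<open>t * p' b\<close>
      from a denominator only increases a term with \<open>q' b\<close> nonzero, and the other terms
      vanish by \<open>supp'\<close>. On the smaller side a term with \<open>q a = 0\<close> equals
      \<open>c a * p a / t\<close>, which is unbounded near 0.\<close>
    define K where "K = (\<Sum>a\<in>J. c' a * (p' a)\<^sup>2 / q' a)"
    have pos: "c a * p a > 0" using a nn[OF a(1)] by (metis less_eq_real_def mult_nonneg_nonneg)
    have bound: "c a * p a \<le> t * K" if t: "t > 0" for t
    proof -
      have "c a * p a / t = c a * (p a)\<^sup>2 / (q a + t * p a)"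
        using a t by (simp add: power2_eq_square)
      also have "\<dots> \<le> (\<Sum>a\<in>I. c a * (p a)\<^sup>2 / (q a + t * p a))"
        using nn t by (intro member_le_sum[OF a(1) _ fin(1)]) (auto intro!: divide_nonneg_nonneg mult_nonneg_nonneg add_nonneg_nonneg)
      also have "\<dots> \<le> (\<Sum>a\<in>J. c' a * (p' a)\<^sup>2 / (q' a + t * p' a))" by (rule le[OF t])
      also have "\<dots> \<le> K" unfolding K_def
      proof (rule sum_mono)
        fix b assume b: "b \<in> J"
        show "c' b * (p' b)\<^sup>2 / (q' b + t * p' b) \<le> c' b * (p' b)\<^sup>2 / q' b"
        proof (cases "q' b = 0")
          case True
          then have "c' b * (p' b)\<^sup>2 = 0" using supp'[OF b] by auto
          then show ?thesis by auto
        next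
          case False
          then show ?thesis using nn'[OF b] t
            by (intro divide_left_mono) (auto intro!: mult_nonneg_nonneg mult_pos_pos add_pos_nonneg)
        qed
      qed
      finally show ?thesis using t by (simp add: field_simps)
    qed
    have K: "K > 0" using bound[of 1] pos by simp
    \<comment> \<open>The value of t is chosen so that \<open>t * K\<close> is half of the positive
      number \<open>c a * p a\<close>.\<close>
    have "c a * p a \<le> (c a * p a / (2 * K)) * K" by (rule bound) (use pos K in auto)
    then show False using pos K by simp
  qed
  \<comment> \<open>On the terms of nonzero weight all of \<open>c\<close>, \<open>p\<close> and
    \<open>q\<close> are positive. Hence the logarithms are differentiable down to t = 0, and
    \<open>ln0\<close> is \<open>ln\<close>.\<close>
  define I0 where "I0 = {a\<in>I. c a * p a \<noteq> 0}"
  define J0 where "J0 = {a\<in>J. c' a * p' a \<noteq> 0}"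
  have fin0: "finite I0" "finite J0" using fin by (auto simp: I0_def J0_def)
  have I0: "c a > 0 \<and> p a > 0 \<and> q a > 0" if "a \<in> I0" for a
    using that nn[of a] supp by (auto simp: I0_def less_le)
  have J0: "c' a > 0 \<and> p' a > 0 \<and> q' a > 0" if "a \<in> J0" for a
    using that nn'[of a] supp' by (auto simp: J0_def less_le)
  have rI: "(\<Sum>a\<in>I. c a * p a * f a) = (\<Sum>a\<in>I0. c a * p a * f a)" for f
    unfolding I0_def by (rule sum.mono_neutral_cong_right) (use fin in auto)
  have rJ: "(\<Sum>a\<in>J. c' a * p' a * f a) = (\<Sum>a\<in>J0. c' a * p' a * f a)" for f
    unfolding J0_def by (rule sum.mono_neutral_cong_right) (use fin in auto)
  define G where "G t = (\<Sum>a\<in>I0. c a * p a * ln (q a + t * p a))" for t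
  define H where "H t = (\<Sum>a\<in>J0. c' a * p' a * ln (q' a + t * p' a))" for t
  have dG: "(G has_real_derivative (\<Sum>a\<in>I0. c a * p a * (p a / (q a + t * p a)))) (at t)" if "t \<ge> 0" for t
    unfolding G_def using that I0
    by (auto intro!: derivative_eq_intros sum.cong simp: add_pos_nonneg less_imp_le)
  have dH: "(H has_real_derivative (\<Sum>a\<in>J0. c' a * p' a * (p' a / (q' a + t * p' a)))) (at t)" if "t \<ge> 0" for t
    unfolding H_def using that J0
    by (auto intro!: derivative_eq_intros sum.cong simp: add_pos_nonneg less_imp_le)
  \<comment> \<open>The derivative of \<open>H - G\<close> is nonnegative for t > 0 by
    \<open>le\<close>, so the mean value theorem gives what integrating from 0 to t would.\<close>
  have GH: "G t - G 0 \<le> H t - H 0" if t: "t > 0" for t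
  proof -
    let ?h = "\<lambda>t. (\<Sum>a\<in>J0. c' a * p' a * (p' a / (q' a + t * p' a))) - (\<Sum>a\<in>I0. c a * p a * (p a / (q a + t * p a)))"
    have dHG: "((\<lambda>t. H t - G t) has_real_derivative ((\<Sum>a\<in>J0. c' a * p' a * (p' a / (q' a + t * p' a))) - (\<Sum>a\<in>I0. c a * p a * (p a / (q a + t * p a))))) (at t)"
      if "t \<ge> 0" for t by (intro DERIV_diff dG dH that)
    from MVT2[OF t, of "\<lambda>t. H t - G t" ?h, OF dHG] obtain z where z: "0 < z" "z < t"
      "(H t - G t) - (H 0 - G 0) = (t - 0) * ((\<Sum>a\<in>J0. c' a * p' a * (p' a / (q' a + z * p' a))) - (\<Sum>a\<in>I0. c a * p a * (p a / (q a + z * p a))))"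
      by blast
    have "(\<Sum>a\<in>I0. c a * p a * (p a / (q a + z * p a))) \<le> (\<Sum>a\<in>J0. c' a * p' a * (p' a / (q' a + z * p' a)))"
      unfolding rI[symmetric] rJ[symmetric] using le[OF z(1)] by (simp add: power2_eq_square mult.assoc)
    then have "0 \<le> (H t - G t) - (H 0 - G 0)" unfolding z(3) using t by simp
    then show ?thesis by simp
  qed
  \<comment> \<open>Removing \<open>ln t\<close> times the total weight makes the limit at infinity
    finite: \<open>q a / t\<close> tends to 0 and \<open>ln (p a)\<close> remains. The total weights
    of both sides agree, so the same correction is subtracted on each.\<close>
  have expand: "(\<Sum>a\<in>I0. c a * p a * ln (q a / t + p a)) = G t - ln t * (\<Sum>a\<in>I0. c a * p a)" if t: "t > 0" for t
  proof -
    have "ln (q a / t + p a) = ln (q a + t * p a) - ln t" if "a \<in> I0" for a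
    proof -
      have "q a / t + p a = (q a + t * p a) / t" using t by (simp add: field_simps)
      moreover have "q a + t * p a > 0" using t I0[OF that] by (simp add: add_pos_pos)
      ultimately show ?thesis using t by (simp add: ln_div)
    qed
    then show ?thesis unfolding G_def sum_distrib_left sum_subtractf[symmetric]
      by (intro sum.cong refl) (simp add: right_diff_distrib mult_ac)
  qed
  have expand': "(\<Sum>a\<in>J0. c' a * p' a * ln (q' a / t + p' a)) = H t - ln t * (\<Sum>a\<in>J0. c' a * p' a)" if t: "t > 0" for t
  proof -
    have "ln (q' a / t + p' a) = ln (q' a + t * p' a) - ln t" if "a \<in> J0" for a
    proof -
      have "q' a / t + p' a = (q' a + t * p' a) / t" using t by (simp add: field_simps)
      moreover have "q' a + t * p' a > 0" using t J0[OF that] by (simp add: add_pos_pos)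
      ultimately show ?thesis using t by (simp add: ln_div)
    qed
    then show ?thesis unfolding H_def sum_distrib_left sum_subtractf[symmetric]
      by (intro sum.cong refl) (simp add: right_diff_distrib mult_ac)
  qed
  have tr0: "(\<Sum>a\<in>I0. c a * p a) = (\<Sum>a\<in>J0. c' a * p' a)"
    using tr rI[of "\<lambda>_. 1"] rJ[of "\<lambda>_. 1"] by simp
  have lim: "((\<lambda>t. \<Sum>a\<in>I0. c a * p a * ln (q a / t + p a)) \<longlongrightarrow> (\<Sum>a\<in>I0. c a * p a * ln (0 + p a))) at_top"
    by (intro tendsto_intros tendsto_ln) (use I0 in \<open>auto simp: less_imp_neq intro!: real_tendsto_divide_at_top[OF tendsto_const filterlim_ident]\<close>, fastforce)
  have lim': "((\<lambda>t. \<Sum>a\<in>J0. c' a * p' a * ln (q' a / t + p' a)) \<longlongrightarrow> (\<Sum>a\<in>J0. c' a * p' a * ln (0 + p' a))) at_top"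
    by (intro tendsto_intros tendsto_ln) (use J0 in \<open>auto simp: less_imp_neq intro!: real_tendsto_divide_at_top[OF tendsto_const filterlim_ident]\<close>, fastforce)
  have "(\<Sum>a\<in>I0. c a * p a * ln (0 + p a)) - G 0 \<le> (\<Sum>a\<in>J0. c' a * p' a * ln (0 + p' a)) - H 0"
  proof (rule tendsto_le[OF _ tendsto_diff[OF lim' tendsto_const] tendsto_diff[OF lim tendsto_const]])
    show "\<forall>\<^sub>F t in at_top. (\<Sum>a\<in>I0. c a * p a * ln (q a / t + p a)) - G 0 \<le> (\<Sum>a\<in>J0. c' a * p' a * ln (q' a / t + p' a)) - H 0"
      using eventually_gt_at_top[of 0]
    proof eventually_elim
      case (elim t)
      then show ?case using GH[OF elim] tr0 by (simp add: expand expand')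
    qed
  qed simp
  moreover have "(\<Sum>a\<in>I0. c a * p a * ln (0 + p a)) - G 0 = (\<Sum>a\<in>I0. c a * p a * (ln0 (p a) - ln0 (q a)))"
    unfolding G_def sum_subtractf[symmetric]
    by (intro sum.cong refl) (use I0 in \<open>auto simp: ln0_def right_diff_distrib\<close>)
  moreover have "(\<Sum>a\<in>J0. c' a * p' a * ln (0 + p' a)) - H 0 = (\<Sum>a\<in>J0. c' a * p' a * (ln0 (p' a) - ln0 (q' a)))"
    unfolding H_def sum_subtractf[symmetric]
    by (intro sum.cong refl) (use J0 in \<open>auto simp: ln0_def right_diff_distrib\<close>)
  ultimately show "(\<Sum>a\<in>I. c a * p a * (ln0 (p a) - ln0 (q a))) \<le> (\<Sum>a\<in>J. c' a * p' a * (ln0 (p' a) - ln0 (q' a)))"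
    unfolding rI rJ by simp
qed

section \<open>The variational functional and its maximum\<close>

definition entropy_functional :: "complex mat \<Rightarrow> complex mat \<Rightarrow> real \<Rightarrow> complex mat \<Rightarrow> real" where
  "entropy_functional \<rho> \<sigma> t X =
     2 * Re (mtrace (\<rho> * X)) - Re (mtrace (\<sigma> * (X * adj X))) - t * Re (mtrace (\<rho> * (adj X * X)))"

text \<open>With \<open>X\<close> written as a matrix from the eigenbasis of \<rho> to that of
  \<sigma>, the functional decouples into one quadratic function of each single entry, so that it
  can be maximised entry by entry.\<close>

lemma entropy_functional_spec:
  assumes \<rho>: "\<rho> \<in> carrier_mat d d" and sr: "spec_decomp \<rho> W p"
    and \<sigma>: "\<sigma> \<in> carrier_mat d d" and ss: "spec_decomp \<sigma> Z q" and x: "x \<in> carrier_mat d d"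
  shows "entropy_functional \<rho> \<sigma> t (Z * x * adj W) =
    (\<Sum>i<d. \<Sum>j<d. 2 * (p i * Re ((adj W * Z) $$ (i,j) * x $$ (j,i))) - (q j + t * p i) * (cmod (x $$ (j,i)))^2)"
proof -
  note W = spec_decompD[OF sr \<rho>] and Z = spec_decompD[OF ss \<sigma>]
  note uW = unitary_matD[OF W(1)] and uZ = unitary_matD[OF Z(1)]
  define Y where "Y = adj W * Z"
  have Y: "Y \<in> carrier_mat d d" using W(2) Z(2) by (auto simp: Y_def intro: mult_carrier_mat[of _ d d])
  have 1: "\<rho> * (Z * x * adj W) = W * (real_diag d p * (Y * x)) * adj W"
    unfolding Y_def W(3) using W(2) Z(2) x by (auto dest!: carrier_dims simp: mat_algebra)
  have "\<sigma> * ((Z * x * adj W) * adj (Z * x * adj W)) = Z * (real_diag d q * ((adj Z * Z) * (x * ((adj W * W) * adj x)))) * adj Z"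
    unfolding Z(3) using W(2) Z(2) x by (auto dest!: carrier_dims simp: mat_algebra)
  then have 2: "\<sigma> * ((Z * x * adj W) * adj (Z * x * adj W)) = Z * (real_diag d q * (x * adj x)) * adj Z"
    using uW uZ x by (auto dest!: carrier_dims)
  have "\<rho> * (adj (Z * x * adj W) * (Z * x * adj W)) = W * (real_diag d p * ((adj W * W) * (adj x * ((adj Z * Z) * x)))) * adj W"
    unfolding W(3) using W(2) Z(2) x by (auto dest!: carrier_dims simp: mat_algebra)
  then have 3: "\<rho> * (adj (Z * x * adj W) * (Z * x * adj W)) = W * (real_diag d p * (adj x * x)) * adj W"
    using uW uZ x by (auto dest!: carrier_dims)
  have c: "Y * x \<in> carrier_mat d d" "x * adj x \<in> carrier_mat d d" "adj x * x \<in> carrier_mat d d"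
    using Y x by (auto intro: mult_carrier_mat[of _ d d])
  have sq: "Re z * Re z + Im z * Im z = (cmod z)^2" for z
    by (simp add: cmod_power2 flip: power2_eq_square)
  note dims = carrier_matD[OF x]
  have t1: "Re (mtrace (\<rho> * (Z * x * adj W))) = (\<Sum>i<d. \<Sum>j<d. p i * Re (Y $$ (i,j) * x $$ (j,i)))"
    unfolding 1 mtrace_unitary_conj[OF W(1) mult_carrier_mat[OF real_diag_carrier c(1)]] mtrace_diag_mult[OF c(1)]
    by (simp add: index_mult_sum[OF Y x] sum_distrib_left del: index_mult_mat(1))
  have t2: "Re (mtrace (\<sigma> * ((Z * x * adj W) * adj (Z * x * adj W)))) = (\<Sum>j<d. \<Sum>i<d. q j * (cmod (x $$ (j,i)))^2)"
    unfolding 2 mtrace_unitary_conj[OF Z(1) mult_carrier_mat[OF real_diag_carrier c(2)]] mtrace_diag_mult[OF c(2)]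
    by (simp add: index_mult_sum[OF x adj_carrier[OF x]] dims sq sum_distrib_left
        del: index_mult_mat(1))
  have t3: "Re (mtrace (\<rho> * (adj (Z * x * adj W) * (Z * x * adj W)))) = (\<Sum>i<d. \<Sum>j<d. p i * (cmod (x $$ (j,i)))^2)"
    unfolding 3 mtrace_unitary_conj[OF W(1) mult_carrier_mat[OF real_diag_carrier c(3)]] mtrace_diag_mult[OF c(3)]
    by (simp add: index_mult_sum[OF adj_carrier[OF x] x] dims sq sum_distrib_left
        del: index_mult_mat(1))
  show ?thesis
    unfolding entropy_functional_def t1 t3 t2 Y_def[symmetric]
    by (subst sum.swap[of "\<lambda>j i. q j * (cmod (x $$ (j,i)))^2"])
      (simp add: sum_distrib_left sum_subtractf[symmetric] algebra_simps)
qed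

text \<open>Completing the square in each entry of \<open>x\<close>, after bounding the real part of
  a product by the product of the moduli.\<close>

lemma entropy_functional_le:
  assumes \<rho>: "\<rho> \<in> carrier_mat d d" and sr: "spec_decomp \<rho> W p" and p: "\<And>i. i < d \<Longrightarrow> 0 \<le> p i"
    and \<sigma>: "\<sigma> \<in> carrier_mat d d" and ss: "spec_decomp \<sigma> Z q" and q: "\<And>i. i < d \<Longrightarrow> 0 \<le> q i"
    and t: "t > 0" and X: "X \<in> carrier_mat d d"
  shows "entropy_functional \<rho> \<sigma> t X \<le>
    (\<Sum>i<d. \<Sum>j<d. (cmod ((adj W * Z) $$ (i,j)))^2 * (p i)^2 / (q j + t * p i))"
proof -
  note W = spec_decompD[OF sr \<rho>] and Z = spec_decompD[OF ss \<sigma>]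
  note uW = unitary_matD[OF W(1)] and uZ = unitary_matD[OF Z(1)]
  define x where "x = adj Z * X * W"
  have x: "x \<in> carrier_mat d d" using W(2) Z(2) X by (auto simp: x_def intro!: mult_carrier_mat[of _ d d])
  have "Z * x * adj W = (Z * adj Z) * (X * (W * adj W))"
    unfolding x_def using W(2) Z(2) X by (auto dest!: carrier_dims simp: mat_algebra)
  then have Xx: "X = Z * x * adj W" using uW uZ X by simp
  \<comment> \<open>When \<open>b = 0\<close> also \<open>a = 0\<close>, and both sides are 0
    because division by zero yields 0.\<close>
  have *: "2 * (a * Re (y * z)) - b * (cmod z)^2 \<le> (cmod y)^2 * a^2 / b" if "0 \<le> a" "0 \<le> b" "b = 0 \<Longrightarrow> a = 0" for a b y z
  proof (cases "b = 0")
    case True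
    then show ?thesis using that by simp
  next
    case False
    then have b: "b > 0" using that by simp
    have "a * Re (y * z) \<le> a * (cmod y * cmod z)"
      using that complex_Re_le_cmod[of "y * z"] by (intro mult_left_mono) (auto simp: norm_mult)
    moreover have "0 \<le> (a * cmod y - b * cmod z)^2 / b" using b by simp
    then have "2 * (a * (cmod y * cmod z)) - b * (cmod z)^2 \<le> (cmod y)^2 * a^2 / b"
      using b by (simp add: field_simps power2_eq_square)
    ultimately show ?thesis by linarith
  qed
  show ?thesis
    unfolding Xx entropy_functional_spec[OF \<rho> sr \<sigma> ss x]
  proof (intro sum_mono *)
    fix i j assume "i \<in> {..<d}" "j \<in> {..<d}"
    then have pq: "0 \<le> p i" "0 \<le> q j" using p q by auto
    then show "0 \<le> p i" "0 \<le> q j + t * p i" using t by auto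
    show "p i = 0" if "q j + t * p i = 0" using that pq t by (simp add: add_nonneg_eq_0_iff)
  qed
qed

lemma entropy_functional_attained:
  assumes \<rho>: "\<rho> \<in> carrier_mat d d" and sr: "spec_decomp \<rho> W p" and p: "\<And>i. i < d \<Longrightarrow> 0 \<le> p i"
    and \<sigma>: "\<sigma> \<in> carrier_mat d d" and ss: "spec_decomp \<sigma> Z q" and q: "\<And>i. i < d \<Longrightarrow> 0 \<le> q i"
    and t: "t > 0"
  obtains X where "X \<in> carrier_mat d d" "entropy_functional \<rho> \<sigma> t X =
    (\<Sum>i<d. \<Sum>j<d. (cmod ((adj W * Z) $$ (i,j)))^2 * (p i)^2 / (q j + t * p i))"
proof -
  note W = spec_decompD[OF sr \<rho>] and Z = spec_decompD[OF ss \<sigma>]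
  \<comment> \<open>The stationary point of each quadratic function. Its phase is that of the
    conjugate overlap, so that the linear term is real and nonnegative; a vanishing denominator
    gives the entry 0.\<close>
  define x where "x = mat d d (\<lambda>(j,i). complex_of_real (p i / (q j + t * p i)) * cnj ((adj W * Z) $$ (i,j)))"
  have x: "x \<in> carrier_mat d d" by (simp add: x_def)
  have *: "2 * (a * Re (y * (complex_of_real (a / b) * cnj y))) - b * (cmod (complex_of_real (a / b) * cnj y))^2 = (cmod y)^2 * a^2 / b"
    for a b :: real and y
  proof -
    have "y * (complex_of_real (a / b) * cnj y) = complex_of_real (a / b * (cmod y)^2)"
      unfolding of_real_mult complex_norm_square by (simp only: mult_ac)
    then have "Re (y * (complex_of_real (a / b) * cnj y)) = a / b * (cmod y)^2" by (metis Re_complex_of_real)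
    moreover have "(cmod (complex_of_real (a / b) * cnj y))^2 = (a / b)^2 * (cmod y)^2"
      by (simp only: norm_mult norm_of_real power_mult_distrib complex_mod_cnj power2_abs)
    ultimately show ?thesis by (cases "b = 0") (simp_all add: field_simps power2_eq_square)
  qed
  have "entropy_functional \<rho> \<sigma> t (Z * x * adj W) = (\<Sum>i<d. \<Sum>j<d. (cmod ((adj W * Z) $$ (i,j)))^2 * (p i)^2 / (q j + t * p i))"
    unfolding entropy_functional_spec[OF \<rho> sr \<sigma> ss x]
    by (intro sum.cong refl) (simp only: x_def index_mat split lessThan_iff *)
  moreover have "Z * x * adj W \<in> carrier_mat d d" using W(2) Z(2) x by (auto intro!: mult_carrier_mat[of _ d d])
  ultimately show ?thesis using that by blast
qed

section \<open>Kraus maps, their duals and the Kadison--Schwarz inequality\<close>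

lemma mat_sum_carrier [simp]: "mat_sum d S f \<in> carrier_mat d d"
  by (simp add: mat_sum_def)

lemma dim_mat_sum [simp]: "dim_row (mat_sum d S f) = d" "dim_col (mat_sum d S f) = d"
  by (simp_all add: mat_sum_def)

lemma index_mat_sum: "i < d \<Longrightarrow> j < d \<Longrightarrow> mat_sum d S f $$ (i,j) = (\<Sum>a\<in>S. f a $$ (i,j))"
  by (simp add: mat_sum_def)

lemma mat_sum_singleton: "f x \<in> carrier_mat d d \<Longrightarrow> mat_sum d {x} f = f x"
  by (rule eq_matI) (auto simp: index_mat_sum)

lemma mtrace_mat_sum_left:
  assumes "\<And>a. a \<in> S \<Longrightarrow> f a \<in> carrier_mat d d" "B \<in> carrier_mat d d"
  shows "mtrace (mat_sum d S f * B) = (\<Sum>a\<in>S. mtrace (f a * B))"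
proof -
  have "mtrace (mat_sum d S f * B) = (\<Sum>i<d. \<Sum>k<d. \<Sum>a\<in>S. f a $$ (i,k) * B $$ (k,i))"
    using assms by (subst mtrace_mult_sum[of _ d d]) (auto simp: index_mat_sum sum_distrib_right intro!: sum.cong)
  also have "\<dots> = (\<Sum>a\<in>S. mtrace (f a * B))"
    by (subst sum_rotate) (use assms in \<open>auto simp: mtrace_mult_sum[of _ d d] intro!: sum.cong\<close>)
  finally show ?thesis .
qed

lemma mtrace_mat_sum_right:
  assumes "\<And>a. a \<in> S \<Longrightarrow> f a \<in> carrier_mat d d" "B \<in> carrier_mat d d"
  shows "mtrace (B * mat_sum d S f) = (\<Sum>a\<in>S. mtrace (B * f a))"
proof -
  have "mtrace (B * mat_sum d S f) = mtrace (mat_sum d S f * B)"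
    using assms by (intro mtrace_comm) auto
  also have "\<dots> = (\<Sum>a\<in>S. mtrace (f a * B))"
    by (rule mtrace_mat_sum_left) (use assms in auto)
  also have "\<dots> = (\<Sum>a\<in>S. mtrace (B * f a))"
    using assms by (auto intro!: sum.cong mtrace_comm)
  finally show ?thesis .
qed

text \<open>Passage to the Heisenberg picture, by cyclicity of the trace for each Kraus operator.
  With \<open>X\<close> the identity it yields trace preservation.\<close>

lemma mtrace_kraus_dual:
  assumes "\<rho> \<in> carrier_mat d d" "X \<in> carrier_mat e e" "\<And>a. a \<in> S \<Longrightarrow> L a \<in> carrier_mat e d"
  shows "mtrace (mat_sum e S (\<lambda>a. L a * \<rho> * adj (L a)) * X) = mtrace (\<rho> * mat_sum d S (\<lambda>a. adj (L a) * X * L a))"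
proof -
  have "mtrace (L a * \<rho> * adj (L a) * X) = mtrace (\<rho> * (adj (L a) * X * L a))" if "a \<in> S" for a
  proof -
    note L = assms(3)[OF that]
    have "mtrace (L a * \<rho> * adj (L a) * X) = mtrace (L a * (\<rho> * adj (L a) * X))"
      using assms(1,2) L by (auto dest!: carrier_dims simp: mat_algebra)
    also have "\<dots> = mtrace ((\<rho> * adj (L a) * X) * L a)"
      using assms(1,2) L by (intro mtrace_comm[of _ e d]) (auto dest!: carrier_dims intro!: carrier_matI)
    also have "\<dots> = mtrace (\<rho> * (adj (L a) * X * L a))"
      using assms(1,2) L by (auto dest!: carrier_dims simp: mat_algebra)
    finally show ?thesis .
  qed
  moreover have "L a * \<rho> * adj (L a) \<in> carrier_mat e e" "adj (L a) * X * L a \<in> carrier_mat d d" if "a \<in> S" for a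
    using assms(1,2) assms(3)[OF that] by (auto dest!: carrier_dims intro!: carrier_matI)
  ultimately show ?thesis using assms(1,2)
    by (subst mtrace_mat_sum_left, simp, simp) (subst mtrace_mat_sum_right, auto)
qed

lemma mtrace_mult_adj_sum:
  assumes "\<sigma> \<in> carrier_mat d d" "P \<in> carrier_mat e d" "R \<in> carrier_mat e d"
  shows "mtrace (\<sigma> * (adj P * R)) = (\<Sum>i<d. \<Sum>k<d. \<Sum>l<e. \<sigma> $$ (i,k) * cnj (P $$ (l,k)) * R $$ (l,i))"
proof -
  have "adj P * R \<in> carrier_mat d d" using assms by (auto intro: mult_carrier_mat)
  then have "mtrace (\<sigma> * (adj P * R)) = (\<Sum>i<d. \<Sum>k<d. \<sigma> $$ (i,k) * (adj P * R) $$ (k,i))"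
    by (rule mtrace_mult_sum[OF assms(1)])
  also have "\<dots> = (\<Sum>i<d. \<Sum>k<d. \<Sum>l<e. \<sigma> $$ (i,k) * cnj (P $$ (l,k)) * R $$ (l,i))"
    by (simp add: index_mult_sum[OF adj_carrier[OF assms(2)] assms(3)] carrier_matD[OF assms(2)]
        sum_distrib_left mult.assoc del: index_mult_mat(1))
  finally show ?thesis .
qed

lemma psd_mtrace_adj_mult_nonneg:
  assumes "psd_mat d \<sigma>" "Z \<in> carrier_mat e d"
  shows "0 \<le> Re (mtrace (\<sigma> * (adj Z * Z)))"
proof -
  obtain g where g: "\<And>i j. i < d \<Longrightarrow> j < d \<Longrightarrow> \<sigma> $$ (i,j) = (\<Sum>m<d. g m i * cnj (g m j))"
    using psd_mat_gram[OF assms(1)] by metis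
  define w where "w l m = (\<Sum>i<d. Z $$ (l,i) * g m i)" for l m
  have "mtrace (\<sigma> * (adj Z * Z)) = (\<Sum>i<d. \<Sum>k<d. \<Sum>l<e. \<sigma> $$ (i,k) * cnj (Z $$ (l,k)) * Z $$ (l,i))"
    by (rule mtrace_mult_adj_sum[OF psd_matD(1)[OF assms(1)] assms(2,2)])
  also have "\<dots> = (\<Sum>l<e. \<Sum>i<d. \<Sum>k<d. \<Sum>m<d. (Z $$ (l,i) * g m i) * cnj (Z $$ (l,k) * g m k))"
    by (subst sum_rotate) (auto simp: g sum_distrib_left sum_distrib_right mult_ac intro!: sum.cong)
  also have "\<dots> = (\<Sum>l<e. \<Sum>m<d. w l m * cnj (w l m))"
  proof (rule sum.cong[OF refl])
    fix l
    show "(\<Sum>i<d. \<Sum>k<d. \<Sum>m<d. (Z $$ (l,i) * g m i) * cnj (Z $$ (l,k) * g m k)) = (\<Sum>m<d. w l m * cnj (w l m))"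
      by (subst sum_rotate) (simp add: w_def sum_product del: complex_cnj_mult)
  qed
  also have "\<dots> = complex_of_real (\<Sum>l<e. \<Sum>m<d. (cmod (w l m))^2)"
    by (simp only: complex_norm_square of_real_sum)
  finally show ?thesis by (simp add: sum_nonneg)
qed

text \<open>The Kadison--Schwarz inequality for the dual map, tested against a positive \<sigma>.
  The difference of the two sides is a sum of terms tr(\<sigma> Z* Z), one for each Kraus
  operator.\<close>

lemma kraus_schwarz:
  assumes \<sigma>: "psd_mat d \<sigma>" and X: "X \<in> carrier_mat e e"
    and L: "\<And>a. a \<in> S \<Longrightarrow> L a \<in> carrier_mat e d"
    and one: "mat_sum d S (\<lambda>a. adj (L a) * L a) = 1\<^sub>m d"
  defines "Y \<equiv> mat_sum d S (\<lambda>a. adj (L a) * X * L a)"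
  shows "adj Y = mat_sum d S (\<lambda>a. adj (L a) * adj X * L a)"
    and "Re (mtrace (\<sigma> * (Y * adj Y))) \<le> Re (mtrace (\<sigma> * mat_sum d S (\<lambda>a. adj (L a) * (X * adj X) * L a)))"
proof -
  note \<sigma>c = psd_matD(1)[OF \<sigma>]
  have Y: "Y \<in> carrier_mat d d" by (simp add: Y_def)
  note c = carrier_dims[OF \<sigma>c] carrier_dims[OF X] carrier_dims[OF Y]
  show aY: "adj Y = mat_sum d S (\<lambda>a. adj (L a) * adj X * L a)"
  proof (rule eq_matI)
    fix i j assume "i < dim_row (mat_sum d S (\<lambda>a. adj (L a) * adj X * L a))" "j < dim_col (mat_sum d S (\<lambda>a. adj (L a) * adj X * L a))"
    then have ij: "i < d" "j < d" by simp_all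
    have "cnj ((adj (L a) * X * L a) $$ (j,i)) = (adj (L a) * adj X * L a) $$ (i,j)" if "a \<in> S" for a
    proof -
      have "adj (adj (L a) * X * L a) = adj (L a) * adj X * L a"
        using L[OF that] X by (auto dest!: carrier_dims simp: mat_algebra)
      then show ?thesis using index_adj[of i "adj (L a) * X * L a" j] L[OF that] ij
        by (metis carrier_matD(2) dim_adj(1) index_mult_mat(2,3))
    qed
    then show "adj Y $$ (i,j) = mat_sum d S (\<lambda>a. adj (L a) * adj X * L a) $$ (i,j)"
      using Y ij by (simp add: Y_def index_mat_sum carrier_matD[OF mat_sum_carrier] del: index_mult_mat(1))
  qed (use Y in \<open>auto simp: mat_sum_def\<close>)
  \<comment> \<open>The square is taken of \<open>P a - R a\<close>. Summed over \<open>a\<close>,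
    both cross terms and the square of \<open>R a\<close> give the same trace of
    \<open>\<sigma> * (Y * adj Y)\<close>, the last one by \<open>one\<close>; with the signs -1, -1
    and +1 exactly one negative copy remains.\<close>
  define P where "P a = adj X * L a" for a
  define R where "R a = L a * adj Y" for a
  have P: "P a \<in> carrier_mat e d" and R: "R a \<in> carrier_mat e d" if "a \<in> S" for a
    using L[OF that] X Y by (auto simp: P_def R_def dest!: carrier_dims intro!: carrier_matI)
  have LXL: "adj (L a) * X * L a \<in> carrier_mat d d" "adj (L a) * adj X * L a \<in> carrier_mat d d"
      "adj (L a) * (X * adj X) * L a \<in> carrier_mat d d" "adj (L a) * L a \<in> carrier_mat d d" if "a \<in> S" for a
    using L[OF that] X by (auto dest!: carrier_dims intro!: carrier_matI)
  have T1: "(\<Sum>a\<in>S. mtrace (\<sigma> * (adj (P a) * P a))) = mtrace (\<sigma> * mat_sum d S (\<lambda>a. adj (L a) * (X * adj X) * L a))"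
  proof -
    have "adj (P a) * P a = adj (L a) * (X * adj X) * L a" if "a \<in> S" for a
      using L[OF that] X unfolding P_def by (auto dest!: carrier_dims simp: mat_algebra)
    then show ?thesis by (subst mtrace_mat_sum_right[OF LXL(3) \<sigma>c]) auto
  qed
  have T2: "(\<Sum>a\<in>S. mtrace (\<sigma> * (adj (P a) * R a))) = mtrace (\<sigma> * (Y * adj Y))"
  proof -
    have "mtrace (\<sigma> * (adj (P a) * R a)) = mtrace ((adj Y * \<sigma>) * (adj (L a) * X * L a))" if "a \<in> S" for a
    proof -
      have "\<sigma> * (adj (P a) * R a) = (\<sigma> * (adj (L a) * X * L a)) * adj Y"
        using L[OF that] X \<sigma>c Y unfolding P_def R_def by (auto dest!: carrier_dims simp: mat_algebra)
      then have "mtrace (\<sigma> * (adj (P a) * R a)) = mtrace (adj Y * (\<sigma> * (adj (L a) * X * L a)))"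
        using LXL[OF that] \<sigma>c Y by (simp only:) (rule mtrace_comm[of _ d d], auto intro: mult_carrier_mat)
      then show ?thesis using L[OF that] \<sigma>c Y by (auto dest!: carrier_dims simp: mat_algebra)
    qed
    then have "(\<Sum>a\<in>S. mtrace (\<sigma> * (adj (P a) * R a))) = (\<Sum>a\<in>S. mtrace ((adj Y * \<sigma>) * (adj (L a) * X * L a)))" by simp
    also have "\<dots> = mtrace ((adj Y * \<sigma>) * Y)"
      unfolding Y_def by (rule mtrace_mat_sum_right[symmetric, OF LXL(1)]) (auto intro!: mult_carrier_mat[OF _ \<sigma>c])
    also have "(adj Y * \<sigma>) * Y = adj Y * (\<sigma> * Y)"
      using \<sigma>c Y by (auto dest!: carrier_dims simp: mat_algebra)
    also have "mtrace \<dots> = mtrace ((\<sigma> * Y) * adj Y)"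
      by (rule mtrace_comm[of _ d d]) (use \<sigma>c Y in \<open>auto intro: mult_carrier_mat\<close>)
    also have "(\<sigma> * Y) * adj Y = \<sigma> * (Y * adj Y)"
      using \<sigma>c Y by (auto dest!: carrier_dims simp: mat_algebra)
    finally show ?thesis .
  qed
  have T3: "(\<Sum>a\<in>S. mtrace (\<sigma> * (adj (R a) * P a))) = mtrace (\<sigma> * (Y * adj Y))"
  proof -
    have "\<sigma> * (adj (R a) * P a) = (\<sigma> * Y) * (adj (L a) * adj X * L a)" if "a \<in> S" for a
      using L[OF that] X \<sigma>c Y unfolding P_def R_def by (auto dest!: carrier_dims simp: mat_algebra)
    then have "(\<Sum>a\<in>S. mtrace (\<sigma> * (adj (R a) * P a))) = (\<Sum>a\<in>S. mtrace ((\<sigma> * Y) * (adj (L a) * adj X * L a)))" by simp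
    also have "\<dots> = mtrace ((\<sigma> * Y) * adj Y)"
      unfolding aY by (rule mtrace_mat_sum_right[symmetric, OF LXL(2)]) (use \<sigma>c Y in \<open>auto intro: mult_carrier_mat\<close>)
    also have "(\<sigma> * Y) * adj Y = \<sigma> * (Y * adj Y)"
      using \<sigma>c Y by (auto dest!: carrier_dims simp: mat_algebra)
    finally show ?thesis .
  qed
  have T4: "(\<Sum>a\<in>S. mtrace (\<sigma> * (adj (R a) * R a))) = mtrace (\<sigma> * (Y * adj Y))"
  proof -
    have "mtrace (\<sigma> * (adj (R a) * R a)) = mtrace ((adj Y * (\<sigma> * Y)) * (adj (L a) * L a))" if "a \<in> S" for a
    proof -
      have "\<sigma> * (adj (R a) * R a) = (\<sigma> * Y * (adj (L a) * L a)) * adj Y"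
        using L[OF that] X \<sigma>c Y unfolding P_def R_def by (auto dest!: carrier_dims simp: mat_algebra)
      then have "mtrace (\<sigma> * (adj (R a) * R a)) = mtrace (adj Y * (\<sigma> * Y * (adj (L a) * L a)))"
        using LXL[OF that] \<sigma>c Y by (simp only:) (rule mtrace_comm[of _ d d], auto intro!: mult_carrier_mat[of _ d d])
      then show ?thesis using L[OF that] \<sigma>c Y by (auto dest!: carrier_dims simp: mat_algebra)
    qed
    then have "(\<Sum>a\<in>S. mtrace (\<sigma> * (adj (R a) * R a))) = (\<Sum>a\<in>S. mtrace ((adj Y * (\<sigma> * Y)) * (adj (L a) * L a)))" by simp
    also have "\<dots> = mtrace ((adj Y * (\<sigma> * Y)) * mat_sum d S (\<lambda>a. adj (L a) * L a))"
      by (rule mtrace_mat_sum_right[symmetric, OF LXL(4)]) (use \<sigma>c Y in \<open>auto intro!: mult_carrier_mat[of _ d d]\<close>)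
    also have "\<dots> = mtrace (adj Y * (\<sigma> * Y))"
      unfolding one using c by simp
    also have "\<dots> = mtrace ((\<sigma> * Y) * adj Y)"
      by (rule mtrace_comm[of _ d d]) (use \<sigma>c Y in \<open>auto intro: mult_carrier_mat\<close>)
    also have "(\<sigma> * Y) * adj Y = \<sigma> * (Y * adj Y)"
      using \<sigma>c Y by (auto dest!: carrier_dims simp: mat_algebra)
    finally show ?thesis .
  qed
  have expand: "mtrace (\<sigma> * (adj (P a - R a) * (P a - R a))) =
      mtrace (\<sigma> * (adj (P a) * P a)) - mtrace (\<sigma> * (adj (P a) * R a))
      - mtrace (\<sigma> * (adj (R a) * P a)) + mtrace (\<sigma> * (adj (R a) * R a))" if "a \<in> S" for a
  proof -
    note cc = P[OF that] R[OF that]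
    have PR: "P a - R a \<in> carrier_mat e d" by (rule minus_carrier_mat[OF cc(2)])
    show ?thesis
      unfolding mtrace_mult_adj_sum[OF \<sigma>c PR PR] mtrace_mult_adj_sum[OF \<sigma>c cc(1) cc(1)]
        mtrace_mult_adj_sum[OF \<sigma>c cc(1) cc(2)] mtrace_mult_adj_sum[OF \<sigma>c cc(2) cc(1)] mtrace_mult_adj_sum[OF \<sigma>c cc(2) cc(2)]
        sum_subtractf[symmetric] sum.distrib[symmetric]
      using cc by (intro sum.cong refl) (simp add: algebra_simps)
  qed
  have "0 \<le> Re (\<Sum>a\<in>S. mtrace (\<sigma> * (adj (P a - R a) * (P a - R a))))"
    unfolding Re_sum by (intro sum_nonneg psd_mtrace_adj_mult_nonneg[OF \<sigma>, of _ e] minus_carrier_mat R)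
  also have "(\<Sum>a\<in>S. mtrace (\<sigma> * (adj (P a - R a) * (P a - R a)))) =
      mtrace (\<sigma> * mat_sum d S (\<lambda>a. adj (L a) * (X * adj X) * L a)) - mtrace (\<sigma> * (Y * adj Y))"
    by (simp add: expand sum.distrib sum_subtractf T1 T2 T3 T4)
  finally show "Re (mtrace (\<sigma> * (Y * adj Y))) \<le> Re (mtrace (\<sigma> * mat_sum d S (\<lambda>a. adj (L a) * (X * adj X) * L a)))"
    by simp
qed

text \<open>The linear term is preserved by duality. Both quadratic terms carry a minus sign and are
  compared by Kadison--Schwarz, applied to \<open>X\<close> for \<sigma> and to \<open>adj X\<close>
  for \<rho>.\<close>

lemma entropy_functional_kraus:
  assumes \<rho>: "psd_mat d \<rho>" and \<sigma>: "psd_mat d \<sigma>" and X: "X \<in> carrier_mat e e" and t: "0 \<le> t"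
    and L: "\<And>a. a \<in> S \<Longrightarrow> L a \<in> carrier_mat e d"
    and one: "mat_sum d S (\<lambda>a. adj (L a) * L a) = 1\<^sub>m d"
  shows "entropy_functional (mat_sum e S (\<lambda>a. L a * \<rho> * adj (L a))) (mat_sum e S (\<lambda>a. L a * \<sigma> * adj (L a))) t X
     \<le> entropy_functional \<rho> \<sigma> t (mat_sum d S (\<lambda>a. adj (L a) * X * L a))"
proof -
  note \<rho>c = psd_matD(1)[OF \<rho>] and \<sigma>c = psd_matD(1)[OF \<sigma>]
  have XX: "X * adj X \<in> carrier_mat e e" "adj X * X \<in> carrier_mat e e" using X by (auto intro: mult_carrier_mat)
  note 1 = kraus_schwarz[OF \<sigma> X L one] and 2 = kraus_schwarz[OF \<rho> adj_carrier[OF X] L one]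
  have "t * Re (mtrace (\<rho> * (adj (mat_sum d S (\<lambda>a. adj (L a) * X * L a)) * mat_sum d S (\<lambda>a. adj (L a) * X * L a))))
     \<le> t * Re (mtrace (\<rho> * mat_sum d S (\<lambda>a. adj (L a) * (adj X * X) * L a)))"
    using 2 1(1) t by (intro mult_left_mono) simp_all
  moreover have "mtrace (mat_sum e S (\<lambda>a. L a * \<rho> * adj (L a)) * X) = mtrace (\<rho> * mat_sum d S (\<lambda>a. adj (L a) * X * L a))"
    by (rule mtrace_kraus_dual[OF \<rho>c X L])
  moreover have "mtrace (mat_sum e S (\<lambda>a. L a * \<sigma> * adj (L a)) * (X * adj X)) = mtrace (\<sigma> * mat_sum d S (\<lambda>a. adj (L a) * (X * adj X) * L a))"
    by (rule mtrace_kraus_dual[OF \<sigma>c XX(1) L])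
  moreover have "mtrace (mat_sum e S (\<lambda>a. L a * \<rho> * adj (L a)) * (adj X * X)) = mtrace (\<rho> * mat_sum d S (\<lambda>a. adj (L a) * (adj X * X) * L a))"
    by (rule mtrace_kraus_dual[OF \<rho>c XX(2) L])
  ultimately show ?thesis
    using 1(2) unfolding entropy_functional_def by simp
qed

lemma psd_kraus:
  assumes \<rho>: "psd_mat d \<rho>" and L: "\<And>a. a \<in> S \<Longrightarrow> L a \<in> carrier_mat e d"
  shows "psd_mat e (mat_sum e S (\<lambda>a. L a * \<rho> * adj (L a)))"
proof -
  obtain g where g: "\<And>i j. i < d \<Longrightarrow> j < d \<Longrightarrow> \<rho> $$ (i,j) = (\<Sum>m<d. g m i * cnj (g m j))"
    using psd_mat_gram[OF \<rho>] by metis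
  show ?thesis
  proof (rule psd_mat_gramI[where S = "S \<times> {..<d}" and u = "\<lambda>(a,m) i. \<Sum>k<d. L a $$ (i,k) * g m k"])
    fix i j assume ij: "i < e" "j < e"
    have "(L a * \<rho> * adj (L a)) $$ (i,j) = (\<Sum>m<d. (\<Sum>k<d. L a $$ (i,k) * g m k) * cnj (\<Sum>k<d. L a $$ (j,k) * g m k))" if "a \<in> S" for a
    proof -
      have "(L a * \<rho> * adj (L a)) $$ (i,j) = (\<Sum>k<d. \<Sum>l<d. \<Sum>m<d. (L a $$ (i,k) * g m k) * cnj (L a $$ (j,l) * g m l))"
        using ij by (subst index_conj_sum[OF L[OF that] psd_matD(1)[OF \<rho>]]) (auto simp: g sum_distrib_left sum_distrib_right mult_ac intro!: sum.cong)
      also have "\<dots> = (\<Sum>m<d. (\<Sum>k<d. L a $$ (i,k) * g m k) * cnj (\<Sum>k<d. L a $$ (j,k) * g m k))"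
        by (subst sum_rotate) (simp add: sum_product del: complex_cnj_mult)
      finally show ?thesis .
    qed
    then show "mat_sum e S (\<lambda>a. L a * \<rho> * adj (L a)) $$ (i,j) = (\<Sum>k\<in>S \<times> {..<d}. (case k of (a,m) \<Rightarrow> \<lambda>i. \<Sum>k<d. L a $$ (i,k) * g m k) i * cnj ((case k of (a,m) \<Rightarrow> \<lambda>i. \<Sum>k<d. L a $$ (i,k) * g m k) j))"
      using ij by (simp add: index_mat_sum sum.cartesian_product' del: index_mult_mat(1))
  qed simp
qed

text \<open>For each t the optimal \<open>X\<close> for the outputs is pulled back by the dual map
  to a candidate for the inputs, which compares the two suprema. The arbitrary index set serves both
  a single permutation matrix and a family indexed by group elements and Gram vectors.\<close>

theorem rel_ent_kraus_mono:
  assumes \<rho>: "psd_mat d \<rho>" and \<sigma>: "psd_mat d \<sigma>"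
    and L: "\<And>a. a \<in> S \<Longrightarrow> L a \<in> carrier_mat e d"
    and one: "mat_sum d S (\<lambda>a. adj (L a) * L a) = 1\<^sub>m d"
  shows "rel_ent (mat_sum e S (\<lambda>a. L a * \<rho> * adj (L a))) (mat_sum e S (\<lambda>a. L a * \<sigma> * adj (L a))) \<le> rel_ent \<rho> \<sigma>"
proof -
  define \<rho>' where "\<rho>' = mat_sum e S (\<lambda>a. L a * \<rho> * adj (L a))"
  define \<sigma>' where "\<sigma>' = mat_sum e S (\<lambda>a. L a * \<sigma> * adj (L a))"
  have \<rho>': "psd_mat e \<rho>'" and \<sigma>': "psd_mat e \<sigma>'" 
    unfolding \<rho>'_def \<sigma>'_def by (rule psd_kraus[OF \<rho> L], assumption, rule psd_kraus[OF \<sigma> L])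
  note c = psd_matD(1)[OF \<rho>] psd_matD(1)[OF \<sigma>] and c' = psd_matD(1)[OF \<rho>'] psd_matD(1)[OF \<sigma>']
  obtain W p where W: "spec_decomp \<rho> W p" and p: "\<And>i. i < d \<Longrightarrow> 0 \<le> p i" using psd_spec_decomp[OF \<rho>] by blast
  obtain Z q where Z: "spec_decomp \<sigma> Z q" and q: "\<And>i. i < d \<Longrightarrow> 0 \<le> q i" using psd_spec_decomp[OF \<sigma>] by blast
  obtain W' p' where W': "spec_decomp \<rho>' W' p'" and p': "\<And>i. i < e \<Longrightarrow> 0 \<le> p' i" using psd_spec_decomp[OF \<rho>'] by blast
  obtain Z' q' where Z': "spec_decomp \<sigma>' Z' q'" and q': "\<And>i. i < e \<Longrightarrow> 0 \<le> q' i" using psd_spec_decomp[OF \<sigma>'] by blast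
  define k where "k i j = (cmod ((adj W * Z) $$ (i,j)))^2" for i j
  define k' where "k' i j = (cmod ((adj W' * Z') $$ (i,j)))^2" for i j
  have le: "(\<Sum>i<e. \<Sum>j<e. k' i j * (p' i)^2 / (q' j + t * p' i)) \<le> (\<Sum>i<d. \<Sum>j<d. k i j * (p i)^2 / (q j + t * p i))"
    if t: "t > 0" for t
  proof -
    obtain X where X: "X \<in> carrier_mat e e" "entropy_functional \<rho>' \<sigma>' t X = (\<Sum>i<e. \<Sum>j<e. k' i j * (p' i)^2 / (q' j + t * p' i))"
      using entropy_functional_attained[OF c'(1) W' p' c'(2) Z' q' t] unfolding k'_def by blast
    have "entropy_functional \<rho>' \<sigma>' t X \<le> entropy_functional \<rho> \<sigma> t (mat_sum d S (\<lambda>a. adj (L a) * X * L a))"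
      unfolding \<rho>'_def \<sigma>'_def using t by (intro entropy_functional_kraus[OF \<rho> \<sigma> X(1) _ L one]) auto
    also have "\<dots> \<le> (\<Sum>i<d. \<Sum>j<d. k i j * (p i)^2 / (q j + t * p i))"
      unfolding k_def by (rule entropy_functional_le[OF c(1) W p c(2) Z q t mat_sum_carrier])
    finally show ?thesis using X(2) by simp
  qed
  have tr': "(\<Sum>i<e. \<Sum>j<e. k' i j * p' i) = Re (mtrace \<rho>')"
    unfolding mtrace_spec[OF W' c'(1)] k'_def sum_distrib_right[symmetric]
    using overlap_sums(1)[OF spec_decompD(1)[OF W' c'(1)] spec_decompD(1)[OF Z' c'(2)]] by simp
  have tr: "(\<Sum>i<d. \<Sum>j<d. k i j * p i) = Re (mtrace \<rho>)"
    unfolding mtrace_spec[OF W c(1)] k_def sum_distrib_right[symmetric]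
    using overlap_sums(1)[OF spec_decompD(1)[OF W c(1)] spec_decompD(1)[OF Z c(2)]] by simp
  \<comment> \<open>Trace preservation is duality tested on the identity matrix.\<close>
  have tt: "mtrace \<rho>' = mtrace \<rho>"
  proof -
    have "mtrace \<rho>' = mtrace (\<rho>' * 1\<^sub>m e)" using c' by simp
    also have "\<dots> = mtrace (\<rho> * mat_sum d S (\<lambda>a. adj (L a) * 1\<^sub>m e * L a))"
      unfolding \<rho>'_def by (rule mtrace_kraus_dual[OF c(1) _ L]) auto
    also have "mat_sum d S (\<lambda>a. adj (L a) * 1\<^sub>m e * L a) = mat_sum d S (\<lambda>a. adj (L a) * L a)"
      unfolding mat_sum_def
    proof (rule cong_mat[OF refl refl], clarsimp simp del: index_mult_mat)
      fix i j
      show "(\<Sum>a\<in>S. (adj (L a) * 1\<^sub>m e * L a) $$ (i, j)) = (\<Sum>a\<in>S. (adj (L a) * L a) $$ (i, j))"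
        by (rule sum.cong[OF refl]) (metis L adj_carrier right_mult_one_mat)
    qed
    finally show ?thesis using one c by simp
  qed
  have D: "rel_ent \<rho> \<sigma> = (if \<forall>i<d. \<forall>j<d. q j = 0 \<longrightarrow> k i j * p i = 0
     then ereal (\<Sum>i<d. \<Sum>j<d. k i j * p i * (ln0 (p i) - ln0 (q j))) else \<infinity>)"
    unfolding k_def by (rule rel_ent_overlap[OF \<rho> W p Z c(2)])
  have D': "rel_ent \<rho>' \<sigma>' = (if \<forall>i<e. \<forall>j<e. q' j = 0 \<longrightarrow> k' i j * p' i = 0
     then ereal (\<Sum>i<e. \<Sum>j<e. k' i j * p' i * (ln0 (p' i) - ln0 (q' j))) else \<infinity>)"
    unfolding k'_def by (rule rel_ent_overlap[OF \<rho>' W' p' Z' c'(2)])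
  have "rel_ent \<rho>' \<sigma>' \<le> rel_ent \<rho> \<sigma>"
  proof (cases "\<forall>i<d. \<forall>j<d. q j = 0 \<longrightarrow> k i j * p i = 0")
    case True
    let ?I = "{..<e} \<times> {..<e}" and ?J = "{..<d} \<times> {..<d}"
    have fin: "finite ?I" "finite ?J" by auto
    have nn: "0 \<le> k' (fst a) (snd a) \<and> 0 \<le> p' (fst a) \<and> 0 \<le> q' (snd a)" if "a \<in> ?I" for a
      using that p' q' by (auto simp: k'_def)
    have nn': "0 \<le> k (fst a) (snd a) \<and> 0 \<le> p (fst a) \<and> 0 \<le> q (snd a)" if "a \<in> ?J" for a
      using that p q by (auto simp: k_def)
    have trs: "(\<Sum>a\<in>?I. k' (fst a) (snd a) * p' (fst a)) = (\<Sum>a\<in>?J. k (fst a) (snd a) * p (fst a))"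
      using tr tr' tt by (simp add: sum.cartesian_product')
    have les: "(\<Sum>a\<in>?I. k' (fst a) (snd a) * (p' (fst a))\<^sup>2 / (q' (snd a) + t * p' (fst a)))
       \<le> (\<Sum>a\<in>?J. k (fst a) (snd a) * (p (fst a))\<^sup>2 / (q (snd a) + t * p (fst a)))" if "t > 0" for t
      using le[OF that] by (simp add: sum.cartesian_product')
    have su: "k (fst a) (snd a) * p (fst a) = 0" if "a \<in> ?J" "q (snd a) = 0" for a
      using True that by (auto simp del: mult_eq_0_iff)
    \<comment> \<open>In the comparison of sums the unprimed side is the smaller one, so the primed
      data of the outputs are put into the unprimed places.\<close>
    note m = relative_entropy_sum_mono[OF fin, where c = "\<lambda>a. k' (fst a) (snd a)" and p = "\<lambda>a. p' (fst a)" and q = "\<lambda>a. q' (snd a)"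
        and c' = "\<lambda>a. k (fst a) (snd a)" and p' = "\<lambda>a. p (fst a)" and q' = "\<lambda>a. q (snd a)", OF nn nn' trs les su]
    have m1: "\<forall>a\<in>?I. q' (snd a) = 0 \<longrightarrow> k' (fst a) (snd a) * p' (fst a) = 0"
      by (rule m(1))
    have m2: "(\<Sum>a\<in>?I. k' (fst a) (snd a) * p' (fst a) * (ln0 (p' (fst a)) - ln0 (q' (snd a))))
        \<le> (\<Sum>a\<in>?J. k (fst a) (snd a) * p (fst a) * (ln0 (p (fst a)) - ln0 (q (snd a))))"
      by (rule m(2))
    have su': "\<forall>i<e. \<forall>j<e. q' j = 0 \<longrightarrow> k' i j * p' i = 0"
      using m1 by (auto simp del: mult_eq_0_iff)
    show ?thesis
      using m2 unfolding D D' if_P[OF True] if_P[OF su'] by (simp only: ereal_less_eq sum.cartesian_product' fst_conv snd_conv)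
  next
    case False
    then show ?thesis unfolding D by (simp only: if_False) simp
  qed
  then show ?thesis unfolding \<rho>'_def \<sigma>'_def .
qed

section \<open>Tensor products and partial traces\<close>


lemma mult_add_less: "x * e + a < d * e" if "x < d" "a < e" for x a d e :: nat
proof -
  have "x * e + a < Suc x * e" using that by simp
  also have "\<dots> \<le> d * e" using that by (intro mult_right_mono) auto
  finally show ?thesis .
qed

lemma mult_add_div: "a < e \<Longrightarrow> (x * e + a) div e = x" for x a e :: nat
  by (rule div_nat_eqI) auto

lemma length_mr_digits [simp]: "length (mr_digits ds x) = length ds"
  by (induction ds arbitrary: x) auto

lemma mr_digits_less:
  "x < prod_list ds \<Longrightarrow> i < length ds \<Longrightarrow> mr_digits ds x ! i < ds ! i"
proof (induction ds arbitrary: x i)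
  case (Cons d ds)
  then have "prod_list ds > 0" by (cases "prod_list ds") auto
  then show ?case using Cons by (cases i) (auto simp: less_mult_imp_div_less)
qed simp

lemma mr_digits_inj:
  "x < prod_list ds \<Longrightarrow> y < prod_list ds \<Longrightarrow> (\<And>i. i < length ds \<Longrightarrow> mr_digits ds x ! i = mr_digits ds y ! i) \<Longrightarrow> x = y"
proof (induction ds arbitrary: x y)
  case (Cons d ds)
  then have p: "prod_list ds > 0" by (cases "prod_list ds") auto
  have "x div prod_list ds = y div prod_list ds" using Cons.prems(3)[of 0] by simp
  moreover have "x mod prod_list ds = y mod prod_list ds"
    by (rule Cons.IH) (use p Cons.prems(3)[of "Suc _"] in auto)
  ultimately show ?case by (metis div_mult_mod_eq)
qed simp

lemma mr_digits_surj:
  "(\<And>i. i < length ds \<Longrightarrow> g i < ds ! i) \<Longrightarrow> \<exists>x<prod_list ds. \<forall>i<length ds. mr_digits ds x ! i = g i"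
proof (induction ds arbitrary: g)
  case (Cons d ds)
  have "\<exists>y<prod_list ds. \<forall>i<length ds. mr_digits ds y ! i = g (Suc i)"
    by (rule Cons.IH) (use Cons.prems[of "Suc _"] in auto)
  then obtain y where y: "y < prod_list ds" "\<And>i. i < length ds \<Longrightarrow> mr_digits ds y ! i = g (Suc i)" by blast
  have g0: "g 0 < d" using Cons.prems[of 0] by simp
  have "g 0 * prod_list ds + y < d * prod_list ds" by (rule mult_add_less[OF g0 y(1)])
  moreover have "(g 0 * prod_list ds + y) div prod_list ds = g 0" by (rule mult_add_div[OF y(1)])
  then have "mr_digits (d # ds) (g 0 * prod_list ds + y) ! i = g i" if "i < length (d # ds)" for i
    using y that by (cases i) auto
  ultimately show ?case by auto
qed simp

lemma sum_div_mod:
  fixes h :: "nat \<Rightarrow> nat \<Rightarrow> 'a :: comm_monoid_add"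
  shows "(\<Sum>x<d * P. h (x div P) (x mod P)) = (\<Sum>a<d. \<Sum>y<P. h a y)"
proof -
  have "(\<Sum>a<d. \<Sum>y<P. h a y) = (\<Sum>(a,y)\<in>{..<d} \<times> {..<P}. h a y)"
    by (rule sum.cartesian_product)
  also have "\<dots> = (\<Sum>x<d * P. h (x div P) (x mod P))"
  proof (rule sum.reindex_bij_witness[where i = "\<lambda>x. (x div P, x mod P)" and j = "\<lambda>(a,y). a * P + y"])
    fix x assume "x \<in> {..<d * P}"
    then have "x < d * P" by simp
    moreover from this have "P > 0" by (cases P) auto
    ultimately show "(x div P, x mod P) \<in> {..<d} \<times> {..<P}" by (auto simp: less_mult_imp_div_less)
  next
    fix b assume "b \<in> {..<d} \<times> {..<P}"
    then obtain a y where b: "b = (a,y)" "a < d" "y < P" by auto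
    then show "(case b of (a,y) \<Rightarrow> a * P + y) \<in> {..<d * P}" by (simp add: mult_add_less)
  qed auto
  finally show ?thesis by simp
qed

lemma sum_split_mult:
  fixes H :: "nat \<Rightarrow> 'a :: comm_monoid_add"
  shows "(\<Sum>x<d * P. H x) = (\<Sum>a<d. \<Sum>y<P. H (a * P + y))"
  using sum_div_mod[where d = d and P = P and h = "\<lambda>a y. H (a * P + y)"] by simp

text \<open>The distributive law in mixed-radix form. Every contraction of tensor products below
  reduces to it or to its version with two indices.\<close>

lemma sum_prod_mr_digits:
  fixes f :: "nat \<Rightarrow> nat \<Rightarrow> 'a :: comm_semiring_1"
  shows "(\<Sum>x<prod_list ds. \<Prod>i<length ds. f i (mr_digits ds x ! i)) = (\<Prod>i<length ds. \<Sum>a<ds ! i. f i a)"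
proof (induction ds arbitrary: f)
  case (Cons d ds)
  have "(\<Sum>x<prod_list (d # ds). \<Prod>i<length (d # ds). f i (mr_digits (d # ds) x ! i)) =
     (\<Sum>x<d * prod_list ds. f 0 (x div prod_list ds) * (\<Prod>i<length ds. f (Suc i) (mr_digits ds (x mod prod_list ds) ! i)))"
    by (simp add: prod.lessThan_Suc_shift del: prod.lessThan_Suc)
  also have "\<dots> = (\<Sum>a<d. \<Sum>y<prod_list ds. f 0 a * (\<Prod>i<length ds. f (Suc i) (mr_digits ds y ! i)))"
    by (rule sum_div_mod)
  also have "\<dots> = (\<Sum>a<d. f 0 a) * (\<Prod>i<length ds. \<Sum>a<ds ! i. f (Suc i) a)"
    by (simp add: sum_distrib_left[symmetric] sum_distrib_right[symmetric] Cons.IH[of "\<lambda>i. f (Suc i)"])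
  finally show ?case by (simp add: prod.lessThan_Suc_shift del: prod.lessThan_Suc)
qed simp

lemma sum2_prod_mr_digits:
  fixes f :: "nat \<Rightarrow> nat \<Rightarrow> nat \<Rightarrow> 'a :: comm_semiring_1"
  assumes "length ds = length es"
  shows "(\<Sum>x<prod_list ds. \<Sum>y<prod_list es. \<Prod>i<length ds. f i (mr_digits ds x ! i) (mr_digits es y ! i))
    = (\<Prod>i<length ds. \<Sum>a<ds ! i. \<Sum>b<es ! i. f i a b)"
  using assms
proof (induction ds es arbitrary: f rule: list_induct2)
  case (Cons d ds e es)
  let ?F = "\<lambda>x y. \<Prod>i<length ds. f (Suc i) (mr_digits ds x ! i) (mr_digits es y ! i)"
  have "(\<Sum>x<prod_list (d # ds). \<Sum>y<prod_list (e # es). \<Prod>i<length (d # ds). f i (mr_digits (d # ds) x ! i) (mr_digits (e # es) y ! i)) =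
     (\<Sum>x<d * prod_list ds. \<Sum>y<e * prod_list es. f 0 (x div prod_list ds) (y div prod_list es) * ?F (x mod prod_list ds) (y mod prod_list es))"
    by (simp add: prod.lessThan_Suc_shift del: prod.lessThan_Suc)
  also have "\<dots> = (\<Sum>a<d. \<Sum>x<prod_list ds. \<Sum>y<e * prod_list es. f 0 a (y div prod_list es) * ?F x (y mod prod_list es))"
    by (rule sum_div_mod[where h = "\<lambda>a x. \<Sum>y<e * prod_list es. f 0 a (y div prod_list es) * ?F x (y mod prod_list es)"])
  also have "\<dots> = (\<Sum>a<d. \<Sum>x<prod_list ds. \<Sum>b<e. \<Sum>y<prod_list es. f 0 a b * ?F x y)"
  proof (rule sum.cong[OF refl], rule sum.cong[OF refl])
    fix a x
    show "(\<Sum>y<e * prod_list es. f 0 a (y div prod_list es) * ?F x (y mod prod_list es)) = (\<Sum>b<e. \<Sum>y<prod_list es. f 0 a b * ?F x y)"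
      by (rule sum_div_mod[where h = "\<lambda>b y. f 0 a b * ?F x y"])
  qed
  also have "\<dots> = (\<Sum>a<d. \<Sum>b<e. f 0 a b * (\<Sum>x<prod_list ds. \<Sum>y<prod_list es. ?F x y))"
    by (rule sum.cong[OF refl], subst sum.swap) (simp add: sum_distrib_left)
  also have "\<dots> = (\<Sum>a<d. \<Sum>b<e. f 0 a b) * (\<Prod>i<length ds. \<Sum>a<ds ! i. \<Sum>b<es ! i. f (Suc i) a b)"
    by (simp only: Cons.IH[of "\<lambda>i. f (Suc i)"] sum_distrib_right)
  finally show ?case by (simp add: prod.lessThan_Suc_shift del: prod.lessThan_Suc)
qed simp

lemma prod_indicator:
  "finite A \<Longrightarrow> (\<Prod>i\<in>A. if P i then 1 else 0 :: 'a :: comm_semiring_1) = (if \<forall>i\<in>A. P i then 1 else 0)"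
  by (induction A rule: finite_induct) auto

lemma prod_indicator_mr_digits:
  assumes "x < prod_list ds" "y < prod_list ds"
  shows "(\<Prod>i<length ds. if mr_digits ds x ! i = mr_digits ds y ! i then 1 else 0 :: 'a :: comm_semiring_1)
    = (if x = y then 1 else 0)"
  using mr_digits_inj[OF assms] by (subst prod_indicator) auto

section \<open>Tensor products of indexed families\<close>

lemma dim_tensor_list:
  "dim_row (tensor_list As) = prod_list (map dim_row As)" "dim_col (tensor_list As) = prod_list (map dim_col As)"
  by (induction As) (auto simp: tensor_list_def kron_def)

lemma index_tensor_list:
  "x < prod_list (map dim_row As) \<Longrightarrow> y < prod_list (map dim_col As) \<Longrightarrow>
   tensor_list As $$ (x,y) = (\<Prod>i<length As. (As ! i) $$ (mr_digits (map dim_row As) x ! i, mr_digits (map dim_col As) y ! i))"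
proof (induction As arbitrary: x y)
  case Nil
  then show ?case by (simp add: tensor_list_def)
next
  case (Cons A As)
  let ?r = "prod_list (map dim_row As)" and ?c = "prod_list (map dim_col As)"
  have x: "x < dim_row A * ?r" and y: "y < dim_col A * ?c" using Cons.prems by auto
  have "?r > 0" using x by (cases ?r) auto
  moreover have "?c > 0" using y by (cases ?c) auto
  ultimately have m: "x mod ?r < ?r" "y mod ?c < ?c" by auto
  have "tensor_list (A # As) = kron A (tensor_list As)" by (simp add: tensor_list_def)
  then have "tensor_list (A # As) $$ (x,y) = A $$ (x div ?r, y div ?c) * tensor_list As $$ (x mod ?r, y mod ?c)"
    using x y by (simp add: kron_def dim_tensor_list)
  also have "\<dots> = (\<Prod>i<length (A # As). ((A # As) ! i) $$ (mr_digits (map dim_row (A # As)) x ! i, mr_digits (map dim_col (A # As)) y ! i))"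
    by (simp add: Cons.IH[OF m] prod.lessThan_Suc_shift del: prod.lessThan_Suc)
  finally show ?case .
qed

text \<open>Families indexed by positions allow factorwise operations to be written as functions of
  the position, with a list of dimensions recording the shapes.\<close>

abbreviation tensor_upto :: "nat \<Rightarrow> (nat \<Rightarrow> complex mat) \<Rightarrow> complex mat" where
  "tensor_upto n M \<equiv> tensor_list (map M [0..<n])"

lemma tensor_upto_carrier:
  assumes "\<And>i. i < length rs \<Longrightarrow> M i \<in> carrier_mat (rs ! i) (cs ! i)" "length cs = length rs"
  shows "tensor_upto (length rs) M \<in> carrier_mat (prod_list rs) (prod_list cs)"
    and "map dim_row (map M [0..<length rs]) = rs" "map dim_col (map M [0..<length rs]) = cs"
proof -
  show 1: "map dim_row (map M [0..<length rs]) = rs" by (rule nth_equalityI) (use assms in auto)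
  show 2: "map dim_col (map M [0..<length rs]) = cs" by (rule nth_equalityI) (use assms in auto)
  show "tensor_upto (length rs) M \<in> carrier_mat (prod_list rs) (prod_list cs)"
    by (rule carrier_matI) (simp_all only: dim_tensor_list 1 2)
qed

lemma index_tensor_upto:
  assumes "\<And>i. i < length rs \<Longrightarrow> M i \<in> carrier_mat (rs ! i) (cs ! i)" "length cs = length rs"
    and "x < prod_list rs" "y < prod_list cs"
  shows "tensor_upto (length rs) M $$ (x,y) = (\<Prod>i<length rs. M i $$ (mr_digits rs x ! i, mr_digits cs y ! i))"
proof -
  have d: "map dim_row (map M [0..<length rs]) = rs" "map dim_col (map M [0..<length rs]) = cs"
    by (rule tensor_upto_carrier(2)[OF assms(1,2)], assumption, rule tensor_upto_carrier(3)[OF assms(1,2)])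
  show ?thesis using index_tensor_list[of x "map M [0..<length rs]" y, unfolded d] assms(3,4) by simp
qed

lemma tensor_upto_mult:
  assumes A: "\<And>i. i < length ds \<Longrightarrow> A i \<in> carrier_mat (ds ! i) (ds ! i)"
    and B: "\<And>i. i < length ds \<Longrightarrow> B i \<in> carrier_mat (ds ! i) (ds ! i)"
  shows "tensor_upto (length ds) A * tensor_upto (length ds) B = tensor_upto (length ds) (\<lambda>i. A i * B i)"
proof -
  have AB: "A i * B i \<in> carrier_mat (ds ! i) (ds ! i)" if "i < length ds" for i
    using A[OF that] B[OF that] by simp
  note cA = tensor_upto_carrier(1)[where rs = ds and cs = ds, OF A refl]
    and cB = tensor_upto_carrier(1)[where rs = ds and cs = ds, OF B refl]
    and cAB = tensor_upto_carrier(1)[where rs = ds and cs = ds, OF AB refl]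
  show ?thesis
  proof (rule eq_matI)
    fix x y assume "x < dim_row (tensor_upto (length ds) (\<lambda>i. A i * B i))" "y < dim_col (tensor_upto (length ds) (\<lambda>i. A i * B i))"
    then have xy: "x < prod_list ds" "y < prod_list ds" using cAB by auto
    have "(tensor_upto (length ds) A * tensor_upto (length ds) B) $$ (x,y)
       = (\<Sum>z<prod_list ds. \<Prod>i<length ds. A i $$ (mr_digits ds x ! i, mr_digits ds z ! i) * B i $$ (mr_digits ds z ! i, mr_digits ds y ! i))"
      using xy by (subst index_mult_sum[OF cA cB])
        (auto simp: index_tensor_upto[where rs = ds and cs = ds, OF A refl] index_tensor_upto[where rs = ds and cs = ds, OF B refl] prod.distrib)
    also have "\<dots> = (\<Prod>i<length ds. \<Sum>c<ds ! i. A i $$ (mr_digits ds x ! i, c) * B i $$ (c, mr_digits ds y ! i))"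
      by (rule sum_prod_mr_digits)
    also have "\<dots> = tensor_upto (length ds) (\<lambda>i. A i * B i) $$ (x,y)"
      using xy by (subst index_tensor_upto[where rs = ds and cs = ds, OF AB refl])
        (auto simp: index_mult_sum[OF A B] mr_digits_less simp del: index_mult_mat(1) intro!: prod.cong)
    finally show "(tensor_upto (length ds) A * tensor_upto (length ds) B) $$ (x,y) = tensor_upto (length ds) (\<lambda>i. A i * B i) $$ (x,y)" .
  qed (use cA cB cAB in auto)
qed

lemma tensor_upto_adj:
  assumes A: "\<And>i. i < length ds \<Longrightarrow> A i \<in> carrier_mat (ds ! i) (ds ! i)"
  shows "adj (tensor_upto (length ds) A) = tensor_upto (length ds) (\<lambda>i. adj (A i))"
proof -
  have A': "adj (A i) \<in> carrier_mat (ds ! i) (ds ! i)" if "i < length ds" for i using A[OF that] by simp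
  note c = tensor_upto_carrier(1)[where rs = ds and cs = ds, OF A refl]
    and c' = tensor_upto_carrier(1)[where rs = ds and cs = ds, OF A' refl]
  show ?thesis
  proof (rule eq_matI)
    fix x y assume "x < dim_row (tensor_upto (length ds) (\<lambda>i. adj (A i)))" "y < dim_col (tensor_upto (length ds) (\<lambda>i. adj (A i)))"
    then have xy: "x < prod_list ds" "y < prod_list ds" using c' by auto
    have "(adj (A i)) $$ (mr_digits ds x ! i, mr_digits ds y ! i) = cnj (A i $$ (mr_digits ds y ! i, mr_digits ds x ! i))" if "i < length ds" for i
      using A[OF that] mr_digits_less[OF xy(1) that] mr_digits_less[OF xy(2) that] by simp
    then show "adj (tensor_upto (length ds) A) $$ (x,y) = tensor_upto (length ds) (\<lambda>i. adj (A i)) $$ (x,y)"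
      using xy c by (simp add: carrier_matD[OF c] index_tensor_upto[where rs = ds and cs = ds, OF A refl] index_tensor_upto[where rs = ds and cs = ds, OF A' refl])
  qed (use c c' in auto)
qed

text \<open>Two different indices differ in some digit, and the factor at that position is then
  0.\<close>

lemma tensor_upto_diag:
  "tensor_upto (length ds) (\<lambda>i. real_diag (ds ! i) (q i)) = real_diag (prod_list ds) (\<lambda>x. \<Prod>i<length ds. q i (mr_digits ds x ! i))"
proof -
  note c = tensor_upto_carrier(1)[where rs = ds and cs = ds, OF real_diag_carrier refl, of q]
  show ?thesis
  proof (rule eq_matI)
    fix x y assume "x < dim_row (real_diag (prod_list ds) (\<lambda>x. \<Prod>i<length ds. q i (mr_digits ds x ! i)))"
      "y < dim_col (real_diag (prod_list ds) (\<lambda>x. \<Prod>i<length ds. q i (mr_digits ds x ! i)))"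
    then have xy: "x < prod_list ds" "y < prod_list ds" by auto
    have "tensor_upto (length ds) (\<lambda>i. real_diag (ds ! i) (q i)) $$ (x,y)
      = (\<Prod>i<length ds. complex_of_real (q i (mr_digits ds x ! i)) * (if mr_digits ds x ! i = mr_digits ds y ! i then 1 else 0))"
      unfolding index_tensor_upto[where rs = ds and cs = ds, OF real_diag_carrier refl xy]
      by (rule prod.cong[OF refl]) (simp add: mr_digits_less[OF xy(1)] mr_digits_less[OF xy(2)])
    also have "\<dots> = (\<Prod>i<length ds. complex_of_real (q i (mr_digits ds x ! i))) * (if x = y then 1 else 0)"
      unfolding prod.distrib prod_indicator_mr_digits[OF xy] ..
    finally show "tensor_upto (length ds) (\<lambda>i. real_diag (ds ! i) (q i)) $$ (x,y) = real_diag (prod_list ds) (\<lambda>x. \<Prod>i<length ds. q i (mr_digits ds x ! i)) $$ (x,y)"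
      using xy by simp
  qed (use c in auto)
qed

lemma real_diag_one: "real_diag d (\<lambda>_. 1) = 1\<^sub>m d"
  by (rule eq_matI) auto

lemma tensor_upto_one: "tensor_upto (length ds) (\<lambda>i. 1\<^sub>m (ds ! i)) = 1\<^sub>m (prod_list ds)"
  using tensor_upto_diag[of ds "\<lambda>_ _. 1"] by (simp add: real_diag_one)

lemma tensor_upto_cong:
  "(\<And>i. i < n \<Longrightarrow> A i = B i) \<Longrightarrow> tensor_upto n A = tensor_upto n B"
  by (metis (mono_tags, lifting) atLeastLessThan_iff map_eq_conv set_upt)

lemma unitary_tensor_upto:
  assumes "\<And>i. i < length ds \<Longrightarrow> unitary_mat (ds ! i) (V i)"
  shows "unitary_mat (prod_list ds) (tensor_upto (length ds) V)"
proof (rule unitary_matI)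
  note V = unitary_matD[OF assms]
  show "tensor_upto (length ds) V \<in> carrier_mat (prod_list ds) (prod_list ds)"
    by (rule tensor_upto_carrier(1)[OF V(1) refl])
  have "adj (tensor_upto (length ds) V) * tensor_upto (length ds) V = tensor_upto (length ds) (\<lambda>i. adj (V i) * V i)"
    using V(1) by (simp add: tensor_upto_adj tensor_upto_mult)
  also have "\<dots> = tensor_upto (length ds) (\<lambda>i. 1\<^sub>m (ds ! i))"
    by (rule tensor_upto_cong) (rule V(2))
  finally show "adj (tensor_upto (length ds) V) * tensor_upto (length ds) V = 1\<^sub>m (prod_list ds)"
    by (simp add: tensor_upto_one)
qed

lemma spec_decomp_tensor_upto:
  assumes \<omega>: "\<And>i. i < length ds \<Longrightarrow> \<omega> i \<in> carrier_mat (ds ! i) (ds ! i)"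
    and s: "\<And>i. i < length ds \<Longrightarrow> spec_decomp (\<omega> i) (W i) (q i)"
  shows "spec_decomp (tensor_upto (length ds) \<omega>) (tensor_upto (length ds) W) (\<lambda>x. \<Prod>i<length ds. q i (mr_digits ds x ! i))"
proof (rule spec_decompI)
  have W: "unitary_mat (ds ! i) (W i)" "W i \<in> carrier_mat (ds ! i) (ds ! i)"
     "adj (W i) * \<omega> i * W i = real_diag (ds ! i) (q i)" if "i < length ds" for i
    using spec_decompD[OF s[OF that] \<omega>[OF that]] by auto
  show "tensor_upto (length ds) \<omega> \<in> carrier_mat (prod_list ds) (prod_list ds)"
    by (rule tensor_upto_carrier(1)[OF \<omega> refl])
  show "unitary_mat (prod_list ds) (tensor_upto (length ds) W)" by (rule unitary_tensor_upto[OF W(1)])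
  have "adj (tensor_upto (length ds) W) * tensor_upto (length ds) \<omega> * tensor_upto (length ds) W
     = tensor_upto (length ds) (\<lambda>i. adj (W i) * \<omega> i * W i)"
    using W(2) \<omega> mult_carrier_mat[OF adj_carrier[OF W(2)] \<omega>] by (simp add: tensor_upto_adj tensor_upto_mult)
  also have "\<dots> = tensor_upto (length ds) (\<lambda>i. real_diag (ds ! i) (q i))"
    by (rule tensor_upto_cong) (rule W(3))
  finally show "adj (tensor_upto (length ds) W) * tensor_upto (length ds) \<omega> * tensor_upto (length ds) W
     = real_diag (prod_list ds) (\<lambda>x. \<Prod>i<length ds. q i (mr_digits ds x ! i))"
    by (simp add: tensor_upto_diag)
qed

section \<open>Partial traces\<close>

definition ptrace_weight :: "nat \<Rightarrow> nat \<Rightarrow> nat \<Rightarrow> nat \<Rightarrow> nat \<Rightarrow> nat \<Rightarrow> complex" where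
  "ptrace_weight k a b i u v = (if (if i = k then u = a \<and> v = b else u = v) then 1 else 0)"

lemma ptrace_keep_carrier [simp]: "ptrace_keep ds k \<rho> \<in> carrier_mat (ds ! k) (ds ! k)"
  by (simp add: ptrace_keep_def)

text \<open>The condition in \<open>ptrace_keep\<close> is a conjunction over positions; written as
  a product of indicators it can be distributed together with the entries of a tensor
  product.\<close>

lemma index_ptrace_keep:
  assumes "k < length ds" "a < ds ! k" "b < ds ! k"
  shows "ptrace_keep ds k \<rho> $$ (a,b) = (\<Sum>x<prod_list ds. \<Sum>y<prod_list ds.
     (\<Prod>i<length ds. ptrace_weight k a b i (mr_digits ds x ! i) (mr_digits ds y ! i)) * \<rho> $$ (x,y))"
  using assms unfolding ptrace_weight_def
  by (subst prod_indicator) (auto simp: ptrace_keep_def intro!: sum.cong)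

lemma ptrace_weight_remove:
  assumes "k < n"
  shows "(\<Prod>i<n. ptrace_weight k a b i (f i) (g i)) =
     (if f k = a \<and> g k = b then 1 else 0) * (\<Prod>i\<in>{..<n} - {k}. if f i = g i then 1 else 0)"
  using assms by (subst prod.remove[of _ k]) (auto simp: ptrace_weight_def intro!: prod.cong)

lemma sum_swap4:
  "(\<Sum>i\<in>A. \<Sum>j\<in>B. \<Sum>k\<in>C. \<Sum>l\<in>D. f i j k l) = (\<Sum>k\<in>C. \<Sum>l\<in>D. \<Sum>i\<in>A. \<Sum>j\<in>B. f i j k l)"
  by (subst sum_rotate) (intro sum.cong refl sum_rotate)

text \<open>The sums over indices factorise over positions: at \<open>k\<close> the weight selects
  entries of \<open>V k\<close>, and at every other position unitarity turns the sum into a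
  Kronecker delta. The lemma is used to diagonalise marginals and, later, to pass covariance on to
  them.\<close>

lemma ptrace_keep_local_unitary:
  assumes V: "\<And>i. i < length ds \<Longrightarrow> unitary_mat (ds ! i) (V i)"
    and \<rho>: "\<rho> \<in> carrier_mat (prod_list ds) (prod_list ds)" and k: "k < length ds"
  shows "ptrace_keep ds k (tensor_upto (length ds) V * \<rho> * adj (tensor_upto (length ds) V))
     = V k * ptrace_keep ds k \<rho> * adj (V k)"
proof (rule eq_matI)
  let ?n = "length ds" and ?P = "prod_list ds" and ?d = "\<lambda>x i. mr_digits ds x ! i"
  have Vc: "V i \<in> carrier_mat (ds ! i) (ds ! i)" if "i < ?n" for i using unitary_matD[OF V[OF that]] by simp
  note TV = tensor_upto_carrier(1)[where rs = ds and cs = ds, OF Vc refl]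
  fix a b assume "a < dim_row (V k * ptrace_keep ds k \<rho> * adj (V k))" "b < dim_col (V k * ptrace_keep ds k \<rho> * adj (V k))"
  then have ab: "a < ds ! k" "b < ds ! k" using Vc[OF k] by auto
  have "ptrace_keep ds k (tensor_upto ?n V * \<rho> * adj (tensor_upto ?n V)) $$ (a,b) =
    (\<Sum>j<?P. \<Sum>j'<?P. \<Sum>x<?P. \<Sum>y<?P. \<rho> $$ (x,y) *
       (\<Prod>i<?n. ptrace_weight k a b i (?d j i) (?d j' i) * (V i $$ (?d j i, ?d x i) * cnj (V i $$ (?d j' i, ?d y i)))))"
    unfolding index_ptrace_keep[OF k ab]
    by (intro sum.cong refl, subst index_conj_sum[OF TV \<rho>])
      (auto simp: index_tensor_upto[where rs = ds and cs = ds, OF Vc refl] prod.distrib sum_distrib_left mult_ac intro!: sum.cong)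
  also have "\<dots> = (\<Sum>x<?P. \<Sum>y<?P. \<rho> $$ (x,y) * (\<Sum>j<?P. \<Sum>j'<?P.
       (\<Prod>i<?n. ptrace_weight k a b i (?d j i) (?d j' i) * (V i $$ (?d j i, ?d x i) * cnj (V i $$ (?d j' i, ?d y i))))))"
    by (subst sum_swap4) (simp only: sum_distrib_left)
  also have "\<dots> = (\<Sum>x<?P. \<Sum>y<?P. \<rho> $$ (x,y) * ((V k $$ (a, ?d x k) * cnj (V k $$ (b, ?d y k))) *
       (\<Prod>i\<in>{..<?n} - {k}. if ?d x i = ?d y i then 1 else 0)))"
  proof (intro sum.cong refl arg_cong2[where f = "(*)"])
    fix x y assume "x \<in> {..<?P}" "y \<in> {..<?P}"
    then have xy: "x < ?P" "y < ?P" by auto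
    have "(\<Sum>j<?P. \<Sum>j'<?P. (\<Prod>i<?n. ptrace_weight k a b i (?d j i) (?d j' i) * (V i $$ (?d j i, ?d x i) * cnj (V i $$ (?d j' i, ?d y i)))))
      = (\<Prod>i<?n. \<Sum>u<ds ! i. \<Sum>v<ds ! i. ptrace_weight k a b i u v * (V i $$ (u, ?d x i) * cnj (V i $$ (v, ?d y i))))"
      by (rule sum2_prod_mr_digits[where f = "\<lambda>i u v. ptrace_weight k a b i u v * (V i $$ (u, ?d x i) * cnj (V i $$ (v, ?d y i)))"]) simp
    also have "\<dots> = (\<Sum>u<ds ! k. \<Sum>v<ds ! k. ptrace_weight k a b k u v * (V k $$ (u, ?d x k) * cnj (V k $$ (v, ?d y k)))) *
       (\<Prod>i\<in>{..<?n} - {k}. \<Sum>u<ds ! i. \<Sum>v<ds ! i. ptrace_weight k a b i u v * (V i $$ (u, ?d x i) * cnj (V i $$ (v, ?d y i))))"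
      using k by (subst prod.remove[of _ k]) auto
    also have "(\<Sum>u<ds ! k. \<Sum>v<ds ! k. ptrace_weight k a b k u v * (V k $$ (u, ?d x k) * cnj (V k $$ (v, ?d y k))))
       = V k $$ (a, ?d x k) * cnj (V k $$ (b, ?d y k))"
    proof -
      have "(\<Sum>u<ds ! k. \<Sum>v<ds ! k. ptrace_weight k a b k u v * (V k $$ (u, ?d x k) * cnj (V k $$ (v, ?d y k))))
        = (\<Sum>u<ds ! k. \<Sum>v<ds ! k. if v = b then (if u = a then V k $$ (u, ?d x k) * cnj (V k $$ (v, ?d y k)) else 0) else 0)"
        by (intro sum.cong refl) (auto simp: ptrace_weight_def)
      then show ?thesis using ab by simp
    qed
    also have "(\<Prod>i\<in>{..<?n} - {k}. \<Sum>u<ds ! i. \<Sum>v<ds ! i. ptrace_weight k a b i u v * (V i $$ (u, ?d x i) * cnj (V i $$ (v, ?d y i))))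
      = (\<Prod>i\<in>{..<?n} - {k}. if ?d x i = ?d y i then 1 else 0)"
    proof (rule prod.cong[OF refl])
      fix i assume i: "i \<in> {..<?n} - {k}"
      then have i': "i < ?n" by simp
      have "(\<Sum>u<ds ! i. \<Sum>v<ds ! i. ptrace_weight k a b i u v * (V i $$ (u, ?d x i) * cnj (V i $$ (v, ?d y i))))
        = (\<Sum>u<ds ! i. \<Sum>v<ds ! i. if v = u then V i $$ (u, ?d x i) * cnj (V i $$ (v, ?d y i)) else 0)"
        using i by (intro sum.cong refl) (auto simp: ptrace_weight_def)
      also have "\<dots> = (\<Sum>u<ds ! i. cnj (V i $$ (u, ?d y i)) * V i $$ (u, ?d x i))" by (simp add: mult.commute)
      also have "\<dots> = (if ?d x i = ?d y i then 1 else 0)"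
        using unitary_orthonormal_cols[OF V[OF i'] mr_digits_less[OF xy(2) i'] mr_digits_less[OF xy(1) i']] by auto
      finally show "(\<Sum>u<ds ! i. \<Sum>v<ds ! i. ptrace_weight k a b i u v * (V i $$ (u, ?d x i) * cnj (V i $$ (v, ?d y i)))) = (if ?d x i = ?d y i then 1 else 0)" .
    qed
    finally show "(\<Sum>j<?P. \<Sum>j'<?P. (\<Prod>i<?n. ptrace_weight k a b i (?d j i) (?d j' i) * (V i $$ (?d j i, ?d x i) * cnj (V i $$ (?d j' i, ?d y i)))))
      = (V k $$ (a, ?d x k) * cnj (V k $$ (b, ?d y k))) * (\<Prod>i\<in>{..<?n} - {k}. if ?d x i = ?d y i then 1 else 0)" .
  qed
  \<comment> \<open>The digits at position \<open>k\<close> are made free summation variables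
    \<open>c\<close> and \<open>d\<close>; the deltas at the other positions then combine with their
    indicators into the weight of a partial trace.\<close>
  also have "\<dots> = (\<Sum>x<?P. \<Sum>y<?P. \<Sum>c<ds ! k. \<Sum>d<ds ! k. V k $$ (a,c) *
      ((\<Prod>i<?n. ptrace_weight k c d i (?d x i) (?d y i)) * \<rho> $$ (x,y)) * cnj (V k $$ (b,d)))"
  proof (intro sum.cong refl)
    fix x y assume "x \<in> {..<?P}" "y \<in> {..<?P}"
    then have xy: "?d x k < ds ! k" "?d y k < ds ! k" using mr_digits_less k by auto
    let ?R = "\<Prod>i\<in>{..<?n} - {k}. if ?d x i = ?d y i then 1 else 0 :: complex"
    have "(\<Sum>c<ds ! k. \<Sum>d<ds ! k. V k $$ (a,c) * ((\<Prod>i<?n. ptrace_weight k c d i (?d x i) (?d y i)) * \<rho> $$ (x,y)) * cnj (V k $$ (b,d)))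
       = (\<Sum>c<ds ! k. \<Sum>d<ds ! k. if d = ?d y k then (if c = ?d x k then V k $$ (a,c) * (?R * \<rho> $$ (x,y)) * cnj (V k $$ (b,d)) else 0) else 0)"
      by (intro sum.cong refl) (auto simp: ptrace_weight_remove[OF k])
    also have "\<dots> = V k $$ (a,?d x k) * (?R * \<rho> $$ (x,y)) * cnj (V k $$ (b,?d y k))"
      using xy by simp
    finally show "\<rho> $$ (x,y) * ((V k $$ (a, ?d x k) * cnj (V k $$ (b, ?d y k))) * ?R) =
      (\<Sum>c<ds ! k. \<Sum>d<ds ! k. V k $$ (a,c) * ((\<Prod>i<?n. ptrace_weight k c d i (?d x i) (?d y i)) * \<rho> $$ (x,y)) * cnj (V k $$ (b,d)))"
      by (simp only: mult_ac)
  qed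
  also have "\<dots> = (\<Sum>c<ds ! k. \<Sum>d<ds ! k. V k $$ (a,c) * ptrace_keep ds k \<rho> $$ (c,d) * cnj (V k $$ (b,d)))"
    by (subst sum_swap4) (auto simp: index_ptrace_keep[OF k] sum_distrib_left sum_distrib_right intro!: sum.cong)
  also have "\<dots> = (V k * ptrace_keep ds k \<rho> * adj (V k)) $$ (a,b)"
    by (rule index_conj_sum[OF Vc[OF k] ptrace_keep_carrier ab, symmetric])
  finally show "ptrace_keep ds k (tensor_upto ?n V * \<rho> * adj (tensor_upto ?n V)) $$ (a,b) = (V k * ptrace_keep ds k \<rho> * adj (V k)) $$ (a,b)" .
qed (use unitary_matD(1)[OF V[OF k]] in \<open>auto simp: ptrace_keep_def\<close>)

text \<open>Equal digits at \<open>k\<close> together with equal digits elsewhere force equal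
  indices, so the diagonal of a marginal is the classical marginal of the diagonal.\<close>

lemma ptrace_keep_diag:
  assumes k: "k < length ds" and a: "a < ds ! k"
  shows "ptrace_keep ds k \<rho> $$ (a,a) = (\<Sum>x<prod_list ds. if mr_digits ds x ! k = a then \<rho> $$ (x,x) else 0)"
proof -
  have "(\<Prod>i<length ds. ptrace_weight k a a i (mr_digits ds x ! i) (mr_digits ds y ! i)) = (if x = y then (if mr_digits ds x ! k = a then 1 else 0) else 0)"
    if "x < prod_list ds" "y < prod_list ds" for x y
  proof -
    have "(\<forall>i\<in>{..<length ds}. if i = k then mr_digits ds x ! i = a \<and> mr_digits ds y ! i = a else mr_digits ds x ! i = mr_digits ds y ! i)
      \<longleftrightarrow> x = y \<and> mr_digits ds x ! k = a" using mr_digits_inj[OF that] k by (metis lessThan_iff)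
    then show ?thesis unfolding ptrace_weight_def by (subst prod_indicator) auto
  qed
  then have "ptrace_keep ds k \<rho> $$ (a,a) = (\<Sum>x<prod_list ds. \<Sum>y<prod_list ds. if x = y then (if mr_digits ds x ! k = a then \<rho> $$ (x,x) else 0) else 0)"
    unfolding index_ptrace_keep[OF k a a] by (intro sum.cong refl) auto
  then show ?thesis by simp
qed

lemma mtrace_ptrace_keep:
  assumes k: "k < length ds" and \<rho>: "\<rho> \<in> carrier_mat (prod_list ds) (prod_list ds)"
  shows "mtrace (ptrace_keep ds k \<rho>) = mtrace \<rho>"
proof -
  have "mtrace (ptrace_keep ds k \<rho>) = (\<Sum>a<ds ! k. \<Sum>x<prod_list ds. if mr_digits ds x ! k = a then \<rho> $$ (x,x) else 0)"
    using ptrace_keep_diag[OF k] by (simp add: mtrace_def carrier_matD[OF ptrace_keep_carrier])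
  also have "\<dots> = (\<Sum>x<prod_list ds. \<rho> $$ (x,x))"
    by (subst sum.swap) (use mr_digits_less[OF _ k] in \<open>auto intro!: sum.cong\<close>)
  finally show ?thesis using \<rho> by (simp add: mtrace_def)
qed

lemma psd_conj:
  assumes "psd_mat d \<rho>" "L \<in> carrier_mat e d"
  shows "psd_mat e (L * \<rho> * adj L)"
proof -
  have "mat_sum e {()} (\<lambda>_. L * \<rho> * adj L) = L * \<rho> * adj L"
    by (rule mat_sum_singleton) (use assms in \<open>auto dest!: psd_matD(1) carrier_dims intro!: carrier_matI\<close>)
  then show ?thesis using psd_kraus[OF assms(1), of "{()}" "\<lambda>_. L" e] assms(2) by simp
qed

lemma psd_diag_nonneg:
  assumes "psd_mat d A" "i < d"
  shows "0 \<le> Re (A $$ (i,i))" "Im (A $$ (i,i)) = 0"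
proof -
  obtain u where u: "\<And>i j. i < d \<Longrightarrow> j < d \<Longrightarrow> A $$ (i,j) = (\<Sum>k<d. u k i * cnj (u k j))"
    using psd_mat_gram[OF assms(1)] by metis
  have "A $$ (i,i) = complex_of_real (\<Sum>k<d. (cmod (u k i))^2)"
    unfolding u[OF assms(2,2)] by (simp only: complex_norm_square of_real_sum)
  then show "0 \<le> Re (A $$ (i,i))" "Im (A $$ (i,i)) = 0" by (simp_all add: sum_nonneg)
qed

lemma hermitian_ptrace_keep:
  assumes k: "k < length ds" and \<rho>: "\<rho> \<in> carrier_mat (prod_list ds) (prod_list ds)" "hermitian_mat \<rho>"
  shows "hermitian_mat (ptrace_keep ds k \<rho>)"
  unfolding hermitian_mat_def
proof (intro conjI eq_matI)
  fix a b assume "a < dim_row (ptrace_keep ds k \<rho>)" "b < dim_col (ptrace_keep ds k \<rho>)"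
  then have ab: "a < ds ! k" "b < ds ! k" by (auto simp: ptrace_keep_def)
  have w: "cnj (ptrace_weight k b a i u v) = ptrace_weight k a b i v u" for i u v
    by (auto simp: ptrace_weight_def)
  have "cnj (ptrace_keep ds k \<rho> $$ (b,a)) = (\<Sum>x<prod_list ds. \<Sum>y<prod_list ds.
     (\<Prod>i<length ds. ptrace_weight k a b i (mr_digits ds y ! i) (mr_digits ds x ! i)) * \<rho> $$ (y,x))"
    unfolding index_ptrace_keep[OF k ab(2,1)]
    using hermitian_index[OF \<rho>(2)] \<rho>(1) by (auto simp: w intro!: sum.cong)
  also have "\<dots> = ptrace_keep ds k \<rho> $$ (a,b)"
    unfolding index_ptrace_keep[OF k ab] by (rule sum.swap)
  finally show "adj (ptrace_keep ds k \<rho>) $$ (a,b) = ptrace_keep ds k \<rho> $$ (a,b)"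
    using ab by (simp add: carrier_matD[OF ptrace_keep_carrier])
qed (auto simp: ptrace_keep_def)

text \<open>After a local unitary that diagonalises the marginal, its eigenvalues are diagonal
  entries of a partial trace, hence sums of diagonal entries of a positive matrix.\<close>

lemma psd_ptrace_keep:
  assumes k: "k < length ds" and \<rho>: "psd_mat (prod_list ds) \<rho>"
  shows "psd_mat (ds ! k) (ptrace_keep ds k \<rho>)"
proof -
  note \<rho>c = psd_matD[OF \<rho>]
  obtain W l where s: "spec_decomp (ptrace_keep ds k \<rho>) W l"
    using hermitian_spec_decomp[OF hermitian_ptrace_keep[OF k \<rho>c] ptrace_keep_carrier] by blast
  note W = spec_decompD[OF s ptrace_keep_carrier]
  define V where "V i = (if i = k then adj W else 1\<^sub>m (ds ! i))" for i
  have V: "unitary_mat (ds ! i) (V i)" for i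
    using unitary_mat_adj[OF W(1)] by (simp add: V_def unitary_mat_one)
  let ?R = "tensor_upto (length ds) V * \<rho> * adj (tensor_upto (length ds) V)"
  have R: "psd_mat (prod_list ds) ?R"
    by (rule psd_conj[OF \<rho>]) (rule unitary_matD(1)[OF unitary_tensor_upto[OF V]])
  have e: "real_diag (ds ! k) l = ptrace_keep ds k ?R"
    unfolding ptrace_keep_local_unitary[OF V \<rho>c(1) k] W(4)[symmetric] by (simp add: V_def)
  have "0 \<le> l a" if a: "a < ds ! k" for a
  proof -
    have "complex_of_real (l a) = ptrace_keep ds k ?R $$ (a,a)" using e a by (metis index_real_diag)
    then have "l a = Re (\<Sum>x<prod_list ds. if mr_digits ds x ! k = a then ?R $$ (x,x) else 0)"
      unfolding ptrace_keep_diag[OF k a] by (metis Re_complex_of_real)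
    also have "\<dots> \<ge> 0"
      unfolding Re_sum using psd_diag_nonneg(1)[OF R] by (intro sum_nonneg) auto
    finally show ?thesis .
  qed
  then show ?thesis by (rule psd_mat_spec_decompI[OF ptrace_keep_carrier s])
qed

section \<open>Mutual information of states\<close>


text \<open>Klein's inequality. Termwise ln x \<le> x - 1 bounds the overlap form from below by the
  sum of \<open>k i j * (p i - q j)\<close>, which is a difference of equal traces because the
  overlaps are doubly stochastic.\<close>

theorem rel_ent_nonneg:
  assumes \<rho>: "psd_mat d \<rho>" and \<sigma>: "psd_mat d \<sigma>" and tr: "mtrace \<rho> = mtrace \<sigma>"
  shows "0 \<le> rel_ent \<rho> \<sigma>"
proof -
  note c = psd_matD(1)[OF \<rho>] psd_matD(1)[OF \<sigma>]
  obtain W p where W: "spec_decomp \<rho> W p" and p: "\<And>i. i < d \<Longrightarrow> 0 \<le> p i" using psd_spec_decomp[OF \<rho>] by blast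
  obtain Z q where Z: "spec_decomp \<sigma> Z q" and q: "\<And>i. i < d \<Longrightarrow> 0 \<le> q i" using psd_spec_decomp[OF \<sigma>] by blast
  define k where "k i j = (cmod ((adj W * Z) $$ (i,j)))^2" for i j
  have D: "rel_ent \<rho> \<sigma> = (if \<forall>i<d. \<forall>j<d. q j = 0 \<longrightarrow> k i j * p i = 0
     then ereal (\<Sum>i<d. \<Sum>j<d. k i j * p i * (ln0 (p i) - ln0 (q j))) else \<infinity>)"
    unfolding k_def by (rule rel_ent_overlap[OF \<rho> W p Z c(2)])
  have trp: "(\<Sum>i<d. p i) = (\<Sum>j<d. q j)"
    using tr unfolding mtrace_spec[OF W c(1)] mtrace_spec[OF Z c(2)] by (simp only: of_real_eq_iff)
  show ?thesis
  proof (cases "\<forall>i<d. \<forall>j<d. q j = 0 \<longrightarrow> k i j * p i = 0")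
    case True
    have "0 = (\<Sum>i<d. (\<Sum>j<d. k i j) * p i) - (\<Sum>j<d. (\<Sum>i<d. k i j) * q j)"
      unfolding k_def using trp
      by (simp add: overlap_sums[OF spec_decompD(1)[OF W c(1)] spec_decompD(1)[OF Z c(2)]] del: index_mult_mat)
    also have "\<dots> = (\<Sum>i<d. \<Sum>j<d. k i j * (p i - q j))"
      unfolding sum_distrib_right sum.swap[of "\<lambda>j i. k i j * q j"] sum_subtractf[symmetric]
      by (simp add: right_diff_distrib)
    also have "\<dots> \<le> (\<Sum>i<d. \<Sum>j<d. k i j * p i * (ln0 (p i) - ln0 (q j)))"
    proof (intro sum_mono)
      fix i j assume "i \<in> {..<d}" "j \<in> {..<d}"
      then have ij: "i < d" "j < d" by auto
      have k0: "0 \<le> k i j" by (simp add: k_def)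
      show "k i j * (p i - q j) \<le> k i j * p i * (ln0 (p i) - ln0 (q j))"
      proof (cases "k i j = 0 \<or> p i = 0")
        case True
        then show ?thesis using k0 q[OF ij(2)] by auto
      next
        case False
        then have "q j \<noteq> 0" using True ij by auto
        then have pos: "p i > 0" "q j > 0" using False p[OF ij(1)] q[OF ij(2)] by auto
        have "ln (q j / p i) \<le> q j / p i - 1" using pos by (intro ln_le_minus_one) simp
        then have "p i * (ln (q j) - ln (p i)) \<le> p i * (q j / p i - 1)"
          using pos by (intro mult_left_mono) (simp_all add: ln_div)
        then have "p i - q j \<le> p i * (ln (p i) - ln (q j))"
          using pos by (simp add: algebra_simps)
        then have "k i j * (p i - q j) \<le> k i j * (p i * (ln (p i) - ln (q j)))"
          by (rule mult_left_mono[OF _ k0])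
        then show ?thesis using pos by (simp add: ln0_def mult.assoc)
      qed
    qed
    finally show ?thesis unfolding D if_P[OF True] by simp
  next
    case False
    then show ?thesis unfolding D if_not_P[OF False] by simp
  qed
qed

lemma ptrace_keep_eigenbasis_diag:
  assumes W: "\<And>i. i < length ds \<Longrightarrow> unitary_mat (ds ! i) (W i)"
    and \<rho>: "\<rho> \<in> carrier_mat (prod_list ds) (prod_list ds)" and k: "k < length ds" and a: "a < ds ! k"
  shows "(adj (W k) * ptrace_keep ds k \<rho> * W k) $$ (a,a) = (\<Sum>x<prod_list ds. if mr_digits ds x ! k = a
     then (adj (tensor_upto (length ds) W) * \<rho> * tensor_upto (length ds) W) $$ (x,x) else 0)"
proof -
  have W': "unitary_mat (ds ! i) (adj (W i))" if "i < length ds" for i by (rule unitary_mat_adj[OF W[OF that]])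
  have Wc: "W i \<in> carrier_mat (ds ! i) (ds ! i)" if "i < length ds" for i by (rule unitary_matD(1)[OF W[OF that]])
  have t: "tensor_upto (length ds) (\<lambda>i. adj (W i)) = adj (tensor_upto (length ds) W)"
    by (rule tensor_upto_adj[OF Wc, symmetric])
  show ?thesis
    using ptrace_keep_local_unitary[OF W' \<rho> k] ptrace_keep_diag[OF k a] unfolding t adj_adj by metis
qed

text \<open>In a product eigenbasis the logarithm of a product turns into a sum over the factors, each of
  which sees only the corresponding marginal of the diagonal of \<open>\<rho>\<close>.\<close>
lemma rel_ent_tensor_upto:
  assumes \<rho>: "psd_mat (prod_list ds) \<rho>"
    and \<omega>: "\<And>i. i < length ds \<Longrightarrow> \<omega> i \<in> carrier_mat (ds ! i) (ds ! i)"
    and s: "\<And>i. i < length ds \<Longrightarrow> spec_decomp (\<omega> i) (W i) (q i)"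
    and q: "\<And>i a. i < length ds \<Longrightarrow> a < ds ! i \<Longrightarrow> 0 \<le> q i a"
  shows "rel_ent \<rho> (tensor_upto (length ds) \<omega>) =
    (if \<forall>i<length ds. \<forall>a<ds ! i. q i a = 0 \<longrightarrow> (adj (W i) * ptrace_keep ds i \<rho> * W i) $$ (a,a) = 0
     then ereal (Re (mtrace (\<rho> * mat_fun ln0 \<rho>)) - (\<Sum>i<length ds. Re (mtrace (ptrace_keep ds i \<rho> * mat_fun ln0 (\<omega> i)))))
     else \<infinity>)"
proof -
  let ?n = "length ds" and ?P = "prod_list ds" and ?d = "\<lambda>x i. mr_digits ds x ! i"
  define Q where "Q x = (\<Prod>i<?n. q i (?d x i))" for x
  define R where "R = adj (tensor_upto ?n W) * \<rho> * tensor_upto ?n W"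
  define r where "r i = adj (W i) * ptrace_keep ds i \<rho> * W i" for i
  note \<rho>c = psd_matD(1)[OF \<rho>]
  have W: "unitary_mat (ds ! i) (W i)" if "i < ?n" for i using spec_decompD(1)[OF s[OF that] \<omega>[OF that]] .
  have TWc: "tensor_upto ?n W \<in> carrier_mat ?P ?P" by (rule unitary_matD(1)[OF unitary_tensor_upto[OF W]])
  have R: "psd_mat ?P R" using psd_conj[OF \<rho> adj_carrier[OF TWc]] by (simp add: R_def)
  note R0 = psd_diag_nonneg[OF R]
  have Rz: "R $$ (x,x) = 0 \<longleftrightarrow> Re (R $$ (x,x)) = 0" if "x < ?P" for x
    using R0(2)[OF that] by (simp add: complex_eq_iff)
  have marg: "r i $$ (a,a) = (\<Sum>x<?P. if ?d x i = a then R $$ (x,x) else 0)" if "i < ?n" "a < ds ! i" for i a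
    unfolding r_def R_def by (rule ptrace_keep_eigenbasis_diag[OF W \<rho>c that])
  \<comment> \<open>An eigenvalue of the product is 0 iff one of its factors is, and a diagonal
    entry of a marginal, being a sum of nonnegative numbers, is 0 iff all of them are. This matches
    the support condition of the product with those of the factors.\<close>
  have cond: "(\<forall>x<?P. Q x = 0 \<longrightarrow> R $$ (x,x) = 0) \<longleftrightarrow> (\<forall>i<?n. \<forall>a<ds ! i. q i a = 0 \<longrightarrow> r i $$ (a,a) = 0)"
  proof (intro iffI allI impI)
    fix i a assume *: "\<forall>x<?P. Q x = 0 \<longrightarrow> R $$ (x,x) = 0" "i < ?n" "a < ds ! i" "q i a = 0"
    have "Q x = 0" if "?d x i = a" for x
      using * that unfolding Q_def by (auto intro!: prod_zero bexI[of _ i])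
    then show "r i $$ (a,a) = 0" unfolding marg[OF *(2,3)] using *(1) by (intro sum.neutral) auto
  next
    fix x assume *: "\<forall>i<?n. \<forall>a<ds ! i. q i a = 0 \<longrightarrow> r i $$ (a,a) = 0" "x < ?P" "Q x = 0"
    then obtain i where i: "i < ?n" "q i (?d x i) = 0" unfolding Q_def by auto
    have a: "?d x i < ds ! i" by (rule mr_digits_less[OF *(2) i(1)])
    have "(\<Sum>y<?P. if ?d y i = ?d x i then R $$ (y,y) else 0) = 0" using marg[OF i(1) a] * i a by simp
    then have "Re (\<Sum>y<?P. if ?d y i = ?d x i then R $$ (y,y) else 0) = 0" by simp
    then have "(\<Sum>y<?P. if ?d y i = ?d x i then Re (R $$ (y,y)) else 0) = 0" by (simp add: if_distrib cong: if_cong)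
    then have "\<forall>y\<in>{..<?P}. (if ?d y i = ?d x i then Re (R $$ (y,y)) else 0) = 0"
      by (subst (asm) sum_nonneg_eq_0_iff) (auto simp: R0)
    then have "Re (R $$ (x,x)) = 0" using *(2) by (metis lessThan_iff)
    then show "R $$ (x,x) = 0" using Rz *(2) by auto
  qed
  have val: "(\<Sum>x<?P. ln0 (Q x) * Re (R $$ (x,x))) = (\<Sum>i<?n. Re (mtrace (ptrace_keep ds i \<rho> * mat_fun ln0 (\<omega> i))))"
    if c: "\<forall>x<?P. Q x = 0 \<longrightarrow> R $$ (x,x) = 0"
  proof -
    have "(\<Sum>x<?P. ln0 (Q x) * Re (R $$ (x,x))) = (\<Sum>x<?P. \<Sum>i<?n. ln0 (q i (?d x i)) * Re (R $$ (x,x)))"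
    proof (rule sum.cong[OF refl])
      fix x assume "x \<in> {..<?P}"
      then have x: "x < ?P" by simp
      show "ln0 (Q x) * Re (R $$ (x,x)) = (\<Sum>i<?n. ln0 (q i (?d x i)) * Re (R $$ (x,x)))"
      proof (cases "Q x = 0")
        case True
        then show ?thesis using c x by simp
      next
        case False
        then have qp: "q i (?d x i) > 0" if "i < ?n" for i
          using that q[OF that mr_digits_less[OF x that]] unfolding Q_def by (auto simp: less_le)
        then have "ln (Q x) = (\<Sum>i<?n. ln (q i (?d x i)))" "Q x > 0"
          unfolding Q_def by (auto intro!: ln_prod prod_pos simp: less_imp_neq[THEN not_sym])
        then show ?thesis using qp by (simp add: ln0_def sum_distrib_right)
      qed
    qed
    also have "\<dots> = (\<Sum>i<?n. \<Sum>x<?P. ln0 (q i (?d x i)) * Re (R $$ (x,x)))" by (rule sum.swap)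
    also have "\<dots> = (\<Sum>i<?n. Re (mtrace (ptrace_keep ds i \<rho> * mat_fun ln0 (\<omega> i))))"
    proof (rule sum.cong[OF refl])
      fix i assume "i \<in> {..<?n}"
      then have i: "i < ?n" by simp
      have "Re (mtrace (ptrace_keep ds i \<rho> * mat_fun ln0 (\<omega> i))) = (\<Sum>a<ds ! i. ln0 (q i a) * Re (r i $$ (a,a)))"
        unfolding mtrace_mult_spec[OF ptrace_keep_carrier s[OF i] \<omega>[OF i]] r_def by (simp del: index_mult_mat)
      also have "\<dots> = (\<Sum>a<ds ! i. \<Sum>x<?P. if ?d x i = a then ln0 (q i (?d x i)) * Re (R $$ (x,x)) else 0)"
        using marg[OF i] by (auto simp: sum_distrib_left intro!: sum.cong)
      also have "\<dots> = (\<Sum>x<?P. ln0 (q i (?d x i)) * Re (R $$ (x,x)))"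
        by (subst sum.swap) (use mr_digits_less[OF _ i] in \<open>auto intro!: sum.cong\<close>)
      finally show "(\<Sum>x<?P. ln0 (q i (?d x i)) * Re (R $$ (x,x))) = Re (mtrace (ptrace_keep ds i \<rho> * mat_fun ln0 (\<omega> i)))" by simp
    qed
    finally show ?thesis .
  qed
  have sd: "spec_decomp (tensor_upto ?n \<omega>) (tensor_upto ?n W) Q"
    using spec_decomp_tensor_upto[OF \<omega> s] unfolding Q_def by simp
  have T\<omega>: "tensor_upto ?n \<omega> \<in> carrier_mat ?P ?P" by (rule tensor_upto_carrier(1)[OF \<omega> refl])
  show ?thesis
    unfolding rel_ent_spec[OF \<rho> sd T\<omega>] R_def[symmetric] r_def[symmetric] cond[symmetric]
    using val by auto
qed

text \<open>In its own eigenbasis a marginal has its eigenvalues as diagonal entries, so the support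
  condition holds and the mutual information is always finite.\<close>

lemma rel_ent_tensor_ptrace:
  assumes \<rho>: "psd_mat (prod_list ds) \<rho>"
  shows "rel_ent \<rho> (tensor_upto (length ds) (\<lambda>i. ptrace_keep ds i \<rho>)) =
     ereal (Re (mtrace (\<rho> * mat_fun ln0 \<rho>)) - (\<Sum>i<length ds. Re (mtrace (ptrace_keep ds i \<rho> * mat_fun ln0 (ptrace_keep ds i \<rho>)))))"
proof -
  have "\<exists>W q. spec_decomp (ptrace_keep ds i \<rho>) W q \<and> (\<forall>a<ds ! i. 0 \<le> q a)" if "i < length ds" for i
    using psd_spec_decomp[OF psd_ptrace_keep[OF that \<rho>]] by blast
  then obtain W q where s: "\<And>i. i < length ds \<Longrightarrow> spec_decomp (ptrace_keep ds i \<rho>) (W i) (q i)"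
    and q: "\<And>i a. i < length ds \<Longrightarrow> a < ds ! i \<Longrightarrow> 0 \<le> q i a" by metis
  have "\<forall>i<length ds. \<forall>a<ds ! i. q i a = 0 \<longrightarrow> (adj (W i) * ptrace_keep ds i \<rho> * W i) $$ (a,a) = 0"
    using spec_decompD(4)[OF s ptrace_keep_carrier] by (simp del: index_mult_mat)
  then show ?thesis
    using rel_ent_tensor_upto[OF \<rho> ptrace_keep_carrier s q] by simp
qed

theorem rel_ent_marginals_le:
  assumes \<rho>: "psd_mat (prod_list ds) \<rho>"
    and \<omega>: "\<And>i. i < length ds \<Longrightarrow> psd_mat (ds ! i) (\<omega> i)"
    and tr: "\<And>i. i < length ds \<Longrightarrow> mtrace (\<omega> i) = mtrace \<rho>"
  shows "rel_ent \<rho> (tensor_upto (length ds) (\<lambda>i. ptrace_keep ds i \<rho>)) \<le> rel_ent \<rho> (tensor_upto (length ds) \<omega>)"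
proof -
  have \<omega>c: "\<omega> i \<in> carrier_mat (ds ! i) (ds ! i)" if "i < length ds" for i using psd_matD(1)[OF \<omega>[OF that]] .
  have "\<exists>W q. spec_decomp (\<omega> i) W q \<and> (\<forall>a<ds ! i. 0 \<le> q a)" if "i < length ds" for i
    using psd_spec_decomp[OF \<omega>[OF that]] by blast
  then obtain W q where s: "\<And>i. i < length ds \<Longrightarrow> spec_decomp (\<omega> i) (W i) (q i)"
    and q: "\<And>i a. i < length ds \<Longrightarrow> a < ds ! i \<Longrightarrow> 0 \<le> q i a" by metis
  let ?c = "\<forall>i<length ds. \<forall>a<ds ! i. q i a = 0 \<longrightarrow> (adj (W i) * ptrace_keep ds i \<rho> * W i) $$ (a,a) = 0"
  have D: "rel_ent \<rho> (tensor_upto (length ds) \<omega>) =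
    (if ?c then ereal (Re (mtrace (\<rho> * mat_fun ln0 \<rho>)) - (\<Sum>i<length ds. Re (mtrace (ptrace_keep ds i \<rho> * mat_fun ln0 (\<omega> i)))))
     else \<infinity>)" by (rule rel_ent_tensor_upto[OF \<rho> \<omega>c s q])
  show ?thesis
  proof (cases ?c)
    case True
    have "Re (mtrace (ptrace_keep ds i \<rho> * mat_fun ln0 (\<omega> i))) \<le> Re (mtrace (ptrace_keep ds i \<rho> * mat_fun ln0 (ptrace_keep ds i \<rho>)))"
      if i: "i < length ds" for i
    proof -
      note p = psd_ptrace_keep[OF i \<rho>]
      \<comment> \<open>The support condition of the product restricts to each factor, so every
        relative entropy of a marginal to \<omega> is a finite number and Klein's inequality becomes
        one between real traces.\<close>
      have c: "\<forall>a<ds ! i. q i a = 0 \<longrightarrow> (adj (W i) * ptrace_keep ds i \<rho> * W i) $$ (a,a) = 0" using True i by blast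
      have "0 \<le> rel_ent (ptrace_keep ds i \<rho>) (\<omega> i)"
        by (rule rel_ent_nonneg[OF p \<omega>[OF i]]) (simp add: tr[OF i] mtrace_ptrace_keep[OF i psd_matD(1)[OF \<rho>]])
      also have "rel_ent (ptrace_keep ds i \<rho>) (\<omega> i) = ereal (Re (mtrace (ptrace_keep ds i \<rho> * mat_fun ln0 (ptrace_keep ds i \<rho>)))
          - Re (mtrace (ptrace_keep ds i \<rho> * mat_fun ln0 (\<omega> i))))"
        unfolding rel_ent_spec[OF p s[OF i] \<omega>c[OF i]] if_P[OF c]
        by (simp add: mtrace_mult_spec[OF ptrace_keep_carrier s[OF i] \<omega>c[OF i]] del: index_mult_mat)
      finally show ?thesis by simp
    qed
    then have "(\<Sum>i<length ds. Re (mtrace (ptrace_keep ds i \<rho> * mat_fun ln0 (\<omega> i)))) \<le> (\<Sum>i<length ds. Re (mtrace (ptrace_keep ds i \<rho> * mat_fun ln0 (ptrace_keep ds i \<rho>))))"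
      by (intro sum_mono) auto
    then show ?thesis unfolding D if_P[OF True] rel_ent_tensor_ptrace[OF \<rho>] by simp
  next
    case False
    then show ?thesis unfolding D if_not_P[OF False] by simp
  qed
qed

section \<open>Entropies of marginals and of pure states\<close>

lemma state_mi_eq_entropies:
  assumes "psd_mat (prod_list ds) \<rho>"
  shows "state_mi ds \<rho> = ereal ((\<Sum>i<length ds. vn_entropy (ptrace_keep ds i \<rho>)) - vn_entropy \<rho>)"
  unfolding state_mi_def rel_ent_tensor_ptrace[OF assms] vn_entropy_def by (simp add: sum_negf)

lemma vn_entropy_spec:
  assumes "spec_decomp \<rho> W p" "\<rho> \<in> carrier_mat d d"
  shows "vn_entropy \<rho> = - (\<Sum>i<d. ln0 (p i) * p i)"
  unfolding vn_entropy_def trace_fun_spec[OF assms] by simp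

text \<open>The eigenvalues are 0 and 1, and \<open>ln0 x * x\<close> vanishes at both.\<close>

lemma vn_entropy_idempotent:
  assumes "hermitian_mat \<rho>" "\<rho> \<in> carrier_mat d d" "\<rho> * \<rho> = \<rho>"
  shows "vn_entropy \<rho> = 0"
proof -
  obtain W p where s: "spec_decomp \<rho> W p" using hermitian_spec_decomp[OF assms(1,2)] by blast
  note W = spec_decompD[OF s assms(2)]
  have "real_diag d p * real_diag d p = adj W * \<rho> * (W * adj W) * \<rho> * W"
    unfolding W(4)[symmetric] using W(2) assms(2) by (auto dest!: carrier_dims simp: mat_algebra)
  also have "\<dots> = adj W * (\<rho> * \<rho>) * W"
    using W(2) assms(2) unitary_matD(3)[OF W(1)] by (auto dest!: carrier_dims simp: mat_algebra)
  finally have e: "real_diag d p * real_diag d p = real_diag d p" unfolding assms(3) W(4) .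
  have "ln0 (p i) * p i = 0" if i: "i < d" for i
  proof -
    have "(real_diag d p * real_diag d p) $$ (i,i) = complex_of_real (p i * p i)"
      using i by (subst index_mult_sum[of _ d d _ d]) (auto simp: if_distrib if_distribR cong: if_cong)
    then have "complex_of_real (p i * p i) = complex_of_real (p i)" using e i by simp
    then have "p i * p i = p i" by (simp only: of_real_eq_iff)
    then have "p i = 0 \<or> p i = 1" by auto
    then show ?thesis by (auto simp: ln0_def)
  qed
  then have "(\<Sum>i<d. ln0 (p i) * p i) = 0" by (intro sum.neutral) auto
  then show ?thesis unfolding vn_entropy_spec[OF s assms(2)] by simp
qed

text \<open>Both Gram matrices are diagonalised by the singular vectors of \<open>M\<close>: in these bases \<open>M\<close> has
  an entry only where the two eigenvalues agree.\<close>
lemma vn_entropy_gram_swap: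
  assumes M: "M \<in> carrier_mat a b"
  shows "vn_entropy (M * adj M) = vn_entropy (adj M * M)"
proof -
  have c: "M * adj M \<in> carrier_mat a a" "adj M * M \<in> carrier_mat b b" using M by (auto intro: mult_carrier_mat)
  have "hermitian_mat (M * adj M)" "hermitian_mat (adj M * M)"
    using M by (auto simp: hermitian_mat_def mat_algebra)
  then obtain W p Z q where W: "spec_decomp (M * adj M) W p" and Z: "spec_decomp (adj M * M) Z q"
    using hermitian_spec_decomp c by blast
  note w = spec_decompD[OF W c(1)] and z = spec_decompD[OF Z c(2)]
  define N where "N = adj W * M * Z"
  have N: "N \<in> carrier_mat a b" unfolding N_def using w(2) z(2) M by (auto dest!: carrier_dims intro!: carrier_matI)
  have "N * adj N = adj W * M * (Z * adj Z) * adj M * W"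
    unfolding N_def using w(2) z(2) M by (auto dest!: carrier_dims simp: mat_algebra)
  also have "\<dots> = adj W * (M * adj M) * W"
    using unitary_matD(3)[OF z(1)] w(2) z(2) M by (auto dest!: carrier_dims simp: mat_algebra)
  finally have p: "N * adj N = real_diag a p" using w(4) by simp
  have "adj N * N = adj Z * adj M * (W * adj W) * M * Z"
    unfolding N_def using w(2) z(2) M by (auto dest!: carrier_dims simp: mat_algebra)
  also have "\<dots> = adj Z * (adj M * M) * Z"
    using unitary_matD(3)[OF w(1)] w(2) z(2) M by (auto dest!: carrier_dims simp: mat_algebra)
  finally have q: "adj N * N = real_diag b q" using z(4) by simp
  have sq: "z * cnj z = complex_of_real ((cmod z)^2)" "cnj z * z = complex_of_real ((cmod z)^2)" for z
    by (simp_all only: complex_norm_square mult.commute)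
  have pi: "p i = (\<Sum>j<b. (cmod (N $$ (i,j)))^2)" if i: "i < a" for i
  proof -
    have "complex_of_real (p i) = (N * adj N) $$ (i,i)" using p i by simp
    also have "\<dots> = complex_of_real (\<Sum>j<b. (cmod (N $$ (i,j)))^2)"
      using i N by (subst index_mult_sum[of _ a b _ a]) (auto simp: sq)
    finally show ?thesis by (simp only: of_real_eq_iff)
  qed
  have qj: "q j = (\<Sum>i<a. (cmod (N $$ (i,j)))^2)" if j: "j < b" for j
  proof -
    have "complex_of_real (q j) = (adj N * N) $$ (j,j)" using q j by simp
    also have "\<dots> = complex_of_real (\<Sum>i<a. (cmod (N $$ (i,j)))^2)"
      using j N by (subst index_mult_sum[of _ b a _ b]) (auto simp: sq)
    finally show ?thesis by (simp only: of_real_eq_iff)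
  qed
  \<comment> \<open>The two ways of bracketing this product show that \<open>N\<close> intertwines
    the two diagonal matrices of eigenvalues.\<close>
  have "N * adj N * N = N * (adj N * N)" using N by (auto dest!: carrier_dims simp: mat_algebra)
  then have comm: "real_diag a p * N = N * real_diag b q" unfolding p q .
  have agree: "N $$ (i,j) = 0 \<or> p i = q j" if "i < a" "j < b" for i j
  proof -
    have "(real_diag a p * N) $$ (i,j) = complex_of_real (p i) * N $$ (i,j)"
      using that N by (subst index_mult_sum[of _ a a _ b]) (auto simp: if_distrib if_distribR cong: if_cong)
    moreover have "(N * real_diag b q) $$ (i,j) = complex_of_real (q j) * N $$ (i,j)"
      using that N by (subst index_mult_sum[of _ a b _ b]) (auto simp: if_distrib if_distribR mult.commute cong: if_cong)
    ultimately show ?thesis using comm by auto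
  qed
  have "(\<Sum>i<a. ln0 (p i) * p i) = (\<Sum>i<a. \<Sum>j<b. ln0 (p i) * (cmod (N $$ (i,j)))^2)"
    by (simp only: sum_distrib_left[symmetric]) (simp add: pi[symmetric])
  also have "\<dots> = (\<Sum>i<a. \<Sum>j<b. ln0 (q j) * (cmod (N $$ (i,j)))^2)"
    by (intro sum.cong refl) (use agree in force)
  also have "\<dots> = (\<Sum>j<b. ln0 (q j) * q j)"
    by (subst sum.swap) (simp only: sum_distrib_left[symmetric], simp add: qj[symmetric])
  finally show ?thesis unfolding vn_entropy_spec[OF W c(1)] vn_entropy_spec[OF Z c(2)] by simp
qed

text \<open>Conjugating the eigenvectors leaves the real eigenvalues unchanged. The second marginal
  of a pure state is the complex conjugate of a Gram matrix, which is where this enters.\<close>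

lemma vn_entropy_conjugate:
  assumes h: "hermitian_mat A" and A: "A \<in> carrier_mat d d"
  shows "vn_entropy (map_mat cnj A) = vn_entropy A"
proof -
  obtain W p where s: "spec_decomp A W p" using hermitian_spec_decomp[OF h A] by blast
  note W = spec_decompD[OF s A]
  have mult: "map_mat cnj (X * Y) = map_mat cnj X * map_mat cnj Y" if "X \<in> carrier_mat d d" "Y \<in> carrier_mat d d" for X Y
  proof (rule eq_matI)
    fix i j assume "i < dim_row (map_mat cnj X * map_mat cnj Y)" "j < dim_col (map_mat cnj X * map_mat cnj Y)"
    then have ij: "i < d" "j < d" using that by auto
    have c: "map_mat cnj X \<in> carrier_mat d d" "map_mat cnj Y \<in> carrier_mat d d" using that by auto
    have "map_mat cnj (X * Y) $$ (i,j) = cnj ((X * Y) $$ (i,j))" using ij that by simp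
    then show "map_mat cnj (X * Y) $$ (i,j) = (map_mat cnj X * map_mat cnj Y) $$ (i,j)"
      unfolding index_mult_sum[OF that ij] index_mult_sum[OF c ij] using that ij by (simp add: carrier_matD[OF that(1)] carrier_matD[OF that(2)])
  qed (use that in auto)
  have ad: "adj (map_mat cnj W) = map_mat cnj (adj W)" by (rule eq_matI) auto
  have c: "map_mat cnj W \<in> carrier_mat d d" "map_mat cnj A \<in> carrier_mat d d" using W(2) A by auto
  have "adj (map_mat cnj W) * map_mat cnj W = map_mat cnj (adj W * W)"
    unfolding ad using W(2) by (simp add: mult)
  also have "\<dots> = 1\<^sub>m d" unfolding unitary_matD(2)[OF W(1)] by (rule eq_matI) auto
  finally have u: "unitary_mat d (map_mat cnj W)" by (rule unitary_matI[OF c(1)])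
  have "adj (map_mat cnj W) * map_mat cnj A * map_mat cnj W = map_mat cnj (adj W * A * W)"
    unfolding ad using W(2) A mult_carrier_mat[OF adj_carrier[OF W(2)] A] by (simp add: mult)
  also have "\<dots> = real_diag d p" unfolding W(4) by (rule eq_matI) auto
  finally have "spec_decomp (map_mat cnj A) (map_mat cnj W) p" by (rule spec_decompI[OF c(2) u])
  from vn_entropy_spec[OF this c(2)] vn_entropy_spec[OF s A] show ?thesis by simp
qed

text \<open>The vector \<psi> is read as an a by b matrix \<open>M\<close>. The marginals are
  \<open>M * adj M\<close> and the conjugate of \<open>adj M * M\<close>, which have the same
  entropy, while the entropy of the projection itself is 0.\<close>

lemma state_mi_pure_bipartite:
  assumes \<psi>: "(\<Sum>x<a * b. \<psi> x * cnj (\<psi> x)) = 1"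
  defines "\<rho> \<equiv> mat (a * b) (a * b) (\<lambda>(x,y). \<psi> x * cnj (\<psi> y))"
  shows "state_mi [a, b] \<rho> = ereal (2 * vn_entropy (ptrace_keep [a, b] 0 \<rho>))"
    and "vn_entropy (ptrace_keep [a, b] 0 \<rho>) = vn_entropy (ptrace_keep [a, b] 1 \<rho>)"
proof -
  have \<rho>: "\<rho> \<in> carrier_mat (a * b) (a * b)" by (simp add: \<rho>_def)
  have psd: "psd_mat (a * b) \<rho>"
    by (rule psd_mat_gramI[OF \<rho>, where S = "{()}" and u = "\<lambda>_. \<psi>"]) (simp add: \<rho>_def)
  have "\<rho> * \<rho> = \<rho>"
  proof (rule eq_matI)
    fix i j assume "i < dim_row \<rho>" "j < dim_col \<rho>"
    then have ij: "i < a * b" "j < a * b" using \<rho> by auto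
    have "(\<rho> * \<rho>) $$ (i,j) = (\<Sum>k<a * b. \<psi> i * cnj (\<psi> j) * (\<psi> k * cnj (\<psi> k)))"
      using ij by (subst index_mult_sum[OF \<rho> \<rho>]) (auto simp: \<rho>_def mult_ac)
    also have "\<dots> = \<rho> $$ (i,j)" unfolding sum_distrib_left[symmetric] \<psi> using ij by (simp add: \<rho>_def)
    finally show "(\<rho> * \<rho>) $$ (i,j) = \<rho> $$ (i,j)" .
  qed (use \<rho> in auto)
  then have S: "vn_entropy \<rho> = 0" by (rule vn_entropy_idempotent[OF psd_matD(2,1)[OF psd]])
  define M where "M = mat a b (\<lambda>(i,k). \<psi> (i * b + k))"
  have M: "M \<in> carrier_mat a b" by (simp add: M_def)
  have sum2: "(\<Sum>x<a * b. \<Sum>y<a * b. F x y) = (\<Sum>i<a. \<Sum>k<b. \<Sum>i'<a. \<Sum>k'<b. F (i * b + k) (i' * b + k'))" for F :: "nat \<Rightarrow> nat \<Rightarrow> complex"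
    by (simp only: sum_split_mult)
  have p0: "ptrace_keep [a, b] 0 \<rho> = M * adj M"
  proof (rule eq_matI)
    fix u v assume "u < dim_row (M * adj M)" "v < dim_col (M * adj M)"
    then have uv: "u < a" "v < a" using M by auto
    \<comment> \<open>The joint indicator is split into nested conditions on single variables, in
      the order in which the sums collapse.\<close>
    have "ptrace_keep [a, b] 0 \<rho> $$ (u,v) = (\<Sum>i<a. \<Sum>k<b. \<Sum>i'<a. \<Sum>k'<b. if k' = k then (if i' = v then (if i = u then \<rho> $$ (i * b + k, i' * b + k') else 0) else 0) else 0)"
      using uv by (simp add: index_ptrace_keep sum2 ptrace_weight_def del: sum.delta sum.delta') (intro sum.cong refl, auto simp: ptrace_weight_def)
    also have "\<dots> = (\<Sum>k<b. \<rho> $$ (u * b + k, v * b + k))" using uv by (subst sum.swap) simp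
    also have "\<dots> = (M * adj M) $$ (u,v)"
      using uv mult_add_less M by (subst index_mult_sum[OF M adj_carrier[OF M]]) (auto simp: M_def \<rho>_def)
    finally show "ptrace_keep [a, b] 0 \<rho> $$ (u,v) = (M * adj M) $$ (u,v)" .
  qed (use M in \<open>auto simp: ptrace_keep_def\<close>)
  have p1: "ptrace_keep [a, b] 1 \<rho> = map_mat cnj (adj M * M)"
  proof (rule eq_matI)
    fix u v assume "u < dim_row (map_mat cnj (adj M * M))" "v < dim_col (map_mat cnj (adj M * M))"
    then have uv: "u < b" "v < b" using M by auto
    have "ptrace_keep [a, b] 1 \<rho> $$ (u,v) = (\<Sum>i<a. \<Sum>k<b. \<Sum>i'<a. \<Sum>k'<b. if k' = v then (if i' = i then (if k = u then \<rho> $$ (i * b + k, i' * b + k') else 0) else 0) else 0)"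
      using uv by (simp add: index_ptrace_keep sum2 ptrace_weight_def del: sum.delta sum.delta') (intro sum.cong refl, auto simp: ptrace_weight_def)
    also have "\<dots> = (\<Sum>i<a. \<rho> $$ (i * b + u, i * b + v))" using uv by simp
    also have "\<dots> = cnj ((adj M * M) $$ (u,v))"
      using uv mult_add_less M by (subst index_mult_sum[OF adj_carrier[OF M] M]) (auto simp: M_def \<rho>_def mult.commute)
    finally show "ptrace_keep [a, b] 1 \<rho> $$ (u,v) = map_mat cnj (adj M * M) $$ (u,v)" using uv M by simp
  qed (use M in \<open>auto simp: ptrace_keep_def\<close>)
  have h: "hermitian_mat (adj M * M)" "adj M * M \<in> carrier_mat b b"
    using M by (auto simp: hermitian_mat_def mat_algebra intro: mult_carrier_mat)
  show eq: "vn_entropy (ptrace_keep [a, b] 0 \<rho>) = vn_entropy (ptrace_keep [a, b] 1 \<rho>)"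
    unfolding p0 p1 vn_entropy_conjugate[OF h] by (rule vn_entropy_gram_swap[OF M])
  show "state_mi [a, b] \<rho> = ereal (2 * vn_entropy (ptrace_keep [a, b] 0 \<rho>))"
    using state_mi_eq_entropies[of "[a, b]" \<rho>] psd S eq by simp
qed

section \<open>Reordering of tensor factors\<close>


text \<open>Inverse of the digit map: existence is \<open>mr_digits_surj\<close>, uniqueness is
  \<open>mr_digits_inj\<close>.\<close>

definition mr_encode :: "nat list \<Rightarrow> (nat \<Rightarrow> nat) \<Rightarrow> nat" where
  "mr_encode ds g = (SOME x. x < prod_list ds \<and> (\<forall>i<length ds. mr_digits ds x ! i = g i))"

lemma mr_encode:
  assumes "\<And>i. i < length ds \<Longrightarrow> g i < ds ! i"
  shows "mr_encode ds g < prod_list ds" "i < length ds \<Longrightarrow> mr_digits ds (mr_encode ds g) ! i = g i"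
proof -
  have "\<exists>x. x < prod_list ds \<and> (\<forall>i<length ds. mr_digits ds x ! i = g i)" using mr_digits_surj[OF assms] by blast
  from someI_ex[OF this] show "mr_encode ds g < prod_list ds" "i < length ds \<Longrightarrow> mr_digits ds (mr_encode ds g) ! i = g i"
    unfolding mr_encode_def by auto
qed

lemma mr_digits_append:
  "j < prod_list xs * prod_list ys \<Longrightarrow> mr_digits (xs @ ys) j = mr_digits xs (j div prod_list ys) @ mr_digits ys (j mod prod_list ys)"
proof (induction xs arbitrary: j)
  case (Cons x xs)
  let ?p = "prod_list xs" and ?e = "prod_list ys"
  have "j div (?p * ?e) = j div ?e div ?p" by (metis div_mult2_eq mult.commute)
  moreover have "j mod (?p * ?e) div ?e = j div ?e mod ?p"
  proof (cases "?e = 0")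
    case False
    have "j mod (?e * ?p) = ?e * (j div ?e mod ?p) + j mod ?e" by (rule mod_mult2_eq)
    then show ?thesis using False by (simp add: mult.commute)
  next
    case True
    then show ?thesis unfolding True by simp
  qed
  moreover have "j mod (?p * ?e) mod ?e = j mod ?e" by (simp add: mod_mod_cancel)
  moreover have "?p * ?e > 0" by (rule ccontr) (use Cons.prems in \<open>auto simp del: prod_list_zero_iff\<close>)
  then have "j mod (?p * ?e) < ?p * ?e" by simp
  ultimately show ?case by (simp add: Cons.IH)
qed simp

abbreviation interleave :: "nat list \<Rightarrow> nat list \<Rightarrow> nat list" where
  "interleave xs ys \<equiv> concat (map2 (\<lambda>a b. [a, b]) xs ys)"

lemma interleave_nth:
  assumes "length xs = length ys"
  shows "length (interleave xs ys) = 2 * length xs"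
    and "prod_list (interleave xs ys) = prod_list (map2 (*) xs ys)"
    and "p < length xs \<Longrightarrow> interleave xs ys ! (2 * p) = xs ! p"
    and "p < length xs \<Longrightarrow> interleave xs ys ! Suc (2 * p) = ys ! p"
proof -
  show "length (interleave xs ys) = 2 * length xs" "prod_list (interleave xs ys) = prod_list (map2 (*) xs ys)"
    using assms by (induction xs ys rule: list_induct2) (auto simp: mult.assoc)
  show "p < length xs \<Longrightarrow> interleave xs ys ! (2 * p) = xs ! p" "p < length xs \<Longrightarrow> interleave xs ys ! Suc (2 * p) = ys ! p"
    using assms by (induction xs ys arbitrary: p rule: list_induct2) (auto simp: nth_Cons split: nat.splits)
qed

text \<open>Splitting a digit to base x * y into quotient and remainder modulo y refines the radix
  list without changing the number encoded. Hence fusing the adjacent factors R_i and X_i into one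
  leaves all indices as they are, and only the permutation of factors has to be tracked.\<close>

lemma mr_digits_interleave:
  assumes "length xs = length ys" "p < length xs"
  shows "mr_digits (interleave xs ys) j ! (2 * p) = mr_digits (map2 (*) xs ys) j ! p div ys ! p \<and>
     mr_digits (interleave xs ys) j ! Suc (2 * p) = mr_digits (map2 (*) xs ys) j ! p mod ys ! p"
  using assms
proof (induction xs ys arbitrary: p j rule: list_induct2)
  case (Cons x xs y ys)
  let ?P = "prod_list (map2 (*) xs ys)"
  have e: "prod_list (interleave xs ys) = ?P" by (rule interleave_nth(2)[OF Cons.hyps])
  have 1: "j div (y * ?P) = j div ?P div y" by (metis div_mult2_eq mult.commute)
  have 2: "j mod (y * ?P) div ?P = j div ?P mod y"
  proof (cases "?P = 0")
    case False
    have "j mod (?P * y) = ?P * (j div ?P mod y) + j mod ?P" by (rule mod_mult2_eq)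
    then show ?thesis using False by (simp add: mult.commute)
  next
    case True
    then show ?thesis unfolding True by simp
  qed
  have 3: "j mod (y * ?P) mod ?P = j mod ?P" by (simp add: mod_mod_cancel)
  show ?case
  proof (cases p)
    case 0
    then show ?thesis using 1 2 e by simp
  next
    case (Suc p')
    then have "p' < length xs" using Cons.prems by simp
    from Cons.IH[OF this, of "j mod ?P"] show ?thesis using Suc 3 e by simp
  qed
qed simp

lemma prod_list_nth: "prod_list (xs :: nat list) = (\<Prod>i<length xs. xs ! i)"
  by (simp add: prod.list_conv_set_nth atLeast0LessThan)

text \<open>An index \<open>j\<close> of the grouped system has digits \<open>r\<^sub>i * dO\<^sub>i + a\<^sub>i\<close>; \<open>ref_index\<close> and \<open>out_index\<close>
  collect the \<open>r\<^sub>i\<close> and the \<open>a\<^sub>i\<close>.\<close>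
locale grouping =
  fixes dI dO :: "nat list"
  assumes len: "length dO = length dI" and pos: "\<And>i. i < length dI \<Longrightarrow> 0 < dI ! i" "\<And>i. i < length dI \<Longrightarrow> 0 < dO ! i"
begin

abbreviation "n \<equiv> length dI"
abbreviation "D \<equiv> prod_list dI"
abbreviation "E \<equiv> prod_list dO"
abbreviation "gd \<equiv> grouped_dims dI dO"
abbreviation "P \<equiv> prod_list gd"

definition ref_index :: "nat \<Rightarrow> nat" where
  "ref_index j = mr_encode dI (\<lambda>i. mr_digits gd j ! i div dO ! i)"

definition out_index :: "nat \<Rightarrow> nat" where
  "out_index j = mr_encode dO (\<lambda>i. mr_digits gd j ! i mod dO ! i)"

definition join_index :: "nat \<Rightarrow> nat \<Rightarrow> nat" where
  "join_index r a = mr_encode gd (\<lambda>i. mr_digits dI r ! i * dO ! i + mr_digits dO a ! i)"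

lemma length_gd [simp]: "length gd = n" by (simp add: grouped_dims_def)

lemma gd_nth: "i < n \<Longrightarrow> gd ! i = dI ! i * dO ! i" by (simp add: grouped_dims_def)

lemma gd_map2: "map2 (*) dI dO = gd"
  by (rule nth_equalityI) (auto simp: len gd_nth)

lemma D_pos: "0 < D" unfolding prod_list_nth using pos by (intro prod_pos) auto

lemma E_pos: "0 < E" unfolding prod_list_nth using pos len by (intro prod_pos) auto

lemma P_eq: "P = D * E"
  unfolding prod_list_nth[of dI] prod_list_nth[of dO] prod_list_nth[of gd] len
  by (simp add: gd_nth prod.distrib)

lemma ref_index:
  assumes "j < P"
  shows "ref_index j < D" "i < n \<Longrightarrow> mr_digits dI (ref_index j) ! i = mr_digits gd j ! i div dO ! i"
proof -
  have *: "mr_digits gd j ! i div dO ! i < dI ! i" if "i < n" for i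
    using mr_digits_less[OF assms, of i] that by (simp add: gd_nth less_mult_imp_div_less)
  show "ref_index j < D" "i < n \<Longrightarrow> mr_digits dI (ref_index j) ! i = mr_digits gd j ! i div dO ! i"
    unfolding ref_index_def using mr_encode[OF *] by auto
qed

lemma out_index:
  assumes "j < P"
  shows "out_index j < E" "i < n \<Longrightarrow> mr_digits dO (out_index j) ! i = mr_digits gd j ! i mod dO ! i"
proof -
  have *: "mr_digits gd j ! i mod dO ! i < dO ! i" if "i < length dO" for i
    using that pos len by simp
  show "out_index j < E" "i < n \<Longrightarrow> mr_digits dO (out_index j) ! i = mr_digits gd j ! i mod dO ! i"
    unfolding out_index_def using mr_encode[OF *] len by auto
qed

lemma join_index:
  assumes "r < D" "a < E"
  shows "join_index r a < P" "i < n \<Longrightarrow> mr_digits gd (join_index r a) ! i = mr_digits dI r ! i * dO ! i + mr_digits dO a ! i"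
proof -
  have *: "mr_digits dI r ! i * dO ! i + mr_digits dO a ! i < gd ! i" if "i < length gd" for i
  proof -
    have i: "i < n" using that by simp
    have "mr_digits dO a ! i < dO ! i" using mr_digits_less[OF assms(2)] i len by simp
    then show ?thesis unfolding gd_nth[OF i] by (rule mult_add_less[OF mr_digits_less[OF assms(1) i]])
  qed
  show "join_index r a < P" "i < n \<Longrightarrow> mr_digits gd (join_index r a) ! i = mr_digits dI r ! i * dO ! i + mr_digits dO a ! i"
    unfolding join_index_def using mr_encode[OF *] by auto
qed

lemma ref_join [simp]:
  assumes "r < D" "a < E"
  shows "ref_index (join_index r a) = r" "out_index (join_index r a) = a"
proof -
  note J = join_index[OF assms]
  show "ref_index (join_index r a) = r"
  proof (rule mr_digits_inj[OF ref_index(1)[OF J(1)] assms(1)])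
    fix i assume i: "i < n"
    then have "mr_digits dO a ! i < dO ! i" using mr_digits_less[OF assms(2)] len by simp
    then show "mr_digits dI (ref_index (join_index r a)) ! i = mr_digits dI r ! i"
      unfolding ref_index(2)[OF J(1) i] J(2)[OF i] by simp
  qed
  show "out_index (join_index r a) = a"
  proof (rule mr_digits_inj[OF out_index(1)[OF J(1)] assms(2)])
    fix i assume "i < length dO"
    then have i: "i < n" using len by simp
    then have "mr_digits dO a ! i < dO ! i" using mr_digits_less[OF assms(2)] len by simp
    then show "mr_digits dO (out_index (join_index r a)) ! i = mr_digits dO a ! i"
      unfolding out_index(2)[OF J(1) i] J(2)[OF i] by simp
  qed
qed

lemma join_ref_out [simp]:
  assumes "j < P"
  shows "join_index (ref_index j) (out_index j) = j"
proof (rule mr_digits_inj)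
  note J = join_index[OF ref_index(1)[OF assms] out_index(1)[OF assms]]
  show "join_index (ref_index j) (out_index j) < P" "j < P" using J(1) assms by auto
  fix i assume "i < length gd"
  then have i: "i < n" by simp
  show "mr_digits gd (join_index (ref_index j) (out_index j)) ! i = mr_digits gd j ! i"
    unfolding J(2)[OF i] ref_index(2)[OF assms i] out_index(2)[OF assms i] by (rule div_mult_mod_eq)
qed

lemma index_eq_iff:
  assumes "j < P" "k < P"
  shows "j = k \<longleftrightarrow> ref_index j = ref_index k \<and> out_index j = out_index k"
  by (metis assms join_ref_out)

lemma sum_grouped: "(\<Sum>j<P. F (ref_index j) (out_index j)) = (\<Sum>r<D. \<Sum>a<E. F r a)"
  for F :: "nat \<Rightarrow> nat \<Rightarrow> 'a :: comm_monoid_add"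
proof -
  have "(\<Sum>j<P. F (ref_index j) (out_index j)) = (\<Sum>(r,a)\<in>{..<D} \<times> {..<E}. F r a)"
    by (rule sum.reindex_bij_witness[where i = "\<lambda>(r,a). join_index r a" and j = "\<lambda>j. (ref_index j, out_index j)"])
      (auto simp: ref_index out_index join_index)
  then show ?thesis by (simp add: sum.cartesian_product)
qed

text \<open>Position of a grouped index in the ordering \<open>R\<^sub>1 \<dots> R\<^sub>n X\<^sub>1 \<dots> X\<^sub>n\<close>.\<close>
definition blocked_index :: "nat \<Rightarrow> nat" where
  "blocked_index j = ref_index j * E + out_index j"

lemma blocked_index:
  assumes "j < P"
  shows "blocked_index j < D * E" "blocked_index j div E = ref_index j" "blocked_index j mod E = out_index j"
proof -
  note b = ref_index(1)[OF assms] out_index(1)[OF assms]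
  show "blocked_index j < D * E" unfolding blocked_index_def by (rule mult_add_less[OF b])
  show "blocked_index j div E = ref_index j" unfolding blocked_index_def by (rule mult_add_div[OF b(2)])
  show "blocked_index j mod E = out_index j" using b by (simp add: blocked_index_def)
qed

lemma blocked_join:
  assumes "t < D * E"
  shows "join_index (t div E) (t mod E) < P" "blocked_index (join_index (t div E) (t mod E)) = t"
proof -
  have b: "t div E < D" "t mod E < E" using assms E_pos by (auto simp: less_mult_imp_div_less)
  show "join_index (t div E) (t mod E) < P" by (rule join_index(1)[OF b])
  show "blocked_index (join_index (t div E) (t mod E)) = t" using b by (simp add: blocked_index_def)
qed

end

text \<open>The double sum in \<open>reorder\<close> has a single nonzero term: since
  \<open>f\<close> is onto, the matching conditions prescribe all digits of the old indices. The
  witnesses \<open>x\<close> and \<open>y\<close> are left to the caller.\<close>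

lemma index_reorder:
  fixes f :: "nat \<Rightarrow> nat"
  assumes ds': "map (\<lambda>p. ds ! f p) [0..<length ds] = ds'"
    and surj: "\<And>q. q < length ds \<Longrightarrow> \<exists>p<length ds. f p = q" and f: "\<And>p. p < length ds \<Longrightarrow> f p < length ds"
    and jk: "j < prod_list ds" "k < prod_list ds" and xy: "x < prod_list ds" "y < prod_list ds"
    and x: "\<And>p. p < length ds \<Longrightarrow> mr_digits ds x ! f p = mr_digits ds' j ! p"
    and y: "\<And>p. p < length ds \<Longrightarrow> mr_digits ds y ! f p = mr_digits ds' k ! p"
  shows "reorder ds f \<rho> $$ (j,k) = \<rho> $$ (x,y)"
proof -
  have eq: "(\<forall>p<length ds. mr_digits ds i ! f p = mr_digits ds' j ! p \<and> mr_digits ds i' ! f p = mr_digits ds' k ! p) \<longleftrightarrow> i = x \<and> i' = y"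
    if "i < prod_list ds" "i' < prod_list ds" for i i'
  proof
    assume *: "\<forall>p<length ds. mr_digits ds i ! f p = mr_digits ds' j ! p \<and> mr_digits ds i' ! f p = mr_digits ds' k ! p"
    have "mr_digits ds i ! q = mr_digits ds x ! q \<and> mr_digits ds i' ! q = mr_digits ds y ! q" if "q < length ds" for q
      using surj[OF that] * x y by metis
    then show "i = x \<and> i' = y" using mr_digits_inj[OF that(1) xy(1)] mr_digits_inj[OF that(2) xy(2)] by blast
  qed (use x y in auto)
  have "reorder ds f \<rho> $$ (j,k) = (\<Sum>i<prod_list ds. \<Sum>i'<prod_list ds.
      if \<forall>p<length ds. mr_digits ds i ! f p = mr_digits ds' j ! p \<and> mr_digits ds i' ! f p = mr_digits ds' k ! p then \<rho> $$ (i,i') else 0)"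
    using jk by (simp only: reorder_def Let_def ds' index_mat split)
  also have "\<dots> = (\<Sum>i<prod_list ds. \<Sum>i'<prod_list ds. if i' = y then (if i = x then \<rho> $$ (i,i') else 0) else 0)"
    by (intro sum.cong refl) (simp add: eq)
  also have "\<dots> = \<rho> $$ (x,y)" using xy by simp
  finally show ?thesis .
qed

lemma dim_reorder: "dim_row (reorder ds f \<rho>) = prod_list ds" "dim_col (reorder ds f \<rho>) = prod_list ds"
  by (simp_all add: reorder_def Let_def)

context grouping
begin

lemma interleaved_dims: "map (\<lambda>p. (dI @ dO) ! interleaved_of_blocked n p) [0..<length (dI @ dO)] = interleave dI dO"
proof (rule nth_equalityI)
  show "length (map (\<lambda>p. (dI @ dO) ! interleaved_of_blocked n p) [0..<length (dI @ dO)]) = length (interleave dI dO)"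
    using interleave_nth(1)[OF len[symmetric]] len by simp
  fix p assume "p < length (map (\<lambda>p. (dI @ dO) ! interleaved_of_blocked n p) [0..<length (dI @ dO)])"
  then have p: "p < 2 * n" using len by simp
  have "(dI @ dO) ! interleaved_of_blocked n p = interleave dI dO ! p"
  proof (cases "even p")
    case True
    then obtain m where m: "p = 2 * m" by blast
    then show ?thesis using p interleave_nth(3)[OF len[symmetric], of m] by (simp add: interleaved_of_blocked_def nth_append)
  next
    case False
    then obtain m where m: "p = Suc (2 * m)" by (metis oddE Suc_eq_plus1)
    then show ?thesis using p interleave_nth(4)[OF len[symmetric], of m] by (simp add: interleaved_of_blocked_def nth_append)
  qed
  then show "map (\<lambda>p. (dI @ dO) ! interleaved_of_blocked n p) [0..<length (dI @ dO)] ! p = interleave dI dO ! p"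
    using p len by simp
qed

lemma index_reorder_interleaved:
  assumes "j < P" "k < P"
  shows "reorder (dI @ dO) (interleaved_of_blocked n) \<rho> $$ (j,k) = \<rho> $$ (blocked_index j, blocked_index k)"
proof (rule index_reorder[OF interleaved_dims])
  have l: "length (dI @ dO) = 2 * n" using len by simp
  show "j < prod_list (dI @ dO)" "k < prod_list (dI @ dO)" using assms by (simp_all add: P_eq)
  show "blocked_index j < prod_list (dI @ dO)" "blocked_index k < prod_list (dI @ dO)" using blocked_index(1) assms by simp_all
  show "\<exists>p<length (dI @ dO). interleaved_of_blocked n p = q" if "q < length (dI @ dO)" for q
  proof (cases "q < n")
    case True
    then show ?thesis using l by (intro exI[of _ "2 * q"]) (simp add: interleaved_of_blocked_def)
  next
    case False
    then show ?thesis using l that by (intro exI[of _ "Suc (2 * (q - n))"]) (auto simp: interleaved_of_blocked_def)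
  qed
  show "interleaved_of_blocked n p < length (dI @ dO)" if "p < length (dI @ dO)" for p
    using that l by (auto simp: interleaved_of_blocked_def)
  have *: "mr_digits (dI @ dO) (blocked_index j) ! interleaved_of_blocked n p = mr_digits (interleave dI dO) j ! p"
    if j: "j < P" and p: "p < length (dI @ dO)" for j p
  proof (cases "even p")
    case True
    then obtain m where m: "p = 2 * m" by blast
    then have m': "m < n" using p l by simp
    show ?thesis using mr_digits_interleave[OF len[symmetric] m', of j] m m'
      by (simp add: interleaved_of_blocked_def mr_digits_append nth_append blocked_index[OF j] ref_index[OF j] gd_map2)
  next
    case False
    then obtain m where m: "p = Suc (2 * m)" by (metis oddE Suc_eq_plus1)
    then have m': "m < n" using p l by simp
    show ?thesis using mr_digits_interleave[OF len[symmetric] m', of j] m m'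
      by (simp add: interleaved_of_blocked_def mr_digits_append nth_append blocked_index[OF j] out_index[OF j] gd_map2)
  qed
  show "mr_digits (dI @ dO) (blocked_index j) ! interleaved_of_blocked n p = mr_digits (interleave dI dO) j ! p"
    "mr_digits (dI @ dO) (blocked_index k) ! interleaved_of_blocked n p = mr_digits (interleave dI dO) k ! p"
    if "p < length (dI @ dO)" for p using * assms that by auto
qed

end

lemma blocked_dims:
  "map (\<lambda>p. interleave xs xs ! blocked_of_interleaved (length xs) p) [0..<length (interleave xs xs)] = xs @ xs"
proof (rule nth_equalityI)
  note i = interleave_nth[OF refl[of "length xs"]]
  show "length (map (\<lambda>p. interleave xs xs ! blocked_of_interleaved (length xs) p) [0..<length (interleave xs xs)]) = length (xs @ xs)"
    using i(1) by simp
  fix p assume "p < length (map (\<lambda>p. interleave xs xs ! blocked_of_interleaved (length xs) p) [0..<length (interleave xs xs)])"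
  then have p: "p < 2 * length xs" using i(1) by simp
  then have "interleave xs xs ! blocked_of_interleaved (length xs) p = (xs @ xs) ! p"
    using i(3)[of p] i(4)[of "p - length xs"] by (cases "p < length xs") (auto simp: blocked_of_interleaved_def nth_append)
  then show "map (\<lambda>p. interleave xs xs ! blocked_of_interleaved (length xs) p) [0..<length (interleave xs xs)] ! p = (xs @ xs) ! p"
    using p i(1) by simp
qed

lemma max_ent_carrier [simp]: "max_ent d \<in> carrier_mat (d * d) (d * d)"
  by (simp add: max_ent_def)

text \<open>A product of maximally entangled pairs, with all references moved in front of all
  inputs, is the maximally entangled state of the total systems. This disposes of the first
  permutation in \<open>choi_state\<close>.\<close>

lemma reorder_max_ent:
  assumes pos: "\<And>i. i < length xs \<Longrightarrow> 0 < xs ! i"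
  shows "reorder (concat (map (\<lambda>d. [d, d]) xs)) (blocked_of_interleaved (length xs)) (tensor_list (map max_ent xs))
     = max_ent (prod_list xs)"
proof (rule eq_matI)
  \<comment> \<open>Each factor here is a pair of copies of the same space, so the grouped system
    has input and output dimensions equal.\<close>
  interpret g: grouping xs xs by standard (use pos in auto)
  have cc: "concat (map (\<lambda>d. [d, d]) xs) = interleave xs xs" by (induction xs) auto
  let ?D = "prod_list xs" and ?n = "length xs"
  note i = interleave_nth[OF refl[of ?n]]
  have pl: "prod_list (interleave xs xs) = ?D * ?D" unfolding i(2) g.gd_map2 by (rule g.P_eq)
  show "dim_row (reorder (concat (map (\<lambda>d. [d, d]) xs)) (blocked_of_interleaved ?n) (tensor_list (map max_ent xs))) = dim_row (max_ent ?D)"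
    "dim_col (reorder (concat (map (\<lambda>d. [d, d]) xs)) (blocked_of_interleaved ?n) (tensor_list (map max_ent xs))) = dim_col (max_ent ?D)"
    unfolding cc dim_reorder pl by (simp_all add: max_ent_def)
  fix j k assume "j < dim_row (max_ent ?D)" "k < dim_col (max_ent ?D)"
  then have jk: "j < ?D * ?D" "k < ?D * ?D" by (simp_all add: max_ent_def)
  \<comment> \<open>The interleaved index belonging to the blocked index \<open>j\<close>: quotient
    and remainder by the total dimension are the reference and input parts.\<close>
  define x where "x j = g.join_index (j div ?D) (j mod ?D)" for j
  have b: "j div ?D < ?D" "j mod ?D < ?D" if "j < ?D * ?D" for j
    using that g.D_pos by (auto simp: less_mult_imp_div_less)
  have xl: "x j < g.P" if "j < ?D * ?D" for j unfolding x_def by (rule g.join_index(1)[OF b[OF that]])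
  have dg: "mr_digits (interleave xs xs) (x j) ! blocked_of_interleaved ?n p = mr_digits (xs @ xs) j ! p"
    if j: "j < ?D * ?D" and p: "p < 2 * ?n" for j p
  proof (cases "p < ?n")
    case True
    have "mr_digits xs (j mod ?D) ! p < xs ! p" by (rule mr_digits_less[OF b(2)[OF j] True])
    then show ?thesis
      using j True mr_digits_interleave[OF refl True, of "x j"] g.join_index(2)[OF b[OF j] True]
      by (simp add: blocked_of_interleaved_def mr_digits_append nth_append x_def g.gd_map2)
  next
    case False
    define m where "m = p - ?n"
    have m: "m < ?n" "p = ?n + m" using False p by (auto simp: m_def)
    have "mr_digits xs (j mod ?D) ! m < xs ! m" by (rule mr_digits_less[OF b(2)[OF j] m(1)])
    then show ?thesis
      using j m mr_digits_interleave[OF refl m(1), of "x j"] g.join_index(2)[OF b[OF j] m(1)]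
      by (simp add: blocked_of_interleaved_def mr_digits_append nth_append x_def g.gd_map2)
  qed
  have "reorder (interleave xs xs) (blocked_of_interleaved ?n) (tensor_list (map max_ent xs)) $$ (j,k) = tensor_list (map max_ent xs) $$ (x j, x k)"
  proof (rule index_reorder[OF blocked_dims])
    show "j < prod_list (interleave xs xs)" "k < prod_list (interleave xs xs)" using jk by (simp_all add: pl)
    show "x j < prod_list (interleave xs xs)" "x k < prod_list (interleave xs xs)"
      using xl jk unfolding i(2) g.gd_map2 by auto
    show "\<exists>p<length (interleave xs xs). blocked_of_interleaved ?n p = q" if "q < length (interleave xs xs)" for q
    proof (cases "even q")
      case True
      then obtain m where "q = 2 * m" by blast
      then show ?thesis using that i(1) by (intro exI[of _ m]) (auto simp: blocked_of_interleaved_def)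
    next
      case False
      then obtain m where "q = Suc (2 * m)" by (metis oddE Suc_eq_plus1)
      then show ?thesis using that i(1) by (intro exI[of _ "?n + m"]) (auto simp: blocked_of_interleaved_def)
    qed
    show "blocked_of_interleaved ?n p < length (interleave xs xs)" if "p < length (interleave xs xs)" for p
      using that i(1) by (auto simp: blocked_of_interleaved_def)
    show "mr_digits (interleave xs xs) (x j) ! blocked_of_interleaved ?n p = mr_digits (xs @ xs) j ! p"
      "mr_digits (interleave xs xs) (x k) ! blocked_of_interleaved ?n p = mr_digits (xs @ xs) k ! p"
      if "p < length (interleave xs xs)" for p using dg jk that i(1) by auto
  qed
  also have "\<dots> = max_ent ?D $$ (j,k)"
  proof -
    have e: "map max_ent xs = map (\<lambda>i. max_ent (xs ! i)) [0..<length g.gd]"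
      by (rule nth_equalityI) auto
    have me: "max_ent (xs ! i) \<in> carrier_mat (g.gd ! i) (g.gd ! i)" if "i < length g.gd" for i
      using that max_ent_carrier by (simp add: g.gd_nth)
    have "tensor_list (map max_ent xs) $$ (x j, x k) = (\<Prod>i<?n. max_ent (xs ! i) $$ (mr_digits g.gd (x j) ! i, mr_digits g.gd (x k) ! i))"
      unfolding e using index_tensor_upto[where rs = g.gd and cs = g.gd, OF me refl xl[OF jk(1)] xl[OF jk(2)]] by simp
    also have "\<dots> = (\<Prod>i<?n. complex_of_real (1 / real (xs ! i)) * ((if mr_digits xs (j div ?D) ! i = mr_digits xs (j mod ?D) ! i then 1 else 0)
        * (if mr_digits xs (k div ?D) ! i = mr_digits xs (k mod ?D) ! i then 1 else 0)))"
    proof (rule prod.cong[OF refl])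
      fix i assume "i \<in> {..<?n}"
      then have i: "i < ?n" by simp
      have lt: "mr_digits g.gd (x j) ! i < xs ! i * xs ! i" if "j < ?D * ?D" for j
        using mr_digits_less[OF xl[OF that], of i] i by (simp add: g.gd_nth)
      have dm: "mr_digits g.gd (x j) ! i div xs ! i = mr_digits xs (j div ?D) ! i" "mr_digits g.gd (x j) ! i mod xs ! i = mr_digits xs (j mod ?D) ! i"
        if "j < ?D * ?D" for j
        using mr_digits_less[OF b(2)[OF that] i] unfolding x_def g.join_index(2)[OF b[OF that] i] by simp_all
      show "max_ent (xs ! i) $$ (mr_digits g.gd (x j) ! i, mr_digits g.gd (x k) ! i) =
        complex_of_real (1 / real (xs ! i)) * ((if mr_digits xs (j div ?D) ! i = mr_digits xs (j mod ?D) ! i then 1 else 0)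
        * (if mr_digits xs (k div ?D) ! i = mr_digits xs (k mod ?D) ! i then 1 else 0))"
        using lt jk by (simp add: max_ent_def dm)
    qed
    also have "\<dots> = complex_of_real (1 / real ?D) * ((if j div ?D = j mod ?D then 1 else 0) * (if k div ?D = k mod ?D then 1 else 0))"
      unfolding prod.distrib prod_indicator_mr_digits[OF b[OF jk(1)]] prod_indicator_mr_digits[OF b[OF jk(2)]]
      by (simp add: prod_list_nth[of xs] prod_dividef)
    finally show ?thesis using jk by (simp add: max_ent_def)
  qed
  finally show "reorder (concat (map (\<lambda>d. [d, d]) xs)) (blocked_of_interleaved ?n) (tensor_list (map max_ent xs)) $$ (j,k) = max_ent ?D $$ (j,k)"
    unfolding cc .
qed

context grouping
begin

lemma choi_state_eq:
  "choi_state dI dO T = mat P P (\<lambda>(j,k). id_tensor D D E T (max_ent D) $$ (blocked_index j, blocked_index k))"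
proof (rule eq_matI)
  have e: "choi_state dI dO T = reorder (dI @ dO) (interleaved_of_blocked n) (id_tensor D D E T (max_ent D))"
    by (simp add: choi_state_def Let_def reorder_max_ent[OF pos(1)])
  show "dim_row (choi_state dI dO T) = dim_row (mat P P (\<lambda>(j,k). id_tensor D D E T (max_ent D) $$ (blocked_index j, blocked_index k)))"
    "dim_col (choi_state dI dO T) = dim_col (mat P P (\<lambda>(j,k). id_tensor D D E T (max_ent D) $$ (blocked_index j, blocked_index k)))"
    unfolding e dim_reorder by (simp_all add: P_eq)
  fix j k assume "j < dim_row (mat P P (\<lambda>(j,k). id_tensor D D E T (max_ent D) $$ (blocked_index j, blocked_index k)))"
     "k < dim_col (mat P P (\<lambda>(j,k). id_tensor D D E T (max_ent D) $$ (blocked_index j, blocked_index k)))"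
  then show "choi_state dI dO T $$ (j,k) = mat P P (\<lambda>(j,k). id_tensor D D E T (max_ent D) $$ (blocked_index j, blocked_index k)) $$ (j,k)"
    unfolding e by (simp add: index_reorder_interleaved)
qed

end

section \<open>Channels and Choi states\<close>


text \<open>\<open>S x y a b\<close> is the entry (a,b) of the image of the matrix unit |x><y|. The
  predicate asserts linearity only, so it applies to a Kraus channel and to
  \<open>chan_tensor\<close> alike; positivity is stated separately, through the Choi
  matrix.\<close>

definition channel_kernel :: "nat \<Rightarrow> nat \<Rightarrow> (complex mat \<Rightarrow> complex mat) \<Rightarrow> (nat \<Rightarrow> nat \<Rightarrow> nat \<Rightarrow> nat \<Rightarrow> complex) \<Rightarrow> bool" where
  "channel_kernel d e T S \<longleftrightarrow> (\<forall>Y\<in>carrier_mat d d. T Y \<in> carrier_mat e e \<and>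
     (\<forall>a<e. \<forall>b<e. T Y $$ (a,b) = (\<Sum>x<d. \<Sum>y<d. Y $$ (x,y) * S x y a b)))"

lemma channel_kernelD:
  assumes "channel_kernel d e T S" "Y \<in> carrier_mat d d"
  shows "T Y \<in> carrier_mat e e"
    and "a < e \<Longrightarrow> b < e \<Longrightarrow> T Y $$ (a,b) = (\<Sum>x<d. \<Sum>y<d. Y $$ (x,y) * S x y a b)"
  using assms by (auto simp: channel_kernel_def)

lemma is_channel_kernel:
  assumes "is_channel d e T"
  obtains m :: nat and K where "channel_kernel d e T (\<lambda>x y a b. \<Sum>k<m. K k $$ (a,x) * cnj (K k $$ (b,y)))"
    "\<And>x y. x < d \<Longrightarrow> y < d \<Longrightarrow> (\<Sum>k<m. \<Sum>a<e. cnj (K k $$ (a,x)) * K k $$ (a,y)) = (if x = y then 1 else 0)"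
proof -
  obtain m :: nat and K where K: "\<And>k. k < m \<Longrightarrow> K k \<in> carrier_mat e d"
    and one: "mat_sum d {..<m} (\<lambda>k. adj (K k) * K k) = 1\<^sub>m d"
    and T: "\<And>Y. Y \<in> carrier_mat d d \<Longrightarrow> T Y = mat_sum e {..<m} (\<lambda>k. K k * Y * adj (K k))"
    using assms unfolding is_channel_def by blast
  have "channel_kernel d e T (\<lambda>x y a b. \<Sum>k<m. K k $$ (a,x) * cnj (K k $$ (b,y)))"
    unfolding channel_kernel_def
  proof (intro ballI conjI allI impI)
    fix Y :: "complex mat" assume Y: "Y \<in> carrier_mat d d"
    show "T Y \<in> carrier_mat e e" unfolding T[OF Y] by simp
    fix a b assume ab: "a < e" "b < e"
    have "T Y $$ (a,b) = (\<Sum>k<m. \<Sum>x<d. \<Sum>y<d. K k $$ (a,x) * Y $$ (x,y) * cnj (K k $$ (b,y)))"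
      unfolding T[OF Y] index_mat_sum[OF ab] by (intro sum.cong refl) (use index_conj_sum[OF K Y ab] in auto)
    also have "\<dots> = (\<Sum>x<d. \<Sum>y<d. Y $$ (x,y) * (\<Sum>k<m. K k $$ (a,x) * cnj (K k $$ (b,y))))"
      by (rule trans[OF sum_rotate[symmetric]]) (simp add: sum_distrib_left mult_ac)
    finally show "T Y $$ (a,b) = (\<Sum>x<d. \<Sum>y<d. Y $$ (x,y) * (\<Sum>k<m. K k $$ (a,x) * cnj (K k $$ (b,y))))" .
  qed
  moreover have "(\<Sum>k<m. \<Sum>a<e. cnj (K k $$ (a,x)) * K k $$ (a,y)) = (if x = y then 1 else 0)" if xy: "x < d" "y < d" for x y
  proof -
    have "mat_sum d {..<m} (\<lambda>k. adj (K k) * K k) $$ (x,y) = (\<Sum>k<m. \<Sum>a<e. cnj (K k $$ (a,x)) * K k $$ (a,y))"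
      unfolding index_mat_sum[OF xy]
    proof (rule sum.cong[OF refl])
      fix k assume "k \<in> {..<m}"
      then have k: "K k \<in> carrier_mat e d" using K by simp
      show "(adj (K k) * K k) $$ (x,y) = (\<Sum>a<e. cnj (K k $$ (a,x)) * K k $$ (a,y))"
        unfolding index_mult_sum[OF adj_carrier[OF k] k xy] using k xy by (simp add: carrier_matD[OF k])
    qed
    then show ?thesis unfolding one using xy by simp
  qed
  ultimately show ?thesis by (rule that)
qed

lemma channel_kernel_ket_bra:
  assumes "channel_kernel d e T S" "x < d" "y < d" "a < e" "b < e"
  shows "T (ket_bra d x y) $$ (a,b) = S x y a b"
proof -
  have "ket_bra d x y \<in> carrier_mat d d" by (simp add: ket_bra_def)
  then have "T (ket_bra d x y) $$ (a,b) = (\<Sum>u<d. \<Sum>v<d. ket_bra d x y $$ (u,v) * S u v a b)"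
    using channel_kernelD(2)[OF assms(1) _ assms(4,5)] by blast
  also have "\<dots> = (\<Sum>u<d. \<Sum>v<d. if v = y then (if u = x then S u v a b else 0) else 0)"
    by (intro sum.cong refl) (simp add: ket_bra_def)
  finally show ?thesis using assms by simp
qed

lemma index_id_tensor:
  assumes "channel_kernel d e T S" "t < r * e" "t' < r * e"
  shows "id_tensor r d e T \<rho> $$ (t,t') =
    (\<Sum>x<d. \<Sum>y<d. \<rho> $$ ((t div e) * d + x, (t' div e) * d + y) * S x y (t mod e) (t' mod e))"
proof -
  have e: "e > 0" using assms(2) by (cases e) auto
  have "mat d d (\<lambda>(x,y). \<rho> $$ ((t div e) * d + x, (t' div e) * d + y)) \<in> carrier_mat d d" by simp
  from channel_kernelD(2)[OF assms(1) this, of "t mod e" "t' mod e"] show ?thesis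
    using assms(2,3) e by (simp add: id_tensor_def)
qed

lemma psd_max_ent: "psd_mat (d * d) (max_ent d)"
proof (rule psd_mat_gramI[where S = "{()}" and u = "\<lambda>_ j. if j div d = j mod d then complex_of_real (sqrt (1 / real d)) else 0"])
  have s: "complex_of_real (sqrt (1 / real d)) * complex_of_real (sqrt (1 / real d)) = complex_of_real (1 / real d)"
    unfolding of_real_mult[symmetric] by simp
  show "max_ent d $$ (i,j) = (\<Sum>k\<in>{()}. (if i div d = i mod d then complex_of_real (sqrt (1 / real d)) else 0) *
      cnj (if j div d = j mod d then complex_of_real (sqrt (1 / real d)) else 0))" if "i < d * d" "j < d * d" for i j
    using that s by (auto simp: max_ent_def simp del: real_sqrt_divide)
qed simp

lemma is_state_max_ent:
  assumes "0 < d"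
  shows "is_state (d * d) (max_ent d)"
proof -
  have "mtrace (max_ent d) = (\<Sum>t<d * d. if t div d = t mod d then complex_of_real (1 / real d) else 0)"
    by (simp add: mtrace_def max_ent_def)
  also have "\<dots> = (\<Sum>a<d. \<Sum>y<d. if a = y then complex_of_real (1 / real d) else 0)"
    by (rule sum_div_mod[where h = "\<lambda>a y. if a = y then complex_of_real (1 / real d) else 0"])
  also have "\<dots> = 1" using assms by simp
  finally show ?thesis using psd_max_ent by (simp add: is_state_def)
qed

lemma unitary_kron:
  assumes "unitary_mat d A" "unitary_mat e B"
  shows "unitary_mat (d * e) (kron A B)"
proof (rule unitary_matI)
  note A = unitary_matD(1)[OF assms(1)] and B = unitary_matD(1)[OF assms(2)]
  show c: "kron A B \<in> carrier_mat (d * e) (d * e)" using A B by (simp add: kron_def)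
  show "adj (kron A B) * kron A B = 1\<^sub>m (d * e)"
  proof (rule eq_matI)
    fix x y assume "x < dim_row (1\<^sub>m (d * e))" "y < dim_col (1\<^sub>m (d * e))"
    then have xy: "x < d * e" "y < d * e" by auto
    then have e: "e > 0" by (cases e) auto
    have m: "x div e < d" "y div e < d" "x mod e < e" "y mod e < e" using xy e by (auto simp: less_mult_imp_div_less)
    have "(adj (kron A B) * kron A B) $$ (x,y) = (\<Sum>z<d * e. (cnj (A $$ (z div e, x div e)) * A $$ (z div e, y div e)) *
        (cnj (B $$ (z mod e, x mod e)) * B $$ (z mod e, y mod e)))"
      using xy by (subst index_mult_sum[OF adj_carrier[OF c] c]) (auto simp: kron_def carrier_matD[OF A] carrier_matD[OF B] mult_ac)
    also have "\<dots> = (\<Sum>k<d. \<Sum>l<e. (cnj (A $$ (k, x div e)) * A $$ (k, y div e)) * (cnj (B $$ (l, x mod e)) * B $$ (l, y mod e)))"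
      by (rule sum_div_mod[where h = "\<lambda>k l. (cnj (A $$ (k, x div e)) * A $$ (k, y div e)) * (cnj (B $$ (l, x mod e)) * B $$ (l, y mod e))"])
    also have "\<dots> = (if x div e = y div e then 1 else 0) * (if x mod e = y mod e then 1 else 0)"
      unfolding sum_product[symmetric] unitary_orthonormal_cols[OF assms(1) m(1,2)] unitary_orthonormal_cols[OF assms(2) m(3,4)] ..
    also have "\<dots> = (if x = y then 1 else 0)" by (auto intro: div_mod_decomp) (metis div_mult_mod_eq)
    finally show "(adj (kron A B) * kron A B) $$ (x,y) = 1\<^sub>m (d * e) $$ (x,y)" using xy by simp
  qed (use A B in \<open>auto simp: kron_def\<close>)
qed

lemma unitary_conjugate:
  assumes "unitary_mat d U"
  shows "unitary_mat d (map_mat cnj U)"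
proof (rule unitary_matI)
  note U = unitary_matD(1)[OF assms]
  show c: "map_mat cnj U \<in> carrier_mat d d" using U by simp
  show "adj (map_mat cnj U) * map_mat cnj U = 1\<^sub>m d"
  proof (rule eq_matI)
    fix i j assume "i < dim_row (1\<^sub>m d)" "j < dim_col (1\<^sub>m d)"
    then have ij: "i < d" "j < d" by auto
    have "(adj (map_mat cnj U) * map_mat cnj U) $$ (i,j) = cnj (\<Sum>k<d. cnj (U $$ (k,i)) * U $$ (k,j))"
      unfolding index_mult_sum[OF adj_carrier[OF c] c ij] using ij by (simp add: carrier_matD[OF U])
    then show "(adj (map_mat cnj U) * map_mat cnj U) $$ (i,j) = 1\<^sub>m d $$ (i,j)"
      unfolding unitary_orthonormal_cols[OF assms ij] using ij by simp
  qed (use U in auto)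
qed

text \<open>Polarisation: the matrix units are combinations of pure states.\<close>
lemma linear_zero_on_states:
  assumes z: "\<And>\<rho>. is_state d \<rho> \<Longrightarrow> (\<Sum>u<d. \<Sum>v<d. \<rho> $$ (u,v) * f u v) = 0" and uv: "u < d" "v < d"
  shows "f u v = 0"
proof -
  have pure: "(\<Sum>i<d. \<Sum>j<d. w i * cnj (w j) * f i j) = 0" if w: "(\<Sum>i<d. w i * cnj (w i)) = 1" for w
  proof -
    have "psd_mat d (mat d d (\<lambda>(i,j). w i * cnj (w j)))"
      by (rule psd_mat_gramI[where S = "{()}" and u = "\<lambda>_. w"]) auto
    then have "is_state d (mat d d (\<lambda>(i,j). w i * cnj (w j)))" using w by (simp add: is_state_def mtrace_def)
    from z[OF this] show ?thesis by simp
  qed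
  have diag: "f u u = 0" if u: "u < d" for u
  proof -
    have lin: "(\<Sum>i<d. (if i = u then 1 else 0) * g i) = g u" for g :: "nat \<Rightarrow> complex"
      using u by (simp add: if_distrib if_distribR cong: if_cong)
    have "(\<Sum>i<d. \<Sum>j<d. (if i = u then 1 else 0) * cnj (if j = u then 1 else 0) * f i j) = 0"
      by (rule pure) (simp add: lin u)
    also have "(\<Sum>i<d. \<Sum>j<d. (if i = u then 1 else 0) * cnj (if j = u then 1 else 0) * f i j)
       = (\<Sum>i<d. (if i = u then 1 else 0) * (\<Sum>j<d. (if j = u then 1 else 0) * f i j))"
      unfolding sum_distrib_left by (intro sum.cong refl) simp
    finally show ?thesis unfolding lin .
  qed
  show ?thesis
  proof (cases "u = v")
    case False
    have two: "\<alpha> * cnj \<beta> * f u v + \<beta> * cnj \<alpha> * f v u = 0" if n1: "\<alpha> * cnj \<alpha> + \<beta> * cnj \<beta> = 1" for \<alpha> \<beta>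
    proof -
      define w where "w i = (if i = u then \<alpha> else 0) + (if i = v then \<beta> else 0)" for i
      have lin: "(\<Sum>i<d. w i * g i) = \<alpha> * g u + \<beta> * g v" "(\<Sum>i<d. cnj (w i) * g i) = cnj \<alpha> * g u + cnj \<beta> * g v"
        for g :: "nat \<Rightarrow> complex"
        using uv by (simp_all add: w_def distrib_right sum.distrib if_distrib[of "\<lambda>x. x * _"] if_distrib[of cnj] cong: if_cong)
      have "(\<Sum>i<d. \<Sum>j<d. w i * cnj (w j) * f i j) = 0"
      proof (rule pure)
        have "(\<Sum>i<d. w i * cnj (w i)) = \<alpha> * cnj (w u) + \<beta> * cnj (w v)" by (rule lin(1))
        also have "\<dots> = 1" using n1 False by (simp add: w_def)
        finally show "(\<Sum>i<d. w i * cnj (w i)) = 1" .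
      qed
      also have "(\<Sum>i<d. \<Sum>j<d. w i * cnj (w j) * f i j) = (\<Sum>i<d. w i * (\<Sum>j<d. cnj (w j) * f i j))"
        by (simp add: sum_distrib_left mult.assoc)
      finally show ?thesis unfolding lin using diag uv by (simp add: algebra_simps)
    qed
    \<comment> \<open>With s = 1/sqrt 2, the coefficients (s, s) and (s, \<i> s) show that the sum
      and the difference of \<open>f u v\<close> and \<open>f v u\<close> vanish.\<close>
    define s where "s = complex_of_real (sqrt (1/2))"
    have s: "s * s = 1/2" "cnj s = s" unfolding s_def of_real_mult[symmetric] by simp_all
    have 1: "s * cnj (\<i> * s) = - \<i> * (s * s)" "\<i> * s * cnj s = \<i> * (s * s)" "\<i> * s * cnj (\<i> * s) = s * s" "s * cnj s = s * s"
      by (simp_all add: s(2) algebra_simps)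
    have "1/2 * f u v + 1/2 * f v u = 0"
      using two[of s s] unfolding 1 s(1) by simp
    moreover have "- \<i> * (1/2) * f u v + \<i> * (1/2) * f v u = 0"
      using two[of s "\<i> * s"] unfolding 1 s(1) by simp
    ultimately have "f u v + f v u = 0" "f v u - f u v = 0"
      by (simp_all add: field_simps)
    then show ?thesis by (simp add: eq_neg_iff_add_eq_0)
  qed (use diag uv in simp)
qed

text \<open>Kraus operators of the channel are read off from a Gram representation of its Choi matrix.\<close>
lemma is_channel_of_choi:
  assumes psd: "psd_mat (d * e) J" and d: "0 < d"
    and tr: "\<And>x y. x < d \<Longrightarrow> y < d \<Longrightarrow> (\<Sum>a<e. J $$ (x * e + a, y * e + a)) = (if x = y then 1 / of_nat d else 0)"
  shows "is_channel d e (\<lambda>Y. mat e e (\<lambda>(a,b). \<Sum>x<d. \<Sum>y<d. Y $$ (x,y) * (of_nat d * J $$ (x * e + a, y * e + b))))"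
proof -
  obtain u where u: "\<And>i j. i < d * e \<Longrightarrow> j < d * e \<Longrightarrow> J $$ (i,j) = (\<Sum>k<d * e. u k i * cnj (u k j))"
    using psd_mat_gram[OF psd] by metis
  \<comment> \<open>The Choi matrix of a normalised maximally entangled state carries the factor
    1/d; scaling each Kraus operator by sqrt d removes it.\<close>
  define c where "c = complex_of_real (sqrt (real d))"
  have c: "c * cnj c = of_nat d" "cnj c = c" unfolding c_def of_real_mult[symmetric] complex_cnj_complex_of_real by simp_all
  define K where "K k = mat e d (\<lambda>(a,x). c * u k (x * e + a))" for k
  have K: "K k \<in> carrier_mat e d" for k by (simp add: K_def)
  have "mat_sum d {..<d * e} (\<lambda>k. adj (K k) * K k) = 1\<^sub>m d"
  proof (rule eq_matI)
    fix x y assume "x < dim_row (1\<^sub>m d)" "y < dim_col (1\<^sub>m d)"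
    then have xy: "x < d" "y < d" by auto
    have "mat_sum d {..<d * e} (\<lambda>k. adj (K k) * K k) $$ (x,y) = (\<Sum>k<d * e. \<Sum>a<e. of_nat d * (u k (y * e + a) * cnj (u k (x * e + a))))"
      unfolding index_mat_sum[OF xy] index_mult_sum[OF adj_carrier[OF K] K xy]
      using xy by (intro sum.cong refl) (simp add: K_def c(1)[symmetric] mult_ac)
    also have "\<dots> = of_nat d * (\<Sum>a<e. J $$ (y * e + a, x * e + a))"
      by (subst sum.swap) (simp add: u mult_add_less xy sum_distrib_left)
    finally show "mat_sum d {..<d * e} (\<lambda>k. adj (K k) * K k) $$ (x,y) = 1\<^sub>m d $$ (x,y)"
      using tr[OF xy(2,1)] xy d by simp
  qed auto
  moreover have "mat e e (\<lambda>(a,b). \<Sum>x<d. \<Sum>y<d. Y $$ (x,y) * (of_nat d * J $$ (x * e + a, y * e + b))) = mat_sum e {..<d * e} (\<lambda>k. K k * Y * adj (K k))"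
    if Y: "Y \<in> carrier_mat d d" for Y
  proof (rule eq_matI)
    fix a b assume "a < dim_row (mat_sum e {..<d * e} (\<lambda>k. K k * Y * adj (K k)))" "b < dim_col (mat_sum e {..<d * e} (\<lambda>k. K k * Y * adj (K k)))"
    then have ab: "a < e" "b < e" by auto
    have "mat_sum e {..<d * e} (\<lambda>k. K k * Y * adj (K k)) $$ (a,b) = (\<Sum>k<d * e. \<Sum>x<d. \<Sum>y<d. Y $$ (x,y) * (of_nat d * (u k (x * e + a) * cnj (u k (y * e + b)))))"
      unfolding index_mat_sum[OF ab] index_conj_sum[OF K Y ab]
      using ab by (intro sum.cong refl) (simp add: K_def c(1)[symmetric] mult_ac)
    also have "\<dots> = (\<Sum>x<d. \<Sum>y<d. Y $$ (x,y) * (of_nat d * J $$ (x * e + a, y * e + b)))"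
      by (rule trans[OF sum_rotate[symmetric]]) (use ab in \<open>simp add: u mult_add_less sum_distrib_left\<close>)
    finally show "mat e e (\<lambda>(a,b). \<Sum>x<d. \<Sum>y<d. Y $$ (x,y) * (of_nat d * J $$ (x * e + a, y * e + b))) $$ (a,b) = mat_sum e {..<d * e} (\<lambda>k. K k * Y * adj (K k)) $$ (a,b)"
      using ab by simp
  qed auto
  ultimately show ?thesis unfolding is_channel_def using K by blast
qed

lemma sum_delta2:
  fixes f :: "nat \<Rightarrow> nat \<Rightarrow> complex"
  assumes "x < d" "y < d"
  shows "(\<Sum>u<d. \<Sum>v<d. (if u = x \<and> v = y then c else 0) * f u v) = c * f x y"
proof -
  have "(\<Sum>u<d. \<Sum>v<d. (if u = x \<and> v = y then c else 0) * f u v) = (\<Sum>u<d. \<Sum>v<d. if v = y then (if u = x then c * f u v else 0) else 0)"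
    by (intro sum.cong refl) simp
  then show ?thesis using assms by simp
qed

section \<open>Choi states in the grouped ordering\<close>

context grouping
begin

text \<open>The Choi matrix written directly in grouped indices, with both permutations absorbed;
  1/D is the normalisation of the maximally entangled state.\<close>

definition choi_of :: "(nat \<Rightarrow> nat \<Rightarrow> nat \<Rightarrow> nat \<Rightarrow> complex) \<Rightarrow> complex mat" where
  "choi_of S = mat P P (\<lambda>(j,k). complex_of_real (1 / real D) * S (ref_index j) (ref_index k) (out_index j) (out_index k))"

lemma choi_of_carrier [simp]: "choi_of S \<in> carrier_mat P P"
  by (simp add: choi_of_def)

lemma index_id_tensor_max_ent:
  assumes S: "channel_kernel D E T S" and t: "t < D * E" "t' < D * E"
  shows "id_tensor D D E T (max_ent D) $$ (t,t') = complex_of_real (1 / real D) * S (t div E) (t' div E) (t mod E) (t' mod E)"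
proof -
  have b: "t div E < D" "t' div E < D" using t by (auto simp: less_mult_imp_div_less)
  have "max_ent D $$ ((t div E) * D + x, (t' div E) * D + y) = (if x = t div E \<and> y = t' div E then complex_of_real (1 / real D) else 0)"
    if "x < D" "y < D" for x y
    using mult_add_less[OF b(1) that(1)] mult_add_less[OF b(2) that(2)] that by (auto simp: max_ent_def mult_add_div)
  then have "id_tensor D D E T (max_ent D) $$ (t,t') =
      (\<Sum>x<D. \<Sum>y<D. (if x = t div E \<and> y = t' div E then complex_of_real (1 / real D) else 0) * S x y (t mod E) (t' mod E))"
    unfolding index_id_tensor[OF S t] by (intro sum.cong refl) simp
  then show ?thesis unfolding sum_delta2[OF b] .
qed

lemma choi_state_kernel:
  assumes "channel_kernel D E T S"
  shows "choi_state dI dO T = choi_of S"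
  unfolding choi_state_eq choi_of_def
  by (rule cong_mat) (auto simp: index_id_tensor_max_ent[OF assms] blocked_index)

lemma chan_tensor_kernel:
  "channel_kernel D E (chan_tensor dI dO M) (\<lambda>x y a b. \<Prod>i<n.
     M i (ket_bra (dI ! i) (mr_digits dI x ! i) (mr_digits dI y ! i)) $$ (mr_digits dO a ! i, mr_digits dO b ! i))"
  by (simp add: channel_kernel_def chan_tensor_def)

text \<open>Each Kraus operator, vectorised and divided by sqrt D, is one Gram vector.\<close>

lemma psd_choi_of_kraus: "psd_mat P (choi_of (\<lambda>x y a b. \<Sum>k<m. K k $$ (a,x) * cnj (K k $$ (b,y))))"
proof (rule psd_mat_gramI[where S = "{..<m}" and u = "\<lambda>k j. complex_of_real (sqrt (1 / real D)) * K k $$ (out_index j, ref_index j)"])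
  fix j k assume "j < P" "k < P"
  then have "choi_of (\<lambda>x y a b. \<Sum>k<m. K k $$ (a,x) * cnj (K k $$ (b,y))) $$ (j,k) =
    (\<Sum>l<m. complex_of_real (1 / real D) * K l $$ (out_index j, ref_index j) * cnj (K l $$ (out_index k, ref_index k)))"
    by (simp add: choi_of_def sum_distrib_left mult.assoc)
  also have "\<dots> = (\<Sum>l<m. (complex_of_real (sqrt (1 / real D)) * K l $$ (out_index j, ref_index j)) *
      cnj (complex_of_real (sqrt (1 / real D)) * K l $$ (out_index k, ref_index k)))"
    by (rule sum.cong[OF refl], rule sqrt_scale) simp
  finally show "choi_of (\<lambda>x y a b. \<Sum>k<m. K k $$ (a,x) * cnj (K k $$ (b,y))) $$ (j,k) = (\<Sum>l<m. (complex_of_real (sqrt (1 / real D)) * K l $$ (out_index j, ref_index j)) *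
      cnj (complex_of_real (sqrt (1 / real D)) * K l $$ (out_index k, ref_index k)))" .
qed simp

text \<open>\<open>conj(U) \<otimes> V\<close>, reordered to the grouped system.\<close>
definition conj_tensor :: "complex mat \<Rightarrow> complex mat \<Rightarrow> complex mat" where
  "conj_tensor U V = mat P P (\<lambda>(j,k). cnj (U $$ (ref_index j, ref_index k)) * V $$ (out_index j, out_index k))"

lemma conj_tensor_carrier [simp]: "conj_tensor U V \<in> carrier_mat P P"
  by (simp add: conj_tensor_def)

lemma index_conj_tensor_choi:
  assumes "j < P" "k < P" and \<chi>: "\<chi> \<in> carrier_mat P P"
  shows "(conj_tensor U V * \<chi> * adj (conj_tensor U V)) $$ (j,k) = (\<Sum>j'<P. \<Sum>k'<P.
      (cnj (U $$ (ref_index j, ref_index j')) * V $$ (out_index j, out_index j')) * \<chi> $$ (j',k') *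
      (U $$ (ref_index k, ref_index k') * cnj (V $$ (out_index k, out_index k'))))"
  unfolding index_conj_sum[OF conj_tensor_carrier \<chi> assms(1,2)]
  using assms by (intro sum.cong refl) (simp add: conj_tensor_def)

text \<open>A unitary on the input half of a maximally entangled pair acts like its transpose on the
  reference. Covariance therefore says that conj(U) on the reference and V on the output together
  fix the Choi state.\<close>

lemma choi_of_invariant:
  assumes S: "channel_kernel D E T S" and U: "unitary_mat D U" and V: "unitary_mat E V"
    and cov: "\<And>\<rho>. is_state D \<rho> \<Longrightarrow> T (U * \<rho> * adj U) = V * T \<rho> * adj V"
  shows "conj_tensor U V * choi_of S * adj (conj_tensor U V) = choi_of S"
proof -
  note Uc = unitary_matD(1)[OF U] and Vc = unitary_matD(1)[OF V]
  \<comment> \<open>Covariance as an identity between coefficients on matrix units. The hypothesis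
    concerns states only; the difference of both sides is a linear functional vanishing on all
    states, hence on matrix units.\<close>
  have kov: "(\<Sum>a<E. \<Sum>a'<E. V $$ (b,a) * S u v a a' * cnj (V $$ (b',a'))) = (\<Sum>x<D. \<Sum>y<D. U $$ (x,u) * cnj (U $$ (y,v)) * S x y b b')"
    if uv: "u < D" "v < D" and b: "b < E" "b' < E" for u v b b'
  proof -
    let ?l = "\<lambda>u v. \<Sum>x<D. \<Sum>y<D. U $$ (x,u) * cnj (U $$ (y,v)) * S x y b b'"
    let ?r = "\<lambda>u v. \<Sum>a<E. \<Sum>a'<E. V $$ (b,a) * S u v a a' * cnj (V $$ (b',a'))"
    have "?l u v - ?r u v = 0"
    proof (rule linear_zero_on_states[where d = D, OF _ uv])
      fix \<rho> assume st: "is_state D \<rho>"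
      then have \<rho>: "\<rho> \<in> carrier_mat D D" by (simp add: is_state_def psd_mat_def)
      have U\<rho>: "U * \<rho> * adj U \<in> carrier_mat D D" using Uc \<rho> by (auto dest!: carrier_dims intro!: carrier_matI)
      have "(\<Sum>u<D. \<Sum>v<D. \<rho> $$ (u,v) * ?l u v) = (\<Sum>x<D. \<Sum>y<D. \<Sum>u<D. \<Sum>v<D. \<rho> $$ (u,v) * (U $$ (x,u) * cnj (U $$ (y,v)) * S x y b b'))"
        unfolding sum_distrib_left by (rule sum_swap4)
      also have "\<dots> = (\<Sum>x<D. \<Sum>y<D. (U * \<rho> * adj U) $$ (x,y) * S x y b b')"
        by (intro sum.cong refl, subst index_conj_sum[OF Uc \<rho>]) (auto simp: sum_distrib_left sum_distrib_right mult_ac)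
      also have "\<dots> = T (U * \<rho> * adj U) $$ (b,b')" by (rule channel_kernelD(2)[OF S U\<rho> b, symmetric])
      also have "\<dots> = (\<Sum>a<E. \<Sum>a'<E. V $$ (b,a) * T \<rho> $$ (a,a') * cnj (V $$ (b',a')))"
        unfolding cov[OF st] by (rule index_conj_sum[OF Vc channel_kernelD(1)[OF S \<rho>] b])
      also have "\<dots> = (\<Sum>a<E. \<Sum>a'<E. \<Sum>u<D. \<Sum>v<D. \<rho> $$ (u,v) * (V $$ (b,a) * S u v a a' * cnj (V $$ (b',a'))))"
        by (intro sum.cong refl) (simp add: channel_kernelD(2)[OF S \<rho>] sum_distrib_left sum_distrib_right mult_ac)
      also have "\<dots> = (\<Sum>u<D. \<Sum>v<D. \<rho> $$ (u,v) * ?r u v)"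
        unfolding sum_distrib_left by (rule sum_swap4)
      finally show "(\<Sum>u<D. \<Sum>v<D. \<rho> $$ (u,v) * (?l u v - ?r u v)) = 0"
        by (simp add: right_diff_distrib sum_subtractf)
    qed
    then show ?thesis by simp
  qed
  show ?thesis
  proof (rule eq_matI)
    fix j k assume "j < dim_row (choi_of S)" "k < dim_col (choi_of S)"
    then have jk: "j < P" "k < P" by (simp_all add: choi_of_def)
    note J = ref_index(1)[OF jk(1)] out_index(1)[OF jk(1)] and K = ref_index(1)[OF jk(2)] out_index(1)[OF jk(2)]
    let ?c = "complex_of_real (1 / real D)"
    define F where "F r a r' a' = (cnj (U $$ (ref_index j, r)) * V $$ (out_index j, a)) * (?c * S r r' a a') *
        (U $$ (ref_index k, r') * cnj (V $$ (out_index k, a')))" for r a r' a'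
    have "(conj_tensor U V * choi_of S * adj (conj_tensor U V)) $$ (j,k) = (\<Sum>j'<P. \<Sum>k'<P. F (ref_index j') (out_index j') (ref_index k') (out_index k'))"
      unfolding index_conj_tensor_choi[OF jk choi_of_carrier] F_def by (intro sum.cong refl) (simp add: choi_of_def)
    also have "\<dots> = (\<Sum>r<D. \<Sum>a<E. \<Sum>r'<D. \<Sum>a'<E. F r a r' a')"
      unfolding sum_grouped by (rule sum_grouped[where F = "\<lambda>r a. \<Sum>r'<D. \<Sum>a'<E. F r a r' a'"])
    also have "\<dots> = (\<Sum>r<D. \<Sum>r'<D. \<Sum>a<E. \<Sum>a'<E. F r a r' a')"
      by (rule sum.cong[OF refl], rule sum.swap)
    also have "\<dots> = (\<Sum>r<D. \<Sum>r'<D. ?c * (cnj (U $$ (ref_index j, r)) * U $$ (ref_index k, r')) *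
        (\<Sum>a<E. \<Sum>a'<E. V $$ (out_index j, a) * S r r' a a' * cnj (V $$ (out_index k, a'))))"
      unfolding sum_distrib_left F_def by (intro sum.cong refl) (simp only: mult_ac)
    also have "\<dots> = (\<Sum>r<D. \<Sum>r'<D. ?c * (cnj (U $$ (ref_index j, r)) * U $$ (ref_index k, r')) *
        (\<Sum>x<D. \<Sum>y<D. U $$ (x,r) * cnj (U $$ (y,r')) * S x y (out_index j) (out_index k)))"
      by (intro sum.cong refl) (use kov J K in auto)
    \<comment> \<open>Regrouping brings the U produced by covariance next to the conj(U) acting on
      the reference, so that the orthonormality of rows contracts each pair.\<close>
    also have "\<dots> = (\<Sum>x<D. \<Sum>y<D. \<Sum>r<D. \<Sum>r'<D. ?c * S x y (out_index j) (out_index k) *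
        ((U $$ (x,r) * cnj (U $$ (ref_index j, r))) * (U $$ (ref_index k, r') * cnj (U $$ (y,r')))))"
      unfolding sum_distrib_left by (subst sum_swap4) (simp only: mult_ac)
    also have "\<dots> = (\<Sum>x<D. \<Sum>y<D. ?c * S x y (out_index j) (out_index k) *
        ((\<Sum>r<D. U $$ (x,r) * cnj (U $$ (ref_index j, r))) * (\<Sum>r'<D. U $$ (ref_index k, r') * cnj (U $$ (y,r')))))"
      by (intro sum.cong refl, subst sum_product) (simp only: sum_distrib_left)
    also have "\<dots> = (\<Sum>x<D. \<Sum>y<D. (if x = ref_index j \<and> y = ref_index k then 1 else 0) * (?c * S x y (out_index j) (out_index k)))"
      by (intro sum.cong refl) (use unitary_orthonormal_rows[OF U] J K in auto)
    also have "\<dots> = ?c * S (ref_index j) (ref_index k) (out_index j) (out_index k)"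
      unfolding sum_delta2[OF J(1) K(1)] by (rule mult_1)
    finally show "(conj_tensor U V * choi_of S * adj (conj_tensor U V)) $$ (j,k) = choi_of S $$ (j,k)"
      using jk by (simp add: choi_of_def)
  qed (auto simp: conj_tensor_def choi_of_def)
qed

end

section \<open>Covariant channels\<close>


context grouping
begin

text \<open>The input is written as \<open>\<Sum>k. |C\<^sub>k\<rangle>\<langle>C\<^sub>k|\<close> with \<open>C\<^sub>k\<close> a map from the reference of the maximally
  entangled state; the operators \<open>(C\<^sub>k \<otimes> 1) (conj(U\<^sub>g) \<otimes> V\<^sub>g)\<close> form, up to normalisation, a channel taking
  the Choi state of any covariant channel to its output. The one-design property makes it trace preserving.\<close>
theorem rel_ent_covariant_le:
  assumes T: "channel_kernel D E T S" and M: "channel_kernel D E M S'"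
    and psd: "psd_mat P (choi_of S)" "psd_mat P (choi_of S')"
    and fin: "finite \<G>" "\<G> \<noteq> {}"
    and V: "\<And>g. g \<in> \<G> \<Longrightarrow> unitary_mat E (V g)"
    and design: "\<And>a b c d. a < D \<Longrightarrow> b < D \<Longrightarrow> c < D \<Longrightarrow> d < D \<Longrightarrow>
       (\<Sum>g\<in>\<G>. U g $$ (a,b) * cnj (U g $$ (c,d))) = (if a = c \<and> b = d then of_nat (card \<G>) / of_nat D else 0)"
    and inv: "\<And>g. g \<in> \<G> \<Longrightarrow> conj_tensor (U g) (V g) * choi_of S * adj (conj_tensor (U g) (V g)) = choi_of S"
      "\<And>g. g \<in> \<G> \<Longrightarrow> conj_tensor (U g) (V g) * choi_of S' * adj (conj_tensor (U g) (V g)) = choi_of S'"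
    and \<rho>: "is_state (r * D) \<rho>"
  shows "rel_ent (id_tensor r D E T \<rho>) (id_tensor r D E M \<rho>) \<le> rel_ent (choi_of S) (choi_of S')"
proof -
  have \<rho>p: "psd_mat (r * D) \<rho>" and \<rho>1: "mtrace \<rho> = 1" using \<rho> by (auto simp: is_state_def)
  obtain u where u: "\<And>i j. i < r * D \<Longrightarrow> j < r * D \<Longrightarrow> \<rho> $$ (i,j) = (\<Sum>k<r * D. u k i * cnj (u k j))"
    using psd_mat_gram[OF \<rho>p] by metis
  \<comment> \<open>The square of this constant is D / card \<G>. It cancels the factor card \<G> /
    D of the design relation in trace preservation, and in the output it cancels the number of group
    elements against the 1/D of the Choi state.\<close>
  define c where "c = complex_of_real (sqrt (real D / real (card \<G>)))"
  have cc: "c * cnj c = of_nat D / of_nat (card \<G>)" "cnj c = c"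
    unfolding c_def of_real_mult[symmetric] complex_cnj_complex_of_real by simp_all
  have nz: "(of_nat D :: complex) \<noteq> 0" "(of_nat (card \<G>) :: complex) \<noteq> 0" using D_pos fin by (auto simp del: prod_list_zero_iff)
  \<comment> \<open>The entry of C_k conj(U_g) in row \<open>s\<close> and column
    \<open>ref_index j\<close>; C_k is the Gram vector \<open>u k\<close> of the input reshaped into
    an r by D matrix.\<close>
  define X where "X g k s j = (\<Sum>x<D. u k (s * D + x) * cnj (U g $$ (x, ref_index j)))" for g k s j
  define L where "L p = mat (r * E) P (\<lambda>(t,j). c * X (fst p) (snd p) (t div E) j * V (fst p) $$ (t mod E, out_index j))" for p
  have L: "L p \<in> carrier_mat (r * E) P" for p by (simp add: L_def)
  let ?I = "\<G> \<times> {..<r * D}"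
  have tE: "t div E < r" "t mod E < E" if "t < r * E" for t
    using that E_pos by (auto simp: less_mult_imp_div_less)
  \<comment> \<open>Unitarity of \<open>V g\<close> removes the output indices, the design relation
    forces equal reference indices, and what is left is the trace of the input state.\<close>
  have one: "mat_sum P ?I (\<lambda>p. adj (L p) * L p) = 1\<^sub>m P"
  proof (rule eq_matI)
    fix j j' assume "j < dim_row (1\<^sub>m P)" "j' < dim_col (1\<^sub>m P)"
    then have jj: "j < P" "j' < P" by auto
    note R = ref_index(1)[OF jj(1)] ref_index(1)[OF jj(2)] and A = out_index(1)[OF jj(1)] out_index(1)[OF jj(2)]
    have "mat_sum P ?I (\<lambda>p. adj (L p) * L p) $$ (j,j') =
       (\<Sum>g\<in>\<G>. \<Sum>k<r * D. \<Sum>t<r * E. (c * cnj c * (cnj (X g k (t div E) j) * X g k (t div E) j')) *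
          (cnj (V g $$ (t mod E, out_index j)) * V g $$ (t mod E, out_index j')))"
      unfolding index_mat_sum[OF jj] sum.cartesian_product' index_mult_sum[OF adj_carrier[OF L] L jj]
      using jj by (intro sum.cong refl) (simp add: L_def mult_ac)
    also have "\<dots> = (\<Sum>g\<in>\<G>. \<Sum>k<r * D. (\<Sum>s<r. c * cnj c * (cnj (X g k s j) * X g k s j')) *
          (\<Sum>b<E. cnj (V g $$ (b, out_index j)) * V g $$ (b, out_index j')))"
    proof (rule sum.cong[OF refl], rule sum.cong[OF refl])
      fix g k
      show "(\<Sum>t<r * E. (c * cnj c * (cnj (X g k (t div E) j) * X g k (t div E) j')) *
          (cnj (V g $$ (t mod E, out_index j)) * V g $$ (t mod E, out_index j')))
         = (\<Sum>s<r. c * cnj c * (cnj (X g k s j) * X g k s j')) * (\<Sum>b<E. cnj (V g $$ (b, out_index j)) * V g $$ (b, out_index j'))"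
        unfolding sum_product
        by (rule sum_div_mod[where h = "\<lambda>s b. (c * cnj c * (cnj (X g k s j) * X g k s j')) * (cnj (V g $$ (b, out_index j)) * V g $$ (b, out_index j'))"])
    qed
    also have "\<dots> = (\<Sum>g\<in>\<G>. \<Sum>k<r * D. (\<Sum>s<r. c * cnj c * (cnj (X g k s j) * X g k s j')) * (if out_index j = out_index j' then 1 else 0))"
      by (rule sum.cong[OF refl], rule sum.cong[OF refl]) (simp only: unitary_orthonormal_cols[OF V A])
    also have "\<dots> = (if out_index j = out_index j' then 1 else 0) * (\<Sum>g\<in>\<G>. \<Sum>k<r * D. \<Sum>s<r. c * cnj c * (cnj (X g k s j) * X g k s j'))"
      by simp
    also have "(\<Sum>g\<in>\<G>. \<Sum>k<r * D. \<Sum>s<r. c * cnj c * (cnj (X g k s j) * X g k s j'))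
       = (\<Sum>g\<in>\<G>. \<Sum>k<r * D. \<Sum>s<r. \<Sum>x<D. \<Sum>y<D. c * cnj c * (cnj (u k (s * D + x)) * u k (s * D + y)) *
           (U g $$ (x, ref_index j) * cnj (U g $$ (y, ref_index j'))))"
      unfolding X_def by (intro sum.cong refl) (simp add: sum_product sum_distrib_left mult_ac)
    also have "\<dots> = (\<Sum>k<r * D. \<Sum>s<r. \<Sum>x<D. \<Sum>y<D. \<Sum>g\<in>\<G>. c * cnj c * (cnj (u k (s * D + x)) * u k (s * D + y)) *
           (U g $$ (x, ref_index j) * cnj (U g $$ (y, ref_index j'))))"
      by (subst sum.swap, rule sum.cong[OF refl], subst sum.swap, rule sum.cong[OF refl], subst sum.swap, rule sum.cong[OF refl], rule sum.swap)
    also have "\<dots> = (\<Sum>k<r * D. \<Sum>s<r. \<Sum>x<D. \<Sum>y<D. if y = x then (if ref_index j = ref_index j' then cnj (u k (s * D + x)) * u k (s * D + y) else 0) else 0)"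
      unfolding sum_distrib_left[symmetric] by (intro sum.cong refl) (use nz design R cc in auto)
    also have "\<dots> = (if ref_index j = ref_index j' then 1 else 0) * (\<Sum>k<r * D. \<Sum>s<r. \<Sum>x<D. cnj (u k (s * D + x)) * u k (s * D + x))"
      by simp
    also have "(\<Sum>k<r * D. \<Sum>s<r. \<Sum>x<D. cnj (u k (s * D + x)) * u k (s * D + x)) = (\<Sum>k<r * D. \<Sum>t<r * D. cnj (u k t) * u k t)"
      by (simp only: sum_split_mult[where H = "\<lambda>t. cnj (u _ t) * u _ t"])
    also have "\<dots> = mtrace \<rho>"
      by (subst sum.swap) (use psd_matD(1)[OF \<rho>p] in \<open>simp add: mtrace_def u mult.commute\<close>)
    finally show "mat_sum P ?I (\<lambda>p. adj (L p) * L p) $$ (j,j') = 1\<^sub>m P $$ (j,j')"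
      using jj \<rho>1 index_eq_iff[OF jj] by auto
  qed auto
  \<comment> \<open>Stated for arbitrary \<open>T\<close> and \<open>S\<close>, since the operators
    \<open>L p\<close> depend only on the input and the group and must serve both channels at
    once.\<close>
  have out: "mat_sum (r * E) ?I (\<lambda>p. L p * choi_of S * adj (L p)) = id_tensor r D E T \<rho>"
    if T: "channel_kernel D E T S" and inv: "\<And>g. g \<in> \<G> \<Longrightarrow> conj_tensor (U g) (V g) * choi_of S * adj (conj_tensor (U g) (V g)) = choi_of S"
    for T S
  proof (rule eq_matI)
    fix t t' assume "t < dim_row (id_tensor r D E T \<rho>)" "t' < dim_col (id_tensor r D E T \<rho>)"
    then have tt: "t < r * E" "t' < r * E" by (auto simp: id_tensor_def)
    define s s' b b' where "s = t div E" and "s' = t' div E" and "b = t mod E" and "b' = t' mod E"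
    have sb: "s < r" "s' < r" "b < E" "b' < E" using tE tt by (auto simp: s_def s'_def b_def b'_def)
    \<comment> \<open>The invariance of the Choi state, read at the grouped indices joined from
      (x,b) and (y,b'). It undoes the rotation separately for every group element, so the sum over
      \<G> is constant.\<close>
    have br: "(\<Sum>j<P. \<Sum>j'<P. (cnj (U g $$ (x, ref_index j)) * V g $$ (b, out_index j)) * choi_of S $$ (j,j') *
        (U g $$ (y, ref_index j') * cnj (V g $$ (b', out_index j')))) = 1 / of_nat D * S x y b b'"
      if g: "g \<in> \<G>" and xy: "x < D" "y < D" for g x y
    proof -
      note jx = join_index(1)[OF xy(1) sb(3)] and jy = join_index(1)[OF xy(2) sb(4)]
      have "choi_of S $$ (join_index x b, join_index y b') = 1 / of_nat D * S x y b b'"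
        using jx jy xy sb by (simp add: choi_of_def)
      then show ?thesis
        using index_conj_tensor_choi[OF jx jy choi_of_carrier, of "U g" "V g" S] xy sb unfolding inv[OF g] by simp
    qed
    have "mat_sum (r * E) ?I (\<lambda>p. L p * choi_of S * adj (L p)) $$ (t,t') =
       (\<Sum>g\<in>\<G>. \<Sum>k<r * D. \<Sum>j<P. \<Sum>j'<P. (c * X g k s j * V g $$ (b, out_index j)) * choi_of S $$ (j,j') * cnj (c * X g k s' j' * V g $$ (b', out_index j')))"
      unfolding index_mat_sum[OF tt] sum.cartesian_product' index_conj_sum[OF L choi_of_carrier tt]
      using tt by (intro sum.cong refl) (simp add: L_def s_def s'_def b_def b'_def)
    also have "\<dots> = (\<Sum>g\<in>\<G>. \<Sum>k<r * D. \<Sum>j<P. \<Sum>j'<P. \<Sum>x<D. \<Sum>y<D. (c * cnj c * (u k (s * D + x) * cnj (u k (s' * D + y)))) *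
        ((cnj (U g $$ (x, ref_index j)) * V g $$ (b, out_index j)) * choi_of S $$ (j,j') * (U g $$ (y, ref_index j') * cnj (V g $$ (b', out_index j')))))"
    proof (intro sum.cong refl)
      fix g k j j'
      have "(c * X g k s j * V g $$ (b, out_index j)) * choi_of S $$ (j,j') * cnj (c * X g k s' j' * V g $$ (b', out_index j'))
        = (X g k s j * cnj (X g k s' j')) * (c * cnj c * (V g $$ (b, out_index j) * choi_of S $$ (j,j') * cnj (V g $$ (b', out_index j'))))"
        by simp
      also have "X g k s j * cnj (X g k s' j') = (\<Sum>x<D. \<Sum>y<D. (u k (s * D + x) * cnj (U g $$ (x, ref_index j))) * (cnj (u k (s' * D + y)) * U g $$ (y, ref_index j')))"
        unfolding X_def by (simp add: sum_product)
      finally show "(c * X g k s j * V g $$ (b, out_index j)) * choi_of S $$ (j,j') * cnj (c * X g k s' j' * V g $$ (b', out_index j'))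
        = (\<Sum>x<D. \<Sum>y<D. (c * cnj c * (u k (s * D + x) * cnj (u k (s' * D + y)))) *
        ((cnj (U g $$ (x, ref_index j)) * V g $$ (b, out_index j)) * choi_of S $$ (j,j') * (U g $$ (y, ref_index j') * cnj (V g $$ (b', out_index j')))))"
        by (simp only: sum_distrib_right sum_distrib_left mult_ac)
    qed
    also have "\<dots> = (\<Sum>g\<in>\<G>. \<Sum>k<r * D. \<Sum>x<D. \<Sum>y<D. (c * cnj c * (u k (s * D + x) * cnj (u k (s' * D + y)))) * (1 / of_nat D * S x y b b'))"
    proof (rule sum.cong[OF refl], rule sum.cong[OF refl], subst sum_swap4, rule sum.cong[OF refl], rule sum.cong[OF refl])
      fix g k x y assume "g \<in> \<G>" "x \<in> {..<D}" "y \<in> {..<D}"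
      then show "(\<Sum>j<P. \<Sum>j'<P. (c * cnj c * (u k (s * D + x) * cnj (u k (s' * D + y)))) *
        ((cnj (U g $$ (x, ref_index j)) * V g $$ (b, out_index j)) * choi_of S $$ (j,j') * (U g $$ (y, ref_index j') * cnj (V g $$ (b', out_index j')))))
        = (c * cnj c * (u k (s * D + x) * cnj (u k (s' * D + y)))) * (1 / of_nat D * S x y b b')"
        unfolding sum_distrib_left[symmetric] using br by simp
    qed
    also have "\<dots> = (\<Sum>k<r * D. \<Sum>x<D. \<Sum>y<D. u k (s * D + x) * cnj (u k (s' * D + y)) * S x y b b')"
    proof -
      have "of_nat (card \<G>) * ((c * cnj c * z) * (1 / of_nat D * w)) = z * w" for z w
        using nz unfolding cc(1) by (simp del: prod_list_zero_iff)
      then have "(\<Sum>k<r * D. \<Sum>x<D. \<Sum>y<D. u k (s * D + x) * cnj (u k (s' * D + y)) * S x y b b')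
        = (\<Sum>k<r * D. \<Sum>x<D. \<Sum>y<D. of_nat (card \<G>) * ((c * cnj c * (u k (s * D + x) * cnj (u k (s' * D + y)))) * (1 / of_nat D * S x y b b')))"
        by simp
      then show ?thesis by (simp only: sum_constant sum_distrib_left)
    qed
    also have "\<dots> = (\<Sum>x<D. \<Sum>y<D. (\<Sum>k<r * D. u k (s * D + x) * cnj (u k (s' * D + y))) * S x y b b')"
      unfolding sum_distrib_right by (rule sum_rotate[symmetric])
    also have "\<dots> = id_tensor r D E T \<rho> $$ (t,t')"
      unfolding index_id_tensor[OF T tt] s_def[symmetric] s'_def[symmetric] b_def[symmetric] b'_def[symmetric]
      using u mult_add_less sb by (intro sum.cong refl) simp
    finally show "mat_sum (r * E) ?I (\<lambda>p. L p * choi_of S * adj (L p)) $$ (t,t') = id_tensor r D E T \<rho> $$ (t,t')" .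
  qed (auto simp: id_tensor_def)
  have "mat_sum (r * E) ?I (\<lambda>p. L p * choi_of S * adj (L p)) = id_tensor r D E T \<rho>"
    "mat_sum (r * E) ?I (\<lambda>p. L p * choi_of S' * adj (L p)) = id_tensor r D E M \<rho>"
    by (rule out[OF T inv(1)], assumption) (rule out[OF M inv(2)])
  then show ?thesis
    using rel_ent_kraus_mono[OF psd, of ?I L "r * E", OF L one] by simp
qed

text \<open>Tracing out the output of the i-th marginal leaves the state of the reference R_i, which
  is maximally mixed because \<open>T\<close> preserves the trace. This is the condition under which
  the marginal is the Choi state of a local channel.\<close>

lemma sum_ptrace_choi:
  assumes i: "i < n" and xy: "x < dI ! i" "y < dI ! i"
    and tp: "\<And>r r'. r < D \<Longrightarrow> r' < D \<Longrightarrow> (\<Sum>a<E. S r r' a a) = (if r = r' then 1 else 0)"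
  shows "(\<Sum>a<dO ! i. ptrace_keep gd i (choi_of S) $$ (x * dO ! i + a, y * dO ! i + a)) = (if x = y then 1 / of_nat (dI ! i) else 0)"
proof -
  let ?e = "dO ! i"
  let ?w = "\<lambda>j k. \<Prod>m<n. ptrace_weight i x y m (mr_digits dI j ! m) (mr_digits dI k ! m)"
  have lt: "z * ?e + a < gd ! i" if "z < dI ! i" "a < ?e" for z a
    unfolding gd_nth[OF i] by (rule mult_add_less[OF that])
  \<comment> \<open>Every digit splits into a reference and an output part. Summing over
    \<open>a\<close> closes the output trace at position \<open>i\<close>, where the partial trace
    had left it open, so the weight becomes a partial trace over references times a full trace over
    outputs.\<close>
  have w: "(\<Sum>a<?e. \<Prod>m<n. ptrace_weight i (x * ?e + a) (y * ?e + a) m (mr_digits gd j ! m) (mr_digits gd k ! m))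
     = ?w (ref_index j) (ref_index k) * (if out_index j = out_index k then 1 else 0)" if jk: "j < P" "k < P" for j k
  proof -
    let ?J = "\<lambda>m. mr_digits gd j ! m" and ?K = "\<lambda>m. mr_digits gd k ! m"
    have e: "u = z * ?e + a \<longleftrightarrow> u div ?e = z \<and> u mod ?e = a" if "a < ?e" for u z a
    proof -
      have "(z * ?e + a) div ?e = z" by (rule mult_add_div[OF that])
      then show ?thesis using that by (metis div_mult_mod_eq mod_less mod_mult_self3)
    qed
    have dm: "?J m = ?K m \<longleftrightarrow> ?J m div dO ! m = ?K m div dO ! m \<and> ?J m mod dO ! m = ?K m mod dO ! m" for m
      by (metis div_mult_mod_eq)
    have "(\<Sum>a<?e. \<Prod>m<n. ptrace_weight i (x * ?e + a) (y * ?e + a) m (?J m) (?K m))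
      = (\<Sum>a<?e. if a = ?J i mod ?e then (if ?K i mod ?e = ?J i mod ?e \<and> ?J i div ?e = x \<and> ?K i div ?e = y then (\<Prod>m\<in>{..<n} - {i}. if ?J m = ?K m then 1 else 0) else 0) else 0)"
      unfolding ptrace_weight_remove[OF i] by (intro sum.cong refl) (auto simp: e)
    also have "\<dots> = (if ?K i mod ?e = ?J i mod ?e \<and> ?J i div ?e = x \<and> ?K i div ?e = y then (\<Prod>m\<in>{..<n} - {i}. if ?J m = ?K m then 1 else 0) else 0)"
      using pos(2)[OF i] by simp
    also have "\<dots> = (\<Prod>m<n. ptrace_weight i x y m (?J m div dO ! m) (?K m div dO ! m)) * (\<Prod>m<n. if ?J m mod dO ! m = ?K m mod dO ! m then 1 else 0)"
      unfolding ptrace_weight_remove[OF i] using i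
      by (subst prod.remove[of "{..<n}" i "\<lambda>m. if ?J m mod dO ! m = ?K m mod dO ! m then 1 else 0"])
        (auto simp: prod_indicator dm)
    also have "(\<Prod>m<n. ptrace_weight i x y m (?J m div dO ! m) (?K m div dO ! m)) = ?w (ref_index j) (ref_index k)"
      by (intro prod.cong refl) (simp add: ref_index jk)
    also have "(\<Prod>m<n. if ?J m mod dO ! m = ?K m mod dO ! m then 1 else 0)
       = (\<Prod>m<length dO. if mr_digits dO (out_index j) ! m = mr_digits dO (out_index k) ! m then 1 else 0 :: complex)"
      unfolding len by (intro prod.cong refl) (simp add: out_index jk)
    also have "\<dots> = (if out_index j = out_index k then 1 else 0)"
      by (rule prod_indicator_mr_digits) (simp_all add: out_index jk)
    finally show ?thesis .
  qed
  have "(\<Sum>a<?e. ptrace_keep gd i (choi_of S) $$ (x * ?e + a, y * ?e + a))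
     = (\<Sum>a<?e. \<Sum>j<P. \<Sum>k<P. (\<Prod>m<n. ptrace_weight i (x * ?e + a) (y * ?e + a) m (mr_digits gd j ! m) (mr_digits gd k ! m)) * choi_of S $$ (j,k))"
    using i lt xy by (simp add: index_ptrace_keep)
  also have "\<dots> = (\<Sum>j<P. \<Sum>k<P. (\<Sum>a<?e. \<Prod>m<n. ptrace_weight i (x * ?e + a) (y * ?e + a) m (mr_digits gd j ! m) (mr_digits gd k ! m)) * choi_of S $$ (j,k))"
    unfolding sum_distrib_right by (rule sum_rotate[symmetric])
  also have "\<dots> = (\<Sum>j<P. \<Sum>k<P. ?w (ref_index j) (ref_index k) * (if out_index j = out_index k then 1 else 0) *
      (1 / of_nat D * S (ref_index j) (ref_index k) (out_index j) (out_index k)))"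
    by (intro sum.cong refl) (simp add: w choi_of_def)
  also have "\<dots> = (\<Sum>r<D. \<Sum>a<E. \<Sum>r'<D. \<Sum>a'<E. ?w r r' * (if a = a' then 1 else 0) * (1 / of_nat D * S r r' a a'))"
    unfolding sum_grouped[where F = "\<lambda>r' a'. ?w (ref_index _) r' * (if out_index _ = a' then 1 else 0) * (1 / of_nat D * S (ref_index _) r' (out_index _) a')"]
    by (rule sum_grouped[where F = "\<lambda>r a. \<Sum>r'<D. \<Sum>a'<E. ?w r r' * (if a = a' then 1 else 0) * (1 / of_nat D * S r r' a a')"])
  also have "\<dots> = (\<Sum>r<D. \<Sum>a<E. \<Sum>r'<D. ?w r r' * (1 / of_nat D * S r r' a a))"
  proof (intro sum.cong refl)
    fix r a r' assume "a \<in> {..<E}"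
    have "(\<Sum>a'<E. ?w r r' * (if a = a' then 1 else 0) * (1 / of_nat D * S r r' a a')) = (\<Sum>a'<E. if a = a' then ?w r r' * (1 / of_nat D * S r r' a a') else 0)"
      by (intro sum.cong refl) simp
    then show "(\<Sum>a'<E. ?w r r' * (if a = a' then 1 else 0) * (1 / of_nat D * S r r' a a')) = ?w r r' * (1 / of_nat D * S r r' a a)"
      using \<open>a \<in> {..<E}\<close> by simp
  qed
  also have "\<dots> = (\<Sum>r<D. \<Sum>r'<D. ?w r r' * (1 / of_nat D * (\<Sum>a<E. S r r' a a)))"
    unfolding sum_distrib_left by (rule sum.cong[OF refl], rule sum.swap)
  \<comment> \<open>Trace preservation identifies the two reference indices. What remains factorises
    over positions: a delta at \<open>i\<close>, and the dimension at every other position.\<close>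
  also have "\<dots> = (\<Sum>r<D. \<Sum>r'<D. if r = r' then ?w r r' * (1 / of_nat D) else 0)"
    by (intro sum.cong refl) (simp add: tp)
  also have "\<dots> = (\<Sum>r<D. ?w r r) * (1 / of_nat D)"
    by (simp add: sum_distrib_right sum_divide_distrib)
  also have "(\<Sum>r<D. ?w r r) = (\<Prod>m<n. \<Sum>a<dI ! m. ptrace_weight i x y m a a)"
    by (rule sum_prod_mr_digits[where f = "\<lambda>m a. ptrace_weight i x y m a a"])
  also have "\<dots> = (\<Sum>a<dI ! i. ptrace_weight i x y i a a) * (\<Prod>m\<in>{..<n} - {i}. \<Sum>a<dI ! m. ptrace_weight i x y m a a)"
    using i by (subst prod.remove[of _ i]) auto
  also have "(\<Sum>a<dI ! i. ptrace_weight i x y i a a) = (if x = y then 1 else 0)"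
  proof -
    have "(\<Sum>a<dI ! i. ptrace_weight i x y i a a) = (\<Sum>a<dI ! i. if a = x then (if x = y then 1 else 0) else 0)"
      by (intro sum.cong refl) (auto simp: ptrace_weight_def)
    then show ?thesis using xy by simp
  qed
  also have "(\<Prod>m\<in>{..<n} - {i}. \<Sum>a<dI ! m. ptrace_weight i x y m a a) = (\<Prod>m\<in>{..<n} - {i}. of_nat (dI ! m))"
    by (intro prod.cong refl) (simp add: ptrace_weight_def)
  also have "(if x = y then 1 else 0) * (\<Prod>m\<in>{..<n} - {i}. of_nat (dI ! m)) * (1 / of_nat D) = (if x = y then 1 / of_nat (dI ! i) else (0::complex))"
  proof -
    have "D = dI ! i * (\<Prod>m\<in>{..<n} - {i}. dI ! m)" unfolding prod_list_nth using i by (subst prod.remove[of _ i]) auto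
    then have "(of_nat D :: complex) = of_nat (dI ! i) * (\<Prod>m\<in>{..<n} - {i}. of_nat (dI ! m))" by (metis of_nat_mult of_nat_prod)
    moreover define Q :: complex where "Q = (\<Prod>m\<in>{..<n} - {i}. of_nat (dI ! m))"
    ultimately have e: "(of_nat D :: complex) = of_nat (dI ! i) * Q" by simp
    have "(of_nat D :: complex) \<noteq> 0" using D_pos by (simp del: prod_list_zero_iff)
    then have "Q \<noteq> 0" unfolding e by simp
    then show ?thesis unfolding Q_def[symmetric] e by simp
  qed
  finally show ?thesis .
qed

end


section \<open>Products of Choi states and the lower bound\<close>

lemma psd_tensor_upto:
  assumes \<omega>: "\<And>i. i < length ds \<Longrightarrow> psd_mat (ds ! i) (\<omega> i)"
  shows "psd_mat (prod_list ds) (tensor_upto (length ds) \<omega>)"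
proof -
  have "\<exists>W q. spec_decomp (\<omega> i) W q \<and> (\<forall>a<ds ! i. 0 \<le> q a)" if "i < length ds" for i
    using psd_spec_decomp[OF \<omega>[OF that]] by blast
  then obtain W q where s: "\<And>i. i < length ds \<Longrightarrow> spec_decomp (\<omega> i) (W i) (q i)"
    and q: "\<And>i a. i < length ds \<Longrightarrow> a < ds ! i \<Longrightarrow> 0 \<le> q i a" by metis
  have c: "\<omega> i \<in> carrier_mat (ds ! i) (ds ! i)" if "i < length ds" for i by (rule psd_matD(1)[OF \<omega>[OF that]])
  show ?thesis
    by (rule psd_mat_spec_decompI[OF tensor_upto_carrier(1)[OF c refl] spec_decomp_tensor_upto[OF c s]])
      (use q mr_digits_less in \<open>auto intro!: prod_nonneg\<close>)
qed

context grouping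
begin

text \<open>The local dimensions multiply to D and cancel the normalisation of
  \<open>choi_of\<close>.\<close>

lemma choi_of_product:
  assumes S: "\<And>x y a b. S x y a b = (\<Prod>i<n. of_nat (dI ! i) *
      \<omega> i $$ (mr_digits dI x ! i * dO ! i + mr_digits dO a ! i, mr_digits dI y ! i * dO ! i + mr_digits dO b ! i))"
    and \<omega>: "\<And>i. i < n \<Longrightarrow> \<omega> i \<in> carrier_mat (gd ! i) (gd ! i)"
  shows "choi_of S = tensor_upto n \<omega>"
proof -
  have \<omega>': "\<omega> i \<in> carrier_mat (gd ! i) (gd ! i)" if "i < length gd" for i using \<omega> that by simp
  note c = tensor_upto_carrier(1)[where rs = gd and cs = gd, OF \<omega>' refl, unfolded length_gd]
  show ?thesis
  proof (rule eq_matI)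
    fix j k assume "j < dim_row (tensor_upto n \<omega>)" "k < dim_col (tensor_upto n \<omega>)"
    then have jk: "j < P" "k < P" using c by auto
    have d: "mr_digits dI (ref_index j) ! i * dO ! i + mr_digits dO (out_index j) ! i = mr_digits gd j ! i" if "j < P" "i < n" for j i
      unfolding ref_index(2)[OF that] out_index(2)[OF that] by (rule div_mult_mod_eq)
    have "choi_of S $$ (j,k) = 1 / of_nat D * (\<Prod>i<n. of_nat (dI ! i) * \<omega> i $$ (mr_digits gd j ! i, mr_digits gd k ! i))"
      using jk by (simp add: choi_of_def S d)
    also have "\<dots> = (\<Prod>i<n. \<omega> i $$ (mr_digits gd j ! i, mr_digits gd k ! i))"
    proof -
      have e: "(\<Prod>i<n. of_nat (dI ! i)) = (of_nat D :: complex)" by (simp add: prod_list_nth)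
      have "(of_nat D :: complex) \<noteq> 0" using D_pos by (simp del: prod_list_zero_iff)
      then show ?thesis unfolding prod.distrib e by simp
    qed
    also have "\<dots> = tensor_upto n \<omega> $$ (j,k)"
      using index_tensor_upto[where rs = gd and cs = gd, OF \<omega>' refl jk] by simp
    finally show "choi_of S $$ (j,k) = tensor_upto n \<omega> $$ (j,k)" .
  qed (use c in \<open>auto simp: choi_of_def\<close>)
qed

lemma state_mi_choi: "state_mi gd \<chi> = rel_ent \<chi> (tensor_upto n (\<lambda>i. ptrace_keep gd i \<chi>))"
  by (simp add: state_mi_def)

lemma mtrace_choi_of:
  assumes "\<And>r r'. r < D \<Longrightarrow> r' < D \<Longrightarrow> (\<Sum>a<E. S r r' a a) = (if r = r' then 1 else 0)"
  shows "mtrace (choi_of S) = 1"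
proof -
  have "mtrace (choi_of S) = (\<Sum>j<P. 1 / of_nat D * S (ref_index j) (ref_index j) (out_index j) (out_index j))"
    by (simp add: mtrace_def choi_of_def)
  also have "\<dots> = (\<Sum>r<D. 1 / of_nat D * (\<Sum>a<E. S r r a a))"
    unfolding sum_grouped[where F = "\<lambda>r a. 1 / of_nat D * S r r a a"] sum_distrib_left ..
  also have "\<dots> = 1" using D_pos by (simp add: assms del: prod_list_zero_iff)
  finally show ?thesis .
qed

lemma kraus_trace:
  assumes "\<And>x y. x < d \<Longrightarrow> y < d \<Longrightarrow> (\<Sum>k<m. \<Sum>a<e. cnj (K k $$ (a,x)) * K k $$ (a,y)) = (if x = y then 1 else 0)"
    and "x < d" "y < d"
  shows "(\<Sum>a<e. \<Sum>k<m. K k $$ (a,x) * cnj (K k $$ (a,y))) = (if x = y then 1 else (0 :: complex))"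
  using assms(1)[OF assms(3,2)] by (subst sum.swap) (auto simp: mult.commute)

text \<open>Testing on the maximally entangled input compares the Choi states, and the Choi state of a
  product channel is a product.\<close>
theorem state_mi_choi_le_chan_mi:
  assumes T: "is_channel D E T"
  shows "state_mi gd (choi_state dI dO T) \<le> chan_mi dI dO T"
  unfolding chan_mi_def
proof (rule INF_greatest)
  fix M assume "M \<in> {M. \<forall>i<length dI. is_channel (dI ! i) (dO ! i) (M i)}"
  then have M: "\<And>i. i < n \<Longrightarrow> is_channel (dI ! i) (dO ! i) (M i)" by blast
  obtain m :: nat and K where TS: "channel_kernel D E T (\<lambda>x y a b. \<Sum>k<m. K k $$ (a,x) * cnj (K k $$ (b,y)))"
    and K1: "\<And>x y. x < D \<Longrightarrow> y < D \<Longrightarrow> (\<Sum>k<m. \<Sum>a<E. cnj (K k $$ (a,x)) * K k $$ (a,y)) = (if x = y then 1 else 0)"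
    by (rule is_channel_kernel[OF T], rule that)
  define S where "S x y a b = (\<Sum>k<m. K k $$ (a,x) * cnj (K k $$ (b,y)))" for x y a b
  have TS: "channel_kernel D E T S" using TS unfolding S_def .
  have \<chi>: "psd_mat P (choi_of S)" unfolding S_def by (rule psd_choi_of_kraus)
  have tr\<chi>: "mtrace (choi_of S) = 1"
    unfolding S_def by (rule mtrace_choi_of) (rule kraus_trace[OF K1])
  \<comment> \<open>The Choi state of the local channel \<open>M i\<close>; it is positive with
    trace 1, as the optimality of marginals requires.\<close>
  define \<omega> where "\<omega> i = mat (gd ! i) (gd ! i) (\<lambda>(p,q). 1 / of_nat (dI ! i) *
     M i (ket_bra (dI ! i) (p div dO ! i) (q div dO ! i)) $$ (p mod dO ! i, q mod dO ! i))" for i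
  have \<omega>c: "\<omega> i \<in> carrier_mat (gd ! i) (gd ! i)" for i by (simp add: \<omega>_def)
  have \<omega>: "psd_mat (gd ! i) (\<omega> i) \<and> mtrace (\<omega> i) = 1" if i: "i < n" for i
  proof -
    let ?d = "dI ! i" and ?e = "dO ! i"
    obtain l :: nat and N where N: "channel_kernel ?d ?e (M i) (\<lambda>x y a b. \<Sum>k<l. N k $$ (a,x) * cnj (N k $$ (b,y)))"
      and N1: "\<And>x y. x < ?d \<Longrightarrow> y < ?d \<Longrightarrow> (\<Sum>k<l. \<Sum>a<?e. cnj (N k $$ (a,x)) * N k $$ (a,y)) = (if x = y then 1 else 0)"
      by (rule is_channel_kernel[OF M[OF i]], rule that)
    have dp: "0 < ?d" "0 < ?e" using pos[OF i] by auto
    have ix: "\<omega> i $$ (p,q) = complex_of_real (1 / real ?d) * (\<Sum>k<l. N k $$ (p mod ?e, p div ?e) * cnj (N k $$ (q mod ?e, q div ?e)))"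
      if "p < gd ! i" "q < gd ! i" for p q
    proof -
      have "p div ?e < ?d" "q div ?e < ?d" "p mod ?e < ?e" "q mod ?e < ?e"
        using that dp unfolding gd_nth[OF i] by (auto simp: less_mult_imp_div_less)
      then show ?thesis using that by (simp add: \<omega>_def channel_kernel_ket_bra[OF N])
    qed
    have "psd_mat (gd ! i) (\<omega> i)"
    proof (rule psd_mat_gramI[OF \<omega>c, where S = "{..<l}" and u = "\<lambda>k p. complex_of_real (sqrt (1 / real ?d)) * N k $$ (p mod ?e, p div ?e)"])
      fix p q assume "p < gd ! i" "q < gd ! i"
      then show "\<omega> i $$ (p,q) = (\<Sum>k<l. (complex_of_real (sqrt (1 / real ?d)) * N k $$ (p mod ?e, p div ?e)) * cnj (complex_of_real (sqrt (1 / real ?d)) * N k $$ (q mod ?e, q div ?e)))"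
        unfolding ix[OF \<open>p < gd ! i\<close> \<open>q < gd ! i\<close>] sum_distrib_left mult.assoc[symmetric]
        by (intro sum.cong refl) (subst sqrt_scale, simp_all add: mult.assoc)
    qed
    moreover have "mtrace (\<omega> i) = (\<Sum>p<?d * ?e. complex_of_real (1 / real ?d) * (\<Sum>k<l. N k $$ (p mod ?e, p div ?e) * cnj (N k $$ (p mod ?e, p div ?e))))"
      using ix by (simp add: mtrace_def carrier_matD[OF \<omega>c] gd_nth[OF i])
    then have "mtrace (\<omega> i) = (\<Sum>x<?d. \<Sum>a<?e. complex_of_real (1 / real ?d) * (\<Sum>k<l. N k $$ (a, x) * cnj (N k $$ (a, x))))"
      unfolding sum_div_mod[where h = "\<lambda>x a. complex_of_real (1 / real ?d) * (\<Sum>k<l. N k $$ (a, x) * cnj (N k $$ (a, x)))"] .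
    then have "mtrace (\<omega> i) = 1"
      unfolding sum_distrib_left[symmetric] using dp by (simp add: kraus_trace[OF N1])
    ultimately show ?thesis by blast
  qed
  define S' where "S' x y a b = (\<Prod>i<n. M i (ket_bra (dI ! i) (mr_digits dI x ! i) (mr_digits dI y ! i)) $$ (mr_digits dO a ! i, mr_digits dO b ! i))" for x y a b
  have MS: "channel_kernel D E (chan_tensor dI dO M) S'"
    using chan_tensor_kernel unfolding S'_def .
  have \<sigma>: "choi_of S' = tensor_upto n \<omega>"
  proof -
    have \<omega>': "\<omega> i \<in> carrier_mat (gd ! i) (gd ! i)" if "i < length gd" for i by (rule \<omega>c)
    note c = tensor_upto_carrier(1)[where rs = gd and cs = gd, OF \<omega>' refl, unfolded length_gd]
    show ?thesis
    proof (rule eq_matI)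
      fix j k assume "j < dim_row (tensor_upto n \<omega>)" "k < dim_col (tensor_upto n \<omega>)"
      then have jk: "j < P" "k < P" using c by auto
      have "tensor_upto n \<omega> $$ (j,k) = (\<Prod>i<n. \<omega> i $$ (mr_digits gd j ! i, mr_digits gd k ! i))"
        using index_tensor_upto[where rs = gd and cs = gd, OF \<omega>' refl jk] by simp
      also have "\<dots> = (\<Prod>i<n. 1 / of_nat (dI ! i) * M i (ket_bra (dI ! i) (mr_digits dI (ref_index j) ! i) (mr_digits dI (ref_index k) ! i)) $$ (mr_digits dO (out_index j) ! i, mr_digits dO (out_index k) ! i))"
        by (intro prod.cong refl) (use mr_digits_less[OF jk(1)] mr_digits_less[OF jk(2)] in \<open>simp add: \<omega>_def ref_index out_index jk\<close>)
      also have "\<dots> = 1 / of_nat D * S' (ref_index j) (ref_index k) (out_index j) (out_index k)"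
        unfolding prod.distrib S'_def by (simp add: prod_list_nth[of dI] prod_dividef)
      finally show "choi_of S' $$ (j,k) = tensor_upto n \<omega> $$ (j,k)" using jk by (simp add: choi_of_def)
    qed (use c in \<open>auto simp: choi_of_def\<close>)
  qed
  have psd_tensor: "psd_mat P (tensor_upto n \<omega>)"
    using psd_tensor_upto[of gd \<omega>] \<omega> by simp
  define \<Phi> where "\<Phi> T' = id_tensor D D E T' (max_ent D)" for T'
  have \<Phi>c: "\<Phi> T' \<in> carrier_mat (D * E) (D * E)" for T' by (simp add: \<Phi>_def id_tensor_def)
  \<comment> \<open>The permutation matrix from the blocked to the grouped ordering. Conjugation by
    it is a Kraus map with one operator, so the comparison in the two orderings is an instance of
    monotonicity.\<close>
  define L where "L = mat P (D * E) (\<lambda>(j,t). if t = blocked_index j then 1 else 0 :: complex)"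
  have L: "L \<in> carrier_mat P (D * E)" by (simp add: L_def)
  have L\<Phi>: "L * \<Phi> T' * adj L = choi_of S'" if "channel_kernel D E T' S'" for T' S'
  proof (rule eq_matI)
    fix j k assume "j < dim_row (choi_of S')" "k < dim_col (choi_of S')"
    then have jk: "j < P" "k < P" by (simp_all add: choi_of_def)
    have "(L * \<Phi> T' * adj L) $$ (j,k) = (\<Sum>t<D * E. \<Sum>t'<D * E. (if t = blocked_index j \<and> t' = blocked_index k then 1 else 0) * \<Phi> T' $$ (t,t'))"
      unfolding index_conj_sum[OF L \<Phi>c jk] using jk by (intro sum.cong refl) (simp add: L_def)
    also have "\<dots> = \<Phi> T' $$ (blocked_index j, blocked_index k)"
      unfolding sum_delta2[OF blocked_index(1)[OF jk(1)] blocked_index(1)[OF jk(2)]] by simp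
    finally show "(L * \<Phi> T' * adj L) $$ (j,k) = choi_of S' $$ (j,k)"
      using jk blocked_index unfolding \<Phi>_def by (simp add: index_id_tensor_max_ent[OF that] choi_of_def)
  qed (auto simp: L_def choi_of_def)
  have L1: "adj L * L = 1\<^sub>m (D * E)"
  proof (rule eq_matI)
    fix t t' assume "t < dim_row (1\<^sub>m (D * E))" "t' < dim_col (1\<^sub>m (D * E))"
    then have t: "t < D * E" "t' < D * E" by auto
    have b: "t = blocked_index j \<longleftrightarrow> j = join_index (t div E) (t mod E)" if "j < P" "t < D * E" for j t
      using blocked_join[OF that(2)] blocked_index[OF that(1)] join_ref_out[OF that(1)] by metis
    have "(adj L * L) $$ (t,t') = (\<Sum>j<P. if j = join_index (t div E) (t mod E) then (if t' = blocked_index j then 1 else 0) else 0)"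
      unfolding index_mult_sum[OF adj_carrier[OF L] L t]
      by (rule sum.cong[OF refl]) (use t b in \<open>auto simp: L_def\<close>)
    also have "\<dots> = (if t' = t then 1 else 0)" using blocked_join[OF t(1)] by simp
    finally show "(adj L * L) $$ (t,t') = 1\<^sub>m (D * E) $$ (t,t')" using t by simp
  qed (auto simp: L_def)
  \<comment> \<open>Gram vectors of the Choi matrix are carried back along the permutation of
    indices. For \<open>chan_tensor\<close> this is how positivity is obtained, starting from that
    of the tensor product of the local Choi states.\<close>
  have psd\<Phi>: "psd_mat (D * E) (\<Phi> T')" if k: "channel_kernel D E T' S'" and p: "psd_mat P (choi_of S')" for T' S'
  proof -
    obtain u where u: "\<And>i j. i < P \<Longrightarrow> j < P \<Longrightarrow> choi_of S' $$ (i,j) = (\<Sum>k<P. u k i * cnj (u k j))"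
      using psd_mat_gram[OF p] by metis
    let ?J = "\<lambda>t. join_index (t div E) (t mod E)"
    show ?thesis
    proof (rule psd_mat_gramI[OF \<Phi>c, where S = "{..<P}" and u = "\<lambda>k t. u k (?J t)"])
      fix t t' assume t: "t < D * E" "t' < D * E"
      then have d: "t div E < D" "t' div E < D" "t mod E < E" "t' mod E < E" using E_pos by (auto simp: less_mult_imp_div_less)
      have "choi_of S' $$ (?J t, ?J t') = \<Phi> T' $$ (t,t')"
        using blocked_join(1)[OF t(1)] blocked_join(1)[OF t(2)] d unfolding \<Phi>_def by (simp add: index_id_tensor_max_ent[OF k t] choi_of_def)
      then show "\<Phi> T' $$ (t,t') = (\<Sum>k<P. u k (?J t) * cnj (u k (?J t')))"
        using u[OF blocked_join(1)[OF t(1)] blocked_join(1)[OF t(2)]] by simp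
    qed
  qed
  have "rel_ent (choi_of S) (tensor_upto n (\<lambda>i. ptrace_keep gd i (choi_of S))) \<le> rel_ent (choi_of S) (tensor_upto n \<omega>)"
    using rel_ent_marginals_le[of gd "choi_of S" \<omega>] \<chi> \<omega> tr\<chi> by simp
  also have "\<dots> = rel_ent (L * \<Phi> T * adj L) (L * \<Phi> (chan_tensor dI dO M) * adj L)"
    unfolding L\<Phi>[OF TS] L\<Phi>[OF MS] \<sigma> ..
  also have "\<dots> \<le> rel_ent (\<Phi> T) (\<Phi> (chan_tensor dI dO M))"
  proof -
    have c: "L * \<Phi> T' * adj L \<in> carrier_mat P P" for T' using L \<Phi>c by (auto dest!: carrier_dims intro!: carrier_matI)
    have c': "mat_sum (D * E) {()} (\<lambda>_. adj L * L) = 1\<^sub>m (D * E)" unfolding L1 by (rule mat_sum_singleton) simp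
    show ?thesis
      using rel_ent_kraus_mono[OF psd\<Phi>[OF TS \<chi>] psd\<Phi>[OF MS psd_tensor[folded \<sigma>]], of "{()}" "\<lambda>_. L" P, OF L c']
      unfolding mat_sum_singleton[of "\<lambda>_. _", OF c] .
  qed
  also have "\<dots> \<le> chan_div D E T (chan_tensor dI dO M)"
    unfolding chan_div_def \<Phi>_def
    by (rule SUP_upper2[where i = "(D, max_ent D)"]) (use is_state_max_ent[OF D_pos] in auto)
  finally show "state_mi gd (choi_state dI dO T) \<le> chan_div D E T (chan_tensor dI dO M)"
    unfolding choi_state_kernel[OF TS] state_mi_choi .
qed

end


section \<open>Twirling and the upper bound\<close>

lemma channel_kernel_cong:
  assumes "channel_kernel d e T S" "\<And>x y a b. x < d \<Longrightarrow> y < d \<Longrightarrow> a < e \<Longrightarrow> b < e \<Longrightarrow> S x y a b = S' x y a b"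
  shows "channel_kernel d e T S'"
  using assms by (simp add: channel_kernel_def)

text \<open>The twirl identity for the matrix unit |b><b'|, read at the entry (a,a'). It is the
  orthogonality relation of an irreducible representation, here drawn from the one-design property
  itself.\<close>

lemma one_design_orthogonality:
  assumes U: "\<And>g. g \<in> A \<Longrightarrow> U g \<in> carrier_mat d d" and A: "finite A" "A \<noteq> {}"
    and twirl: "\<And>Y. Y \<in> carrier_mat d d \<Longrightarrow>
      (1 / of_nat (card A)) \<cdot>\<^sub>m mat_sum d A (\<lambda>g. U g * Y * adj (U g)) = (mtrace Y / of_nat d) \<cdot>\<^sub>m 1\<^sub>m d"
    and ix: "a < d" "b < d" "a' < d" "b' < d"
  shows "(\<Sum>g\<in>A. U g $$ (a,b) * cnj (U g $$ (a',b'))) = (if a = a' \<and> b = b' then of_nat (card A) / of_nat d else 0)"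
proof -
  let ?Y = "ket_bra d b b'"
  have Y: "?Y \<in> carrier_mat d d" by (simp add: ket_bra_def)
  have "(U g * ?Y * adj (U g)) $$ (a,a') = U g $$ (a,b) * cnj (U g $$ (a',b'))" if "g \<in> A" for g
  proof -
    have "(U g * ?Y * adj (U g)) $$ (a,a') = (\<Sum>k<d. \<Sum>l<d. (if k = b \<and> l = b' then 1 else 0) * (U g $$ (a,k) * cnj (U g $$ (a',l))))"
      unfolding index_conj_sum[OF U[OF that] Y ix(1,3)] by (intro sum.cong refl) (simp add: ket_bra_def)
    then show ?thesis unfolding sum_delta2[OF ix(2,4)] by simp
  qed
  then have "mat_sum d A (\<lambda>g. U g * ?Y * adj (U g)) $$ (a,a') = (\<Sum>g\<in>A. U g $$ (a,b) * cnj (U g $$ (a',b')))"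
    unfolding index_mat_sum[OF ix(1,3)] by simp
  moreover have "mtrace ?Y = (if b = b' then 1 else 0)"
  proof -
    have "mtrace ?Y = (\<Sum>i<d. if i = b then (if b = b' then 1 else 0) else 0)"
      unfolding mtrace_def by (intro sum.cong) (auto simp: ket_bra_def)
    then show ?thesis using ix by simp
  qed
  ultimately have "1 / of_nat (card A) * (\<Sum>g\<in>A. U g $$ (a,b) * cnj (U g $$ (a',b'))) = (if b = b' then 1 else 0) / of_nat d * (if a = a' then 1 else 0)"
    using arg_cong[OF twirl[OF Y], of "\<lambda>X. X $$ (a,a')"] ix by simp
  moreover have "(of_nat (card A) :: complex) \<noteq> 0" using A by simp
  ultimately show ?thesis by (auto simp: field_simps split: if_splits)
qed

context grouping
begin

text \<open>For product unitaries the operator conj(U) \<otimes> V is, in the grouped ordering, a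
  product over the pairs R_i X_i; this is what lets a marginal see only its own unitary.\<close>

lemma conj_tensor_local:
  assumes U: "\<And>i. i < n \<Longrightarrow> U i \<in> carrier_mat (dI ! i) (dI ! i)" and V: "\<And>i. i < n \<Longrightarrow> V i \<in> carrier_mat (dO ! i) (dO ! i)"
  shows "conj_tensor (tensor_upto n U) (tensor_upto n V) = tensor_upto n (\<lambda>i. kron (map_mat cnj (U i)) (V i))"
proof -
  have K: "kron (map_mat cnj (U i)) (V i) \<in> carrier_mat (gd ! i) (gd ! i)" if "i < length gd" for i
    using that carrier_matD[OF U] carrier_matD[OF V] by (simp add: kron_def gd_nth)
  have V': "V i \<in> carrier_mat (dO ! i) (dO ! i)" if "i < length dO" for i using V that len by simp
  note c = tensor_upto_carrier(1)[where rs = gd and cs = gd, OF K refl, unfolded length_gd]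
  show ?thesis
  proof (rule eq_matI)
    fix j k assume "j < dim_row (tensor_upto n (\<lambda>i. kron (map_mat cnj (U i)) (V i)))" "k < dim_col (tensor_upto n (\<lambda>i. kron (map_mat cnj (U i)) (V i)))"
    then have jk: "j < P" "k < P" using c by auto
    note R = ref_index(1)[OF jk(1)] ref_index(1)[OF jk(2)] and A = out_index(1)[OF jk(1)] out_index(1)[OF jk(2)]
    have "tensor_upto n (\<lambda>i. kron (map_mat cnj (U i)) (V i)) $$ (j,k) = (\<Prod>i<n. kron (map_mat cnj (U i)) (V i) $$ (mr_digits gd j ! i, mr_digits gd k ! i))"
      using index_tensor_upto[where rs = gd and cs = gd, OF K refl jk] by simp
    also have "\<dots> = (\<Prod>i<n. cnj (U i $$ (mr_digits dI (ref_index j) ! i, mr_digits dI (ref_index k) ! i)) *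
        V i $$ (mr_digits dO (out_index j) ! i, mr_digits dO (out_index k) ! i))"
    proof (rule prod.cong[OF refl])
      fix i assume "i \<in> {..<n}"
      then have i: "i < n" by simp
      have "mr_digits gd j ! i < dI ! i * dO ! i" "mr_digits gd k ! i < dI ! i * dO ! i"
        using mr_digits_less[OF jk(1), of i] mr_digits_less[OF jk(2), of i] i by (simp_all add: gd_nth)
      then show "kron (map_mat cnj (U i)) (V i) $$ (mr_digits gd j ! i, mr_digits gd k ! i) =
         cnj (U i $$ (mr_digits dI (ref_index j) ! i, mr_digits dI (ref_index k) ! i)) * V i $$ (mr_digits dO (out_index j) ! i, mr_digits dO (out_index k) ! i)"
        using carrier_matD[OF U[OF i]] carrier_matD[OF V[OF i]]
        by (simp add: kron_def ref_index(2)[OF _ i] out_index(2)[OF _ i] jk less_mult_imp_div_less)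
    qed
    also have "\<dots> = cnj (tensor_upto n U $$ (ref_index j, ref_index k)) * tensor_upto n V $$ (out_index j, out_index k)"
      using index_tensor_upto[where rs = dI and cs = dI, OF U refl R] index_tensor_upto[where rs = dO and cs = dO, OF V' refl A]
      by (simp add: prod.distrib len)
    finally show "conj_tensor (tensor_upto n U) (tensor_upto n V) $$ (j,k) = tensor_upto n (\<lambda>i. kron (map_mat cnj (U i)) (V i)) $$ (j,k)"
      using jk by (simp add: conj_tensor_def)
  qed (use c in \<open>auto simp: conj_tensor_def\<close>)
qed

text \<open>The optimal local channels are those whose Choi states are the marginals of the Choi state; they
  inherit the covariance.\<close>
theorem chan_mi_le_state_mi_choi:
  assumes T: "is_channel D E T" and cov: "tele_covariant dI dO T G U V"
  shows "chan_mi dI dO T \<le> state_mi gd (choi_state dI dO T)"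
proof -
  obtain m :: nat and K where TS: "channel_kernel D E T (\<lambda>x y a b. \<Sum>k<m. K k $$ (a,x) * cnj (K k $$ (b,y)))"
    and K1: "\<And>x y. x < D \<Longrightarrow> y < D \<Longrightarrow> (\<Sum>k<m. \<Sum>a<E. cnj (K k $$ (a,x)) * K k $$ (a,y)) = (if x = y then 1 else 0)"
    by (rule is_channel_kernel[OF T], rule that)
  define S where "S x y a b = (\<Sum>k<m. K k $$ (a,x) * cnj (K k $$ (b,y)))" for x y a b
  have TS: "channel_kernel D E T S" using TS unfolding S_def .
  have \<chi>: "psd_mat P (choi_of S)" unfolding S_def by (rule psd_choi_of_kraus)
  have tp: "(\<Sum>a<E. S r r' a a) = (if r = r' then 1 else 0)" if "r < D" "r' < D" for r r'
    unfolding S_def by (rule kraus_trace[OF K1 that])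
  have G: "group (G i)" "finite (carrier (G i))" if "i < n" for i
    using cov that unfolding tele_covariant_def by blast+
  have UV: "unitary_mat (dI ! i) (U i g)" "unitary_mat (dO ! i) (V i g)" if "i < n" "g \<in> carrier (G i)" for i g
    using cov that unfolding tele_covariant_def by blast+
  have twirl: "(1 / of_nat (card (carrier (G i)))) \<cdot>\<^sub>m mat_sum (dI ! i) (carrier (G i)) (\<lambda>g. U i g * Y * adj (U i g))
     = (mtrace Y / of_nat (dI ! i)) \<cdot>\<^sub>m 1\<^sub>m (dI ! i)" if "i < n" "Y \<in> carrier_mat (dI ! i) (dI ! i)" for i Y
    using cov that unfolding tele_covariant_def by blast
  have Gne: "carrier (G i) \<noteq> {}" if "i < n" for i
    using group.is_monoid[OF G(1)[OF that]] monoid.one_closed by blast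
  \<comment> \<open>All tuples of local group elements. As a \<open>PiE\<close> set it is finite,
    and sums over it of products factorise into local sums.\<close>
  define \<G> where "\<G> = PiE {..<n} (\<lambda>i. carrier (G i))"
  have \<G>: "g i \<in> carrier (G i)" if "g \<in> \<G>" "i < n" for g i using that by (auto simp: \<G>_def)
  have fin: "finite \<G>" "\<G> \<noteq> {}" using G Gne by (auto simp: \<G>_def PiE_eq_empty_iff intro!: finite_PiE)
  define Ug where "Ug g = tensor_upto n (\<lambda>i. U i (g i))" for g
  define Vg where "Vg g = tensor_upto n (\<lambda>i. V i (g i))" for g
  have Ug: "unitary_mat D (Ug g)" if "g \<in> \<G>" for g
    unfolding Ug_def by (rule unitary_tensor_upto) (use UV \<G>[OF that] in blast)
  have Vg: "unitary_mat E (Vg g)" if "g \<in> \<G>" for g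
    unfolding Vg_def using unitary_tensor_upto[of dO "\<lambda>i. V i (g i)"] UV \<G>[OF that] len by simp
  have covT: "T (Ug g * \<rho> * adj (Ug g)) = Vg g * T \<rho> * adj (Vg g)" if "g \<in> \<G>" "is_state D \<rho>" for g \<rho>
  proof -
    have "\<forall>gs. (\<forall>i<n. gs i \<in> carrier (G i)) \<longrightarrow> (\<forall>\<rho>. is_state D \<rho> \<longrightarrow>
        T (tensor_upto n (\<lambda>i. U i (gs i)) * \<rho> * adj (tensor_upto n (\<lambda>i. U i (gs i))))
        = tensor_upto n (\<lambda>i. V i (gs i)) * T \<rho> * adj (tensor_upto n (\<lambda>i. V i (gs i))))"
      using cov unfolding tele_covariant_def Let_def by blast
    then show ?thesis using \<G>[OF that(1)] that(2) unfolding Ug_def Vg_def by blast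
  qed
  \<comment> \<open>The local orthogonality relations multiply: cardinalities to the number of
    tuples, dimensions to D, and the digitwise deltas to deltas of the full indices.\<close>
  have design: "(\<Sum>g\<in>\<G>. Ug g $$ (a,b) * cnj (Ug g $$ (c,d))) = (if a = c \<and> b = d then of_nat (card \<G>) / of_nat D else 0)"
    if ix: "a < D" "b < D" "c < D" "d < D" for a b c d
  proof -
    let ?d = "\<lambda>x i. mr_digits dI x ! i"
    have Uc: "U i (g i) \<in> carrier_mat (dI ! i) (dI ! i)" if "g \<in> \<G>" "i < n" for g i
      by (rule unitary_matD(1)[OF UV(1)[OF that(2) \<G>[OF that]]])
    have h: "Ug g $$ (x,y) = (\<Prod>i<n. U i (g i) $$ (?d x i, ?d y i))" if "x < D" "y < D" "g \<in> \<G>" for x y g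
      unfolding Ug_def by (rule index_tensor_upto[OF Uc[OF that(3)] refl that(1,2)])
    have "(\<Sum>g\<in>\<G>. Ug g $$ (a,b) * cnj (Ug g $$ (c,d))) = (\<Sum>g\<in>\<G>. \<Prod>i<n. U i (g i) $$ (?d a i, ?d b i) * cnj (U i (g i) $$ (?d c i, ?d d i)))"
    proof (rule sum.cong[OF refl])
      fix g assume g: "g \<in> \<G>"
      show "Ug g $$ (a,b) * cnj (Ug g $$ (c,d)) = (\<Prod>i<n. U i (g i) $$ (?d a i, ?d b i) * cnj (U i (g i) $$ (?d c i, ?d d i)))"
        unfolding h[OF ix(1,2) g] h[OF ix(3,4) g] by (simp add: prod.distrib)
    qed
    also have "\<dots> = (\<Prod>i<n. \<Sum>g\<in>carrier (G i). U i g $$ (?d a i, ?d b i) * cnj (U i g $$ (?d c i, ?d d i)))"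
      unfolding \<G>_def by (rule prod_sum_PiE[symmetric]) (use G in auto)
    also have "\<dots> = (\<Prod>i<n. of_nat (card (carrier (G i))) / of_nat (dI ! i) * ((if ?d a i = ?d c i then 1 else 0) * (if ?d b i = ?d d i then 1 else 0)))"
    proof (rule prod.cong[OF refl])
      fix i assume "i \<in> {..<n}"
      then have i: "i < n" by simp
      have "U i g \<in> carrier_mat (dI ! i) (dI ! i)" if "g \<in> carrier (G i)" for g by (rule unitary_matD(1)[OF UV(1)[OF i that]])
      from one_design_orthogonality[OF this G(2)[OF i] Gne[OF i] twirl[OF i], of "?d a i" "?d b i" "?d c i" "?d d i"]
      show "(\<Sum>g\<in>carrier (G i). U i g $$ (?d a i, ?d b i) * cnj (U i g $$ (?d c i, ?d d i)))
        = of_nat (card (carrier (G i))) / of_nat (dI ! i) * ((if ?d a i = ?d c i then 1 else 0) * (if ?d b i = ?d d i then 1 else 0))"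
        using mr_digits_less[OF _ i] ix by simp
    qed
    also have "\<dots> = of_nat (card \<G>) / of_nat D * ((if a = c then 1 else 0) * (if b = d then 1 else 0))"
      unfolding prod.distrib prod_indicator_mr_digits[OF ix(1,3)] prod_indicator_mr_digits[OF ix(2,4)]
      by (simp add: prod_dividef \<G>_def card_PiE prod_list_nth[of dI])
    finally show ?thesis by simp
  qed
  define \<omega> where "\<omega> i = ptrace_keep gd i (choi_of S)" for i
  have \<omega>c: "\<omega> i \<in> carrier_mat (gd ! i) (gd ! i)" for i unfolding \<omega>_def by simp
  have \<omega>: "psd_mat (gd ! i) (\<omega> i)" if "i < n" for i
    unfolding \<omega>_def by (rule psd_ptrace_keep[OF _ \<chi>]) (use that in simp)
  \<comment> \<open>The channel with Choi state \<open>\<omega> i\<close>; the factor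
    \<open>dI ! i\<close> undoes the normalisation of the local maximally entangled state.\<close>
  define M where "M i Y = mat (dO ! i) (dO ! i) (\<lambda>(a,b). \<Sum>x<dI ! i. \<Sum>y<dI ! i. Y $$ (x,y) *
      (of_nat (dI ! i) * \<omega> i $$ (x * dO ! i + a, y * dO ! i + b)))" for i Y
  have M: "is_channel (dI ! i) (dO ! i) (M i)" if i: "i < n" for i
    unfolding M_def
  proof (rule is_channel_of_choi[OF _ pos(1)[OF i]])
    show "psd_mat (dI ! i * dO ! i) (\<omega> i)" using \<omega>[OF i] by (simp add: gd_nth[OF i])
    show "(\<Sum>a<dO ! i. \<omega> i $$ (x * dO ! i + a, y * dO ! i + a)) = (if x = y then 1 / of_nat (dI ! i) else 0)"
      if "x < dI ! i" "y < dI ! i" for x y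
      unfolding \<omega>_def by (rule sum_ptrace_choi[OF i that]) (rule tp)
  qed
  have Mk: "channel_kernel (dI ! i) (dO ! i) (M i) (\<lambda>x y a b. of_nat (dI ! i) * \<omega> i $$ (x * dO ! i + a, y * dO ! i + b))" for i
    by (simp add: channel_kernel_def M_def)
  define S' where "S' x y a b = (\<Prod>i<n. of_nat (dI ! i) *
      \<omega> i $$ (mr_digits dI x ! i * dO ! i + mr_digits dO a ! i, mr_digits dI y ! i * dO ! i + mr_digits dO b ! i))" for x y a b
  have MS: "channel_kernel D E (chan_tensor dI dO M) S'"
    by (rule channel_kernel_cong[OF chan_tensor_kernel]) (use mr_digits_less len in \<open>auto simp: S'_def channel_kernel_ket_bra[OF Mk] intro!: prod.cong\<close>)
  have \<sigma>: "choi_of S' = tensor_upto n \<omega>" by (rule choi_of_product[OF S'_def \<omega>c])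
  have psd': "psd_mat P (choi_of S')" unfolding \<sigma> using psd_tensor_upto[of gd \<omega>] \<omega> by simp
  have inv: "conj_tensor (Ug g) (Vg g) * choi_of S * adj (conj_tensor (Ug g) (Vg g)) = choi_of S" if g: "g \<in> \<G>" for g
    by (rule choi_of_invariant[OF TS Ug[OF g] Vg[OF g] covT[OF g]])
  \<comment> \<open>The joint invariance passes to each marginal, because local unitaries act on a
    marginal through their own factor only, and from the marginals to their tensor product.\<close>
  have inv': "conj_tensor (Ug g) (Vg g) * choi_of S' * adj (conj_tensor (Ug g) (Vg g)) = choi_of S'" if g: "g \<in> \<G>" for g
  proof -
    define W where "W i = kron (map_mat cnj (U i (g i))) (V i (g i))" for i
    have "unitary_mat (dI ! i * dO ! i) (W i)" if "i < n" for i
      unfolding W_def by (intro unitary_kron unitary_conjugate UV that \<G>[OF g])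
    then have W: "unitary_mat (gd ! i) (W i)" if "i < length gd" for i using that by (simp add: gd_nth)
    have Wc: "W i \<in> carrier_mat (gd ! i) (gd ! i)" if "i < length gd" for i by (rule unitary_matD(1)[OF W[OF that]])
    have ct: "conj_tensor (Ug g) (Vg g) = tensor_upto (length gd) W"
      unfolding Ug_def Vg_def W_def length_gd
      by (rule conj_tensor_local) (use unitary_matD(1)[OF UV(1)] unitary_matD(1)[OF UV(2)] \<G>[OF g] in auto)
    have loc: "W i * \<omega> i * adj (W i) = \<omega> i" if i: "i < length gd" for i
      using ptrace_keep_local_unitary[OF W choi_of_carrier i, of S] inv[OF g] unfolding ct \<omega>_def by simp
    have W\<omega>: "W i * \<omega> i \<in> carrier_mat (gd ! i) (gd ! i)" if "i < length gd" for i by (rule mult_carrier_mat[OF Wc[OF that] \<omega>c])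
    have "tensor_upto (length gd) W * tensor_upto (length gd) \<omega> * adj (tensor_upto (length gd) W) = tensor_upto (length gd) (\<lambda>i. W i * \<omega> i * adj (W i))"
      using Wc \<omega>c W\<omega> by (simp only: tensor_upto_adj tensor_upto_mult adj_carrier)
    also have "\<dots> = tensor_upto (length gd) \<omega>" by (rule tensor_upto_cong) (rule loc)
    finally show ?thesis unfolding ct \<sigma> length_gd .
  qed
  have "chan_mi dI dO T \<le> chan_div D E T (chan_tensor dI dO M)"
    unfolding chan_mi_def by (rule INF_lower) (use M in auto)
  also have "\<dots> \<le> rel_ent (choi_of S) (choi_of S')"
    unfolding chan_div_def
  proof (rule SUP_least)
    fix p :: "nat \<times> complex mat" assume "p \<in> {(r, \<rho>). is_state (r * D) \<rho>}"
    then have "is_state (fst p * D) (snd p)" by auto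
    then show "rel_ent (id_tensor (fst p) D E T (snd p)) (id_tensor (fst p) D E (chan_tensor dI dO M) (snd p)) \<le> rel_ent (choi_of S) (choi_of S')"
      by (intro rel_ent_covariant_le[OF TS MS \<chi> psd' fin, of Vg Ug] Vg design inv inv')
  qed
  also have "\<dots> = state_mi gd (choi_state dI dO T)"
    unfolding \<sigma> choi_state_kernel[OF TS] state_mi_choi \<omega>_def ..
  finally show ?thesis .
qed

section \<open>Unitary channels and the conclusion\<close>

theorem unitary_choi_state_mi:
  assumes two: "n = 2" and W: "unitary_mat D W" and DE: "E = D"
  shows "state_mi gd (choi_state dI dO (\<lambda>\<rho>. W * \<rho> * adj W)) = ereal (2 * vn_entropy (ptrace_keep gd 0 (choi_state dI dO (\<lambda>\<rho>. W * \<rho> * adj W))))"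
    and "vn_entropy (ptrace_keep gd 0 (choi_state dI dO (\<lambda>\<rho>. W * \<rho> * adj W))) = vn_entropy (ptrace_keep gd 1 (choi_state dI dO (\<lambda>\<rho>. W * \<rho> * adj W)))"
    and "is_channel D E (\<lambda>\<rho>. W * \<rho> * adj W)"
proof -
  note Wd = unitary_matD[OF W]
  have "mat_sum D {..<1::nat} (\<lambda>k. adj W * W) = 1\<^sub>m D"
    unfolding Wd(2) lessThan_Suc One_nat_def by (simp add: mat_sum_singleton)
  moreover have "mat_sum D {..<1::nat} (\<lambda>k. W * \<rho> * adj W) = W * \<rho> * adj W" if "\<rho> \<in> carrier_mat D D" for \<rho>
    using Wd(1) that unfolding lessThan_Suc One_nat_def
    by (auto dest!: carrier_dims intro!: carrier_matI mat_sum_singleton)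
  ultimately show "is_channel D E (\<lambda>\<rho>. W * \<rho> * adj W)"
    unfolding is_channel_def DE using Wd(1) by (intro exI[of _ "1::nat"] exI[of _ "\<lambda>_. W"]) auto
  define S where "S x y a b = W $$ (a,x) * cnj (W $$ (b,y))" for x y a b
  have k: "channel_kernel D E (\<lambda>\<rho>. W * \<rho> * adj W) S"
    unfolding channel_kernel_def DE
  proof (intro ballI conjI allI impI)
    fix Y :: "complex mat" assume Y: "Y \<in> carrier_mat D D"
    show "W * Y * adj W \<in> carrier_mat D D" using Wd(1) Y by (auto dest!: carrier_dims intro!: carrier_matI)
    fix a b assume ab: "a < D" "b < D"
    show "(W * Y * adj W) $$ (a,b) = (\<Sum>x<D. \<Sum>y<D. Y $$ (x,y) * S x y a b)"
      unfolding index_conj_sum[OF Wd(1) Y ab] S_def by (simp add: mult_ac)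
  qed
  \<comment> \<open>The vectorisation of \<open>W\<close> over sqrt D, in grouped indices. The
    single Kraus operator makes the Choi state the projection onto this vector, and the orthonormal
    columns of \<open>W\<close> make it a unit vector.\<close>
  define \<psi> where "\<psi> j = complex_of_real (sqrt (1 / real D)) * W $$ (out_index j, ref_index j)" for j
  \<comment> \<open>The grouped dimensions as a literal two-element list, the form in which the
    statement on pure bipartite states is phrased.\<close>
  have gd2: "gd = [gd ! 0, gd ! 1]"
    by (rule nth_equalityI) (use two in \<open>auto simp: less_2_cases_iff nth_Cons split: nat.splits\<close>)
  have PP: "P = gd ! 0 * gd ! 1" by (subst gd2) simp
  have sq: "complex_of_real (1 / real D) * x * cnj y = (complex_of_real (sqrt (1 / real D)) * x) * cnj (complex_of_real (sqrt (1 / real D)) * y)" for x y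
    by (rule sqrt_scale) simp
  have choi: "choi_state dI dO (\<lambda>\<rho>. W * \<rho> * adj W) = mat (gd ! 0 * gd ! 1) (gd ! 0 * gd ! 1) (\<lambda>(x,y). \<psi> x * cnj (\<psi> y))"
    unfolding choi_state_kernel[OF k] choi_of_def PP[symmetric] S_def \<psi>_def mult.assoc[symmetric] sq[unfolded mult.assoc[symmetric]] ..
  have nrm: "(\<Sum>x<gd ! 0 * gd ! 1. \<psi> x * cnj (\<psi> x)) = 1"
  proof -
    have "(\<Sum>x<P. \<psi> x * cnj (\<psi> x)) = (\<Sum>x<P. complex_of_real (1 / real D) * W $$ (out_index x, ref_index x) * cnj (W $$ (out_index x, ref_index x)))"
      unfolding \<psi>_def sq ..
    also have "\<dots> = (\<Sum>r<D. \<Sum>a<E. complex_of_real (1 / real D) * W $$ (a, r) * cnj (W $$ (a, r)))"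
      by (rule sum_grouped[where F = "\<lambda>r a. complex_of_real (1 / real D) * W $$ (a, r) * cnj (W $$ (a, r))"])
    also have "\<dots> = (\<Sum>r<D. complex_of_real (1 / real D) * (\<Sum>a<D. cnj (W $$ (a, r)) * W $$ (a, r)))"
      unfolding DE sum_distrib_left by (intro sum.cong refl) (simp only: mult_ac)
    also have "\<dots> = 1" using D_pos by (simp add: unitary_orthonormal_cols[OF W] del: prod_list_zero_iff)
    finally show ?thesis unfolding PP .
  qed
  note r = state_mi_pure_bipartite[OF nrm, folded choi gd2]
  show "state_mi gd (choi_state dI dO (\<lambda>\<rho>. W * \<rho> * adj W)) = ereal (2 * vn_entropy (ptrace_keep gd 0 (choi_state dI dO (\<lambda>\<rho>. W * \<rho> * adj W))))"
    by (rule r(1))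
  show "vn_entropy (ptrace_keep gd 0 (choi_state dI dO (\<lambda>\<rho>. W * \<rho> * adj W))) = vn_entropy (ptrace_keep gd 1 (choi_state dI dO (\<lambda>\<rho>. W * \<rho> * adj W)))"
    by (rule r(2))
qed

theorem chan_mi_tele_covariant:
  assumes "is_channel D E T" "tele_covariant dI dO T G U V"
  shows "chan_mi dI dO T = state_mi gd (choi_state dI dO T)"
  using chan_mi_le_state_mi_choi[OF assms] state_mi_choi_le_chan_mi[OF assms(1)] by (rule antisym)

end

theorem mainTheorem16:
  shows
  "(\<forall>(dI :: nat list) (dO :: nat list) T (G :: nat \<Rightarrow> 'g monoid) U V.
      2 \<le> length dI \<and> length dO = length dI \<and>
      (\<forall>d\<in>set dI. 0 < d) \<and> (\<forall>d\<in>set dO. 0 < d) \<and>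
      is_channel (prod_list dI) (prod_list dO) T \<and>
      tele_covariant dI dO T G U V
      \<longrightarrow> chan_mi dI dO T = state_mi (grouped_dims dI dO) (choi_state dI dO T))
   \<and>
   (\<forall>(dI :: nat list) (dO :: nat list) W (G :: nat \<Rightarrow> 'g monoid) U V.
      length dI = 2 \<and> length dO = 2 \<and>
      (\<forall>d\<in>set dI. 0 < d) \<and> (\<forall>d\<in>set dO. 0 < d) \<and>
      prod_list dO = prod_list dI \<and> unitary_mat (prod_list dI) W \<and>
      tele_covariant dI dO (\<lambda>\<rho>. W * \<rho> * adj W) G U V
      \<longrightarrow> chan_mi dI dO (\<lambda>\<rho>. W * \<rho> * adj W) / 2
            = ereal (vn_entropy (ptrace_keep (grouped_dims dI dO) 0 (choi_state dI dO (\<lambda>\<rho>. W * \<rho> * adj W))))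
        \<and> chan_mi dI dO (\<lambda>\<rho>. W * \<rho> * adj W) / 2
            = ereal (vn_entropy (ptrace_keep (grouped_dims dI dO) 1 (choi_state dI dO (\<lambda>\<rho>. W * \<rho> * adj W)))))"
proof (intro conjI allI impI; elim conjE)
  fix dI dO :: "nat list" and T and G :: "nat \<Rightarrow> 'g monoid" and U V
  assume "length dO = length dI" "\<forall>d\<in>set dI. 0 < d" "\<forall>d\<in>set dO. 0 < d"
  then interpret grouping dI dO by unfold_locales auto
  assume "is_channel (prod_list dI) (prod_list dO) T" "tele_covariant dI dO T G U V"
  then show "chan_mi dI dO T = state_mi (grouped_dims dI dO) (choi_state dI dO T)"
    by (rule chan_mi_tele_covariant)
next
  fix dI dO :: "nat list" and W and G :: "nat \<Rightarrow> 'g monoid" and U V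
  let ?T = "\<lambda>\<rho>. W * \<rho> * adj W"
  let ?S = "\<lambda>i. vn_entropy (ptrace_keep (grouped_dims dI dO) i (choi_state dI dO ?T))"
  assume l: "length dI = 2" "length dO = 2" and p: "\<forall>d\<in>set dI. 0 < d" "\<forall>d\<in>set dO. 0 < d"
    and e: "prod_list dO = prod_list dI" and W: "unitary_mat (prod_list dI) W" and c: "tele_covariant dI dO ?T G U V"
  from l p interpret grouping dI dO by unfold_locales auto
  note u = unitary_choi_state_mi[OF l(1) W e]
  have half: "ereal (2 * x) / 2 = ereal x" for x
    by (metis ereal_divide nonzero_mult_div_cancel_left numeral_eq_ereal zero_neq_numeral)
  \<comment> \<open>That conjugation by \<open>W\<close> is a channel is derived from its unitarity,
    as \<open>u(3)\<close>; the general equality then applies, and the mutual information of the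
    pure Choi state is twice a finite entropy.\<close>
  have "chan_mi dI dO ?T / 2 = ereal (?S 0)"
    unfolding chan_mi_tele_covariant[OF u(3) c] u(1) by (rule half)
  then show "chan_mi dI dO ?T / 2 = ereal (?S 0)" "chan_mi dI dO ?T / 2 = ereal (?S 1)"
    using u(2) by simp_all
qed

end
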